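(* Let $\boldsymbol{\gamma}\in\mathcal{P}_2(\mathcal{C}^2)$. Provided that there exists a dynamic plan $\boldsymbol{\mu}^*\in\mathcal{P}(\Omega)$ satisfying the homogeneous coupling constraint (with respect to $\boldsymbol{\gamma}$) and the homogeneous marginal constraint and such that $\mathcal{A}(\boldsymbol{\mu}^* )<+\infty$, the minimum of the action in the generalized $H(\mathrm{div})$ geodesic problem with coupling $\boldsymbol{\gamma}$ is attained.
   Context: Setting. $M$ is the closure of a bounded open subset of $\mathbb{R}^d$ with Lipschitz boundary, $\rho_0$ is the Lebesgue measure on $M$ normalized so that $\rho_0(M)=1$, and $T>0$ is fixed. $\mathcal{C}=(M\times\mathbb{R}_{\ge0})/(M\times\{0\})$ is the cone over $M$, with points $[x,r]$ and apex $o=[x,0]$. Fix $\bar x\in M$; $\pi_x([x,r])=x$ if $r>0$, $\pi_x(o)=\bar x$, $\pi_r([x,r])=r$. The cone carries the metric tensor $g_{\mathcal{C}}=r^2g+\mathrm{d}r^2$ on $M\times\mathbb{R}_{>0}$ ($g$ Euclidean) and the distance $d_{\mathcal{C}}([x_1,r_1],[x_2,r_2])^2=r_1^2+r_2^2-2r_1r_2\cos(\min(|x_1-x_2|,\pi))$. $\Omega=C^0([0,T];\mathcal{C})$ is the space of continuous paths $\mathrm{z}:t\mapsto z_t=[x_t,r_t]$, with $x_t=\pi_x(z_t)$, $r_t=\pi_r(z_t)$. $AC^2([0,T];\mathcal{C})$ is the set of absolutely continuous paths whose metric derivative is in $L^2$; for such paths $|\dot z_t|^2_{g_{\mathcal{C}}}=r_t^2|\dot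 x_t|^2+\dot r_t^2$ where $r_t>0$ and the derivatives exist, and $0$ otherwise. $\mathcal{A}(\mathrm{z})=\int_0^T|\dot z_t|^2_{g_{\mathcal{C}}}\mathrm{d}t$ if $\mathrm{z}\in AC^2([0,T];\mathcal{C})$, $+\infty$ otherwise; $\mathcal{A}(\boldsymbol{\mu})=\int_\Omega\mathcal{A}(\mathrm{z})\,\mathrm{d}\boldsymbol{\mu}(\mathrm{z})$. A function $f:\mathcal{C}^2\to\mathbb{R}$ is 2-homogeneous if $f([x_1,\lambda r_1],[x_2,\lambda r_2])=\lambda^2f([x_1,r_1],[x_2,r_2])$ for all $\lambda>0$. Generalized $H(\mathrm{div})$ geodesic problem: given $\boldsymbol{\gamma}\in\mathcal{P}_2(\mathcal{C}^2)$ (Borel probability measures with finite second moment), minimize $\mathcal{A}(\boldsymbol{\mu})$ among dynamic plans $\boldsymbol{\mu}\in\mathcal{P}(\Omega)$ (Borel probability measures on $\Omega$) satisfying the homogeneous coupling constraint $\int_\Omega f(z_0,z_T)\,\mathrm{d}\boldsymbol{\mu}=\int_{\mathcal{C}^2}f\,\mathrm{d}\boldsymbol{\gamma}$ for all 2-homogeneous continuous $f:\mathcal{C}^2\to\mathbb{R}$, and the homogeneous marginal constraint $\int_\Omega\int_0^Tf(t,x_t)r_t^2\,\mathrm{d}t\,\mathrm{d}\boldsymbol{\mu}=\int_M\int_0^Tf(t,x)\,\mathrm{d}t\,\mathrm{d}\rho_0$ for all $f\in C^0([0,T]\times M)$. *)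

theory Defs
  imports "HOL-Probability.Probability"
begin

section \<open>The cone over a metric space\<close>

definition cone_dist_fun :: "real \<Rightarrow> real \<Rightarrow> real \<Rightarrow> real" where
  "cone_dist_fun \<theta> r s = sqrt (r\<^sup>2 + s\<^sup>2 - 2 * r * s * cos \<theta>)"

lemma cone_dist_fun_radicand:
  "r\<^sup>2 + s\<^sup>2 - 2 * r * s * cos \<theta> = (r - s)\<^sup>2 + 2 * (r * s) * (1 - cos (\<theta>::real))"
  by (simp add: power2_eq_square algebra_simps)

lemma cone_dist_fun_radicand_nonneg:
  assumes "r \<ge> 0" "s \<ge> 0"
  shows "r\<^sup>2 + s\<^sup>2 - 2 * r * s * cos (\<theta>::real) \<ge> 0"
  unfolding cone_dist_fun_radicand using assms by simp

lemma cone_dist_fun_eq_0_iff: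
  assumes "r \<ge> 0" "s \<ge> 0" "0 \<le> \<theta>" "\<theta> \<le> pi"
  shows "cone_dist_fun \<theta> r s = 0 \<longleftrightarrow> r = s \<and> (\<theta> = 0 \<or> r = 0)"
proof -
  have nn: "(r - s)\<^sup>2 \<ge> 0" "2 * (r * s) * (1 - cos \<theta>) \<ge> 0"
    using assms by simp_all
  have "cos \<theta> = 1 \<longleftrightarrow> \<theta> = 0"
    using cos_inj_pi[of \<theta> 0] assms by auto
  then show ?thesis
    unfolding cone_dist_fun_def cone_dist_fun_radicand
    using add_nonneg_eq_0_iff[OF nn] by auto
qed

lemma cmod_rcis_diff: "cmod (rcis r a - rcis s b) = cone_dist_fun (a - b) r s"
proof -
  have "(cmod (rcis r a - rcis s b))\<^sup>2 =
      r\<^sup>2 * ((sin a)\<^sup>2 + (cos a)\<^sup>2) + s\<^sup>2 * ((sin b)\<^sup>2 + (cos b)\<^sup>2) - 2 * r * s * cos (a - b)"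
    unfolding cmod_power2 cos_diff
    by (simp add: power2_eq_square algebra_simps del: sin_cos_squared_add sin_cos_squared_add2 sin_cos_squared_add3)
  then have "(cmod (rcis r a - rcis s b))\<^sup>2 = r\<^sup>2 + s\<^sup>2 - 2 * r * s * cos (a - b)"
    by simp
  then show ?thesis
    unfolding cone_dist_fun_def by (metis norm_ge_zero real_sqrt_unique)
qed

lemma cone_dist_fun_mono:
  assumes "r \<ge> 0" "s \<ge> 0" "0 \<le> \<theta>" "\<theta> \<le> \<theta>'" "\<theta>' \<le> pi"
  shows "cone_dist_fun \<theta> r s \<le> cone_dist_fun \<theta>' r s"
proof -
  have "cos \<theta>' \<le> cos \<theta>"
    using assms by (simp add: cos_monotone_0_pi_le)
  then have "(r * s) * cos \<theta>' \<le> (r * s) * cos \<theta>"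
    using assms by (intro mult_left_mono) auto
  then show ?thesis unfolding cone_dist_fun_def by (simp add: mult.assoc)
qed

lemma cone_dist_fun_planar_triangle:
  "cone_dist_fun (\<alpha> + \<beta>) r t \<le> cone_dist_fun \<alpha> r s + cone_dist_fun \<beta> s t"
proof -
  have "cmod (rcis r (\<alpha> + \<beta>) - rcis t 0)
      \<le> cmod (rcis r (\<alpha> + \<beta>) - rcis s \<beta>) + cmod (rcis s \<beta> - rcis t 0)"
    using norm_triangle_ineq[of "rcis r (\<alpha> + \<beta>) - rcis s \<beta>" "rcis s \<beta> - rcis t 0"] by simp
  then show ?thesis unfolding cmod_rcis_diff by simp
qed

lemma cone_dist_fun_triangle:
  assumes r: "r \<ge> 0" "s \<ge> 0" "t \<ge> 0" and \<alpha>: "0 \<le> \<alpha>" "\<alpha> \<le> pi" and \<beta>: "0 \<le> \<beta>" "\<beta> \<le> pi"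
    and \<gamma>: "0 \<le> \<gamma>" "\<gamma> \<le> pi" "\<gamma> \<le> \<alpha> + \<beta>"
  shows "cone_dist_fun \<gamma> r t \<le> cone_dist_fun \<alpha> r s + cone_dist_fun \<beta> s t"
proof (cases "\<alpha> + \<beta> \<le> pi")
  case True
  then show ?thesis
    using cone_dist_fun_mono[of r t \<gamma> "\<alpha> + \<beta>"] cone_dist_fun_planar_triangle[of \<alpha> \<beta> r t s] assms
    by linarith
next
  case False
  then have "cone_dist_fun (pi - \<alpha>) s t \<le> cone_dist_fun \<beta> s t"
    using assms by (intro cone_dist_fun_mono) auto
  moreover have "cone_dist_fun \<gamma> r t \<le> cone_dist_fun pi r t"
    using assms by (intro cone_dist_fun_mono) auto
  ultimately show ?thesis
    using cone_dist_fun_planar_triangle[of \<alpha> "pi - \<alpha>" r t s] by simp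
qed

definition cone_rel :: "'a \<times> real \<Rightarrow> 'a \<times> real \<Rightarrow> bool" where
  "cone_rel p q \<longleftrightarrow> snd p \<ge> 0 \<and> snd p = snd q \<and> (fst p = fst q \<or> snd p = 0)"

text \<open>The quotient of pairs \<open>(x, r)\<close>, \<open>r \<ge> 0\<close>, that identifies all pairs with \<open>r = 0\<close>.\<close>

quotient_type 'a cone = "'a \<times> real" / partial: cone_rel
proof (rule part_equivpI)
  show "\<exists>x::'a \<times> real. cone_rel x x"
    by (rule exI[of _ "(undefined, 0)"]) (simp add: cone_rel_def)
  show "symp (cone_rel :: 'a \<times> real \<Rightarrow> _)"
    by (auto simp: symp_def cone_rel_def)
  show "transp (cone_rel :: 'a \<times> real \<Rightarrow> _)"
    by (auto simp: transp_def cone_rel_def)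
qed

text \<open>The point \<open>[x, r]\<close>. Only \<open>r \<ge> 0\<close> is meaningful; negative radii are sent to the apex.\<close>

lift_definition cone_pt :: "'a \<Rightarrow> real \<Rightarrow> 'a cone" is "\<lambda>x r. (x, max 0 r)"
  by (simp add: cone_rel_def)

lift_definition cone_radius :: "'a cone \<Rightarrow> real" is snd
  by (auto simp: cone_rel_def)

text \<open>The first argument is the base point \<open>\<pi>\<^sub>x(o)\<close> attributed to the apex \<open>o\<close>.\<close>

lift_definition cone_base :: "'a \<Rightarrow> 'a cone \<Rightarrow> 'a" is
  "\<lambda>xbar p. if snd p > 0 then fst p else xbar"
  by (auto simp: cone_rel_def)

lemma cone_radius_pt [simp]: "r \<ge> 0 \<Longrightarrow> cone_radius (cone_pt x r) = r"
  by transfer simp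

lemma cone_base_pt [simp]: "r > 0 \<Longrightarrow> cone_base xbar (cone_pt x r) = x"
  by transfer simp

lemma cone_base_apex [simp]: "cone_base xbar (cone_pt x 0) = xbar"
  by transfer simp

lemma cone_pt_eq_iff:
  "r \<ge> 0 \<Longrightarrow> s \<ge> 0 \<Longrightarrow> cone_pt x r = cone_pt y s \<longleftrightarrow> r = s \<and> (x = y \<or> r = 0)"
  by transfer (auto simp: cone_rel_def)

instantiation cone :: (metric_space) metric_space
begin

lift_definition dist_cone :: "'a cone \<Rightarrow> 'a cone \<Rightarrow> real" is
  "\<lambda>p q. cone_dist_fun (min (dist (fst p) (fst q)) pi) (snd p) (snd q)"
  by (auto simp: cone_rel_def cone_dist_fun_def)

definition uniformity_cone_def:
  "(uniformity :: ('a cone \<times> 'a cone) filter) = (INF e\<in>{0<..}. principal {(x, y). dist x y < e})"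

definition open_cone_def:
  "open (U :: 'a cone set) \<longleftrightarrow> (\<forall>x\<in>U. eventually (\<lambda>(x', y). x' = x \<longrightarrow> y \<in> U) uniformity)"

instance
proof
  fix p q u :: "'a cone"
  show "dist p q = 0 \<longleftrightarrow> p = q"
    by transfer (auto simp: cone_rel_def cone_dist_fun_eq_0_iff min_def)
  have comm: "dist a b = dist b a" for a b :: "'a cone"
    by transfer (simp add: dist_commute cone_dist_fun_def algebra_simps)
  have "dist p q \<le> dist p u + dist u q"
  proof transfer
    fix p q u :: "'a \<times> real"
    assume "cone_rel p p" "cone_rel q q" "cone_rel u u"
    then show "cone_dist_fun (min (dist (fst p) (fst q)) pi) (snd p) (snd q)
        \<le> cone_dist_fun (min (dist (fst p) (fst u)) pi) (snd p) (snd u)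
          + cone_dist_fun (min (dist (fst u) (fst q)) pi) (snd u) (snd q)"
      using dist_triangle[of "fst p" "fst q" "fst u"] pi_gt_zero
      by (intro cone_dist_fun_triangle; simp add: cone_rel_def min_def)
        (smt (verit, best) zero_le_dist)
  qed
  then show "dist p q \<le> dist p u + dist q u"
    using comm[of u q] by simp
qed (simp_all add: uniformity_cone_def open_cone_def)

end

lemma dist_cone_pt:
  assumes "r \<ge> 0" "s \<ge> 0"
  shows "(dist (cone_pt x r) (cone_pt y s))\<^sup>2 = r\<^sup>2 + s\<^sup>2 - 2 * r * s * cos (min (dist x y) pi)"
proof -
  have "dist (cone_pt x r) (cone_pt y s) = cone_dist_fun (min (dist x y) pi) r s"
    using assms by transfer simp
  then show ?thesis
    using cone_dist_fun_radicand_nonneg[OF assms] by (simp add: cone_dist_fun_def)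
qed

text \<open>The cone over a subset \<open>M\<close>, as a metric subspace of the cone over the whole space:
  the cone distance only involves the ambient distance between base points.\<close>

definition cone_over :: "'a set \<Rightarrow> 'a cone set" where
  "cone_over M = {cone_pt x r | x r. x \<in> M \<and> r \<ge> 0}"


section \<open>Domains and probability measures\<close>

text \<open>Near each boundary point, \<open>U\<close> is the strict epigraph, in some direction \<open>e\<close>, of a Lipschitz
  function on the hyperplane orthogonal to \<open>e\<close>.\<close>

definition lipschitz_boundary :: "'a::euclidean_space set \<Rightarrow> bool" where
  "lipschitz_boundary U \<longleftrightarrow>
    (\<forall>p\<in>frontier U. \<exists>V e L (\<phi> :: 'a \<Rightarrow> real).
        open V \<and> p \<in> V \<and> norm e = 1 \<and> L-lipschitz_on {y. y \<bullet> e = 0} \<phi> \<and>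
        U \<inter> V = {x\<in>V. \<phi> (x - (x \<bullet> e) *\<^sub>R e) < x \<bullet> e})"

abbreviation normalized_lebesgue :: "'a::euclidean_space set \<Rightarrow> 'a measure" where
  "normalized_lebesgue M \<equiv> uniform_measure lborel M"

text \<open>Borel probability measures on a subset \<open>S\<close> of a metric space with finite second moment.\<close>

definition P2 :: "'b::metric_space set \<Rightarrow> 'b measure set" where
  "P2 S = {\<gamma>. sets \<gamma> = sets (restrict_space borel S) \<and> prob_space \<gamma> \<and>
              (\<exists>p\<^sub>0\<in>S. integrable \<gamma> (\<lambda>p. (dist p p\<^sub>0)\<^sup>2))}"


section \<open>Paths and their action\<close>

text \<open>Continuous paths on \<open>[0,T]\<close> in the cone over \<open>M\<close> with the uniform distance.
  The elements are functions on \<open>real\<close> that are \<open>undefined\<close> outside \<open>[0,T]\<close>.\<close>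

definition path_metric :: "'a::metric_space set \<Rightarrow> real \<Rightarrow> (real \<Rightarrow> 'a cone) metric" where
  "path_metric M T = cfunspace (top_of_set {0..T}) (submetric euclidean_metric (cone_over M))"

lemma mspace_path_metric:
  "mspace (path_metric M T) =
     {z \<in> extensional {0..T}. z ` {0..T} \<subseteq> cone_over M \<and> continuous_on {0..T} z}"
proof -
  have top: "mtopology_of (submetric euclidean_metric (cone_over M)) = top_of_set (cone_over M)"
    by (simp add: mtopology_of_submetric)
  have bdd: "Metric_space.mbounded (cone_over M) dist (z ` {0..T})"
    if "continuous_on {0..T} z" "z ` {0..T} \<subseteq> cone_over M" for z :: "real \<Rightarrow> 'a cone"
  proof -
    interpret Metric_space "cone_over M" dist
      by unfold_locales (auto simp: dist_commute dist_triangle)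
    have "bounded (z ` {0..T})"
      using that(1) by (intro compact_imp_bounded compact_continuous_image) auto
    then show ?thesis
      using that(2) unfolding mbounded_alt bounded_def
      by (metis bounded_two_points \<open>bounded (z ` {0..T})\<close>)
  qed
  show ?thesis
    unfolding path_metric_def mspace_cfunspace top
    using bdd by (auto simp: continuous_map_in_subtopology image_subset_iff_funcset)
qed

definition path_borel :: "'a::metric_space set \<Rightarrow> real \<Rightarrow> (real \<Rightarrow> 'a cone) measure" where
  "path_borel M T =
     sigma (mspace (path_metric M T)) {W. openin (mtopology_of (path_metric M T)) W}"

text \<open>Absolute continuity for paths in metric spaces, in the sense of Ambrosio, Gigli and Savare.\<close>

definition absolutely_continuous_path :: "real \<Rightarrow> (real \<Rightarrow> 'b::metric_space) \<Rightarrow> bool" where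
  "absolutely_continuous_path T z \<longleftrightarrow>
     (\<exists>m. set_integrable lebesgue {0..T} m \<and>
          (\<forall>s t. 0 \<le> s \<and> s \<le> t \<and> t \<le> T \<longrightarrow> dist (z s) (z t) \<le> (LINT u:{s..t}|lebesgue. m u)))"

text \<open>For an absolutely continuous path the limit exists for almost every \<open>t\<close>; where it does not,
  the value is an arbitrary constant.\<close>

definition metric_derivative :: "real \<Rightarrow> (real \<Rightarrow> 'b::metric_space) \<Rightarrow> real \<Rightarrow> real" where
  "metric_derivative T z t = Lim (at t within {0..T}) (\<lambda>s. dist (z s) (z t) / \<bar>s - t\<bar>)"

definition AC2 :: "real \<Rightarrow> (real \<Rightarrow> 'b::metric_space) \<Rightarrow> bool" where
  "AC2 T z \<longleftrightarrow> absolutely_continuous_path T z \<and>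
     set_integrable lebesgue {0..T} (\<lambda>t. (metric_derivative T z t)\<^sup>2)"

definition cone_speed_sq ::
    "'a::euclidean_space \<Rightarrow> real \<Rightarrow> (real \<Rightarrow> 'a cone) \<Rightarrow> real \<Rightarrow> real" where
  "cone_speed_sq xbar T z t =
    (let x = (\<lambda>s. cone_base xbar (z s)); r = (\<lambda>s. cone_radius (z s)); F = at t within {0..T} in
     if r t > 0 \<and> x differentiable F \<and> r differentiable F
     then (r t)\<^sup>2 * (norm (vector_derivative x F))\<^sup>2 + (vector_derivative r F)\<^sup>2
     else 0)"

definition path_action :: "'a::euclidean_space \<Rightarrow> real \<Rightarrow> (real \<Rightarrow> 'a cone) \<Rightarrow> ennreal" where
  "path_action xbar T z =
    (if AC2 T z then \<integral>\<^sup>+t\<in>{0..T}. ennreal (cone_speed_sq xbar T z t) \<partial>lebesgue else \<infinity>)"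

definition action ::
    "'a::euclidean_space \<Rightarrow> real \<Rightarrow> (real \<Rightarrow> 'a cone) measure \<Rightarrow> ennreal" where
  "action xbar T \<mu> = (\<integral>\<^sup>+z. path_action xbar T z \<partial>\<mu>)"


section \<open>The generalized geodesic problem\<close>

definition dynamic_plans :: "'a::metric_space set \<Rightarrow> real \<Rightarrow> (real \<Rightarrow> 'a cone) measure set" where
  "dynamic_plans M T = {\<mu>. sets \<mu> = sets (path_borel M T) \<and> prob_space \<mu>}"

definition homogeneous2 :: "'a set \<Rightarrow> ('a cone \<times> 'a cone \<Rightarrow> real) \<Rightarrow> bool" where
  "homogeneous2 M f \<longleftrightarrow>
    (\<forall>x\<^sub>1\<in>M. \<forall>x\<^sub>2\<in>M. \<forall>r\<^sub>1\<ge>0. \<forall>r\<^sub>2\<ge>0. \<forall>c>0.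
       f (cone_pt x\<^sub>1 (c * r\<^sub>1), cone_pt x\<^sub>2 (c * r\<^sub>2)) = c\<^sup>2 * f (cone_pt x\<^sub>1 r\<^sub>1, cone_pt x\<^sub>2 r\<^sub>2))"

text \<open>Both constraints are stated with \<^const>\<open>has_bochner_integral\<close>, since the Bochner integral
  of a non-integrable function is \<open>0\<close> by convention: the integrals over path space are required
  to exist.\<close>

definition homogeneous_coupling ::
    "'a::metric_space set \<Rightarrow> real \<Rightarrow> ('a cone \<times> 'a cone) measure \<Rightarrow> (real \<Rightarrow> 'a cone) measure \<Rightarrow> bool" where
  "homogeneous_coupling M T \<gamma> \<mu> \<longleftrightarrow>
    (\<forall>f. continuous_on (cone_over M \<times> cone_over M) f \<and> homogeneous2 M f \<longrightarrow>
         has_bochner_integral \<mu> (\<lambda>z. f (z 0, z T)) (\<integral>p. f p \<partial>\<gamma>))"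

definition homogeneous_marginal ::
    "'a::euclidean_space \<Rightarrow> 'a set \<Rightarrow> real \<Rightarrow> (real \<Rightarrow> 'a cone) measure \<Rightarrow> bool" where
  "homogeneous_marginal xbar M T \<mu> \<longleftrightarrow>
    (\<forall>f :: real \<times> 'a \<Rightarrow> real. continuous_on ({0..T} \<times> M) f \<longrightarrow>
         has_bochner_integral \<mu>
           (\<lambda>z. LINT t:{0..T}|lborel. f (t, cone_base xbar (z t)) * (cone_radius (z t))\<^sup>2)
           (LINT x:M|normalized_lebesgue M. (LINT t:{0..T}|lborel. f (t, x))))"

definition admissible_plans ::
    "'a::euclidean_space \<Rightarrow> 'a set \<Rightarrow> real \<Rightarrow> ('a cone \<times> 'a cone) measure \<Rightarrow>
     (real \<Rightarrow> 'a cone) measure set" where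
  "admissible_plans xbar M T \<gamma> =
    {\<mu> \<in> dynamic_plans M T. homogeneous_coupling M T \<gamma> \<mu> \<and> homogeneous_marginal xbar M T \<mu>}"

end

theory Submission
  imports Defs "HOL-Complex_Analysis.Great_Picard"
begin

text \<open>Constraints and action are 2-homogeneous under dilations of paths, so the plans of a minimising
  sequence can be normalised to be carried by paths with
  \<open>\<integral>r\<^sub>t\<^sup>2 dt + r\<^sub>0\<^sup>2 + r\<^sub>T\<^sup>2 = \<kappa>\<close>, where \<open>\<kappa>\<close> is the value of the corresponding
  integral prescribed by the constraints. On these paths every constraint functional is bounded,
  and the action bound makes them equicontinuous up to small mass, hence the plans are tight.
  Along a subsequence with an almost surely convergent representation the constraints pass to
  the limit by dominated convergence and the action by Fatou's lemma.

  Measurability and lower semicontinuity of the action come from writing it as the supremum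
  over \<open>n\<close> of the sums of \<open>d(z\<^sub>s, z\<^sub>t)\<^sup>2 / (t - s)\<close> over the dyadic partition of level \<open>n\<close>.
  The cone over a bounded set is bi-Lipschitz equivalent to its image under
  \<open>[x, r] \<mapsto> (r, r x)\<close>, which reduces this identity to the almost everywhere differentiability of
  real functions; these are represented as integrals because their dyadic difference
  quotients form a martingale bounded in \<open>L\<^sup>2\<close>.\<close>

section \<open>Functions with square-integrable difference quotients\<close>

text \<open>The constraints prescribe integrals of functionals that grow quadratically in the
  radius, and before normalisation only their means are under control. In a weak limit part of these
  integrals could be lost along paths of large radius and small probability. Multiplying the radius
  of a path by \<open>c\<close> and its weight by \<open>1/c^2\<close> changes no 2-homogeneous
  integral, so large radii can be traded for mass. The normalised quantity contains the endpoint
  radii because the coupling sees only the endpoints, which the time integral of \<open>r^2\<close>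
  does not control. A second obstacle is the apex, where the base point jumps. The pair
  \<open>(r, r x)\<close> stays Lipschitz there, and in the marginal constraint the factor
  \<open>r^2\<close> removes the jump. Finally, the paths form a carrier set inside a function type.
  The compactness argument for their laws is therefore moved to the real line by coding points as
  reals; weak limits and almost surely convergent representations are found there and
  decoded.\<close>

text \<open>The hypothesis \<open>orth\<close> makes \<open>k m - k n\<close> orthogonal to
  \<open>k n\<close> in L2, so the squared norms grow by exactly the squared norm of the increment.
  Being bounded, they converge, and the sequence is Cauchy in L2. A fast subsequence then converges
  almost everywhere and in L1 as a telescoping series; the conclusion records its indefinite
  integrals.\<close>

lemma orthogonal_increments_L1_limit:
  fixes k :: "nat \<Rightarrow> 'b \<Rightarrow> real"
  assumes N: "finite_measure N"
    and meas [measurable]: "\<And>n. k n \<in> borel_measurable N"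
    and sq: "\<And>m n. integrable N (\<lambda>x. k m x * k n x)"
    and orth: "\<And>m n. n \<le> m \<Longrightarrow> (\<integral>x. k m x * k n x \<partial>N) = (\<integral>x. k n x * k n x \<partial>N)"
    and bd: "\<And>n. (\<integral>x. k n x * k n x \<partial>N) \<le> K"
  obtains \<phi> :: "nat \<Rightarrow> nat" and f where "strict_mono \<phi>" "integrable N f"
    "\<forall>A\<in>sets N.
      (\<lambda>j. \<integral>x. indicator A x * k (\<phi> j) x \<partial>N) \<longlonglongrightarrow> (\<integral>x. indicator A x * f x \<partial>N)"
proof -
  interpret finite_measure N by fact
  define c where "c n = (\<integral>x. k n x * k n x \<partial>N)" for n
  have diff: "integrable N (\<lambda>x. (k m x - k n x)\<^sup>2)" for m n
    unfolding power2_diff using sq[of m m] sq[of n n] sq[of m n]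
    by (intro Bochner_Integration.integrable_add Bochner_Integration.integrable_diff) (auto simp: power2_eq_square mult.assoc)
  have diffI: "(\<integral>x. (k m x - k n x)\<^sup>2 \<partial>N) = c m - c n" if "n \<le> m" for m n
  proof -
    have "(\<integral>x. (k m x - k n x)\<^sup>2 \<partial>N) = (\<integral>x. k m x * k m x + k n x * k n x - 2 * (k m x * k n x) \<partial>N)"
      by (intro Bochner_Integration.integral_cong) (auto simp: power2_eq_square algebra_simps)
    also have "\<dots> = c m + c n - 2 * (\<integral>x. k m x * k n x \<partial>N)"
      using sq by (simp add: c_def)
    finally show ?thesis using orth[OF that] by (simp add: c_def)
  qed
  have mono: "c n \<le> c m" if "n \<le> m" for m n
  proof -
    have "0 \<le> (\<integral>x. (k m x - k n x)\<^sup>2 \<partial>N)" by (intro integral_nonneg_AE) auto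
    with diffI[OF that] show ?thesis by simp
  qed
  have "convergent c"
    by (rule incseq_convergent[of c K]) (use bd mono in \<open>auto simp: c_def[symmetric] incseq_def convergent_def\<close>)
  then have "Cauchy c" by (rule convergent_Cauchy)
  then have "\<forall>j. \<exists>M. \<forall>m\<ge>M. \<forall>n\<ge>M. \<bar>c m - c n\<bar> < (1/4::real)^j"
    by (auto simp: Cauchy_def dist_real_def)
  then obtain Q where Q: "\<And>j m n. m \<ge> Q j \<Longrightarrow> n \<ge> Q j \<Longrightarrow> \<bar>c m - c n\<bar> < (1/4::real)^j"
    by metis
  \<comment> \<open>Summing the thresholds makes \<open>\<phi>\<close> strictly increasing and keeps
    \<open>\<phi> j\<close> above \<open>Q j\<close>.\<close>
  define \<phi> where "\<phi> j = (\<Sum>i\<le>j. Suc (Q i))" for j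
  have phi: "strict_mono \<phi>" by (intro strict_monoI_Suc) (simp add: \<phi>_def)
  have phiQ: "Q j \<le> \<phi> j" for j
  proof -
    have "Suc (Q j) \<le> (\<Sum>i\<le>j. Suc (Q i))" by (rule member_le_sum) auto
    then show ?thesis by (simp add: \<phi>_def)
  qed
  define g where "g j x = k (\<phi> (Suc j)) x - k (\<phi> j) x" for j x
  have [measurable]: "g j \<in> borel_measurable N" for j unfolding g_def by measurable
  have ki: "integrable N (k n)" for n
  proof (rule Bochner_Integration.integrable_bound)
    show "integrable N (\<lambda>x. 1 + k n x * k n x)" using sq by (intro Bochner_Integration.integrable_add) auto
    show "AE x in N. norm (k n x) \<le> norm (1 + k n x * k n x)"
    proof (intro always_eventually allI)
      fix x
      have "\<bar>k n x\<bar> \<le> 1 + k n x * k n x"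
        using zero_le_power2[of "\<bar>k n x\<bar> - 1/2"] by (simp add: power2_eq_square algebra_simps)
      then show "norm (k n x) \<le> norm (1 + k n x * k n x)" by simp
    qed
  qed simp
  have gi: "integrable N (g j)" for j unfolding g_def using ki by auto
  \<comment> \<open>The inequality \<open>\<bar>g\<bar> \<le> (\<delta> + g^2/\<delta>) / 2\<close>
    with \<open>\<delta> = (1/2)^j\<close>, a bound for the L2 norm of \<open>g j\<close>, stands in
    for Cauchy-Schwarz. Integrating it produces the constant \<open>W\<close>.\<close>
  define W where "W = (measure N (space N) + 1) / 2"
  have gb: "(\<integral>x. norm (g j x) \<partial>N) \<le> W * (1/2)^j" for j
  proof -
    define \<delta> :: real where "\<delta> = (1/2)^j"
    have \<delta>: "\<delta> > 0" by (simp add: \<delta>_def)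
    have le: "(\<integral>x. (g j x)\<^sup>2 \<partial>N) \<le> \<delta>\<^sup>2"
    proof -
      have "(\<integral>x. (g j x)\<^sup>2 \<partial>N) = c (\<phi> (Suc j)) - c (\<phi> j)"
        unfolding g_def by (rule diffI) (use phi in \<open>simp add: strict_mono_less_eq\<close>)
      also have "\<dots> \<le> (1/4)^j"
        using Q[of j "\<phi> (Suc j)" "\<phi> j"] phiQ[of j] phi strict_monoD[OF phi, of j "Suc j"] by fastforce
      also have "\<dots> = \<delta>\<^sup>2" by (simp add: \<delta>_def power2_eq_square flip: power_mult_distrib)
      finally show ?thesis .
    qed
    have "(\<integral>x. norm (g j x) \<partial>N) \<le> (\<integral>x. (\<delta> + (g j x)\<^sup>2 / \<delta>) / 2 \<partial>N)"
    proof (intro integral_mono)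
      show "integrable N (\<lambda>x. (\<delta> + (g j x)\<^sup>2 / \<delta>) / 2)"
        using diff by (auto simp: g_def)
      fix x
      have "0 \<le> (\<bar>g j x\<bar> - \<delta>)\<^sup>2" by simp
      then have "2 * \<bar>g j x\<bar> * \<delta> \<le> \<delta> * \<delta> + (g j x)\<^sup>2" by (simp add: power2_eq_square algebra_simps)
      then show "norm (g j x) \<le> (\<delta> + (g j x)\<^sup>2 / \<delta>) / 2" using \<delta> by (simp add: field_simps)
    qed (use gi in auto)
    also have "\<dots> = (\<delta> * measure N (space N) + (\<integral>x. (g j x)\<^sup>2 \<partial>N) / \<delta>) / 2"
      using diff by (auto simp: g_def)
    also have "\<dots> \<le> (\<delta> * measure N (space N) + \<delta>\<^sup>2 / \<delta>) / 2"
      using le \<delta> by (intro divide_right_mono add_left_mono) auto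
    also have "\<dots> = W * \<delta>" using \<delta> by (simp add: W_def power2_eq_square field_simps)
    finally show ?thesis by (simp add: \<delta>_def)
  qed
  have sum1: "summable (\<lambda>j. \<integral>x. norm (g j x) \<partial>N)"
    by (rule summable_comparison_test'[where g="\<lambda>j. W * (1/2)^j" and N=0])
      (use gb in \<open>auto simp: integral_nonneg_AE summable_mult\<close>)
  have ae: "AE x in N. summable (\<lambda>j. norm (g j x))"
  proof -
    have "(\<integral>\<^sup>+x. (\<Sum>j. ennreal (norm (g j x))) \<partial>N) = (\<Sum>j. \<integral>\<^sup>+x. ennreal (norm (g j x)) \<partial>N)"
      by (rule nn_integral_suminf) measurable
    also have "\<dots> = (\<Sum>j. ennreal (\<integral>x. norm (g j x) \<partial>N))"
      using gi by (subst nn_integral_eq_integral) auto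
    also have "\<dots> = ennreal (\<Sum>j. \<integral>x. norm (g j x) \<partial>N)"
      using sum1 by (subst suminf_ennreal2) (auto intro: integral_nonneg_AE)
    finally have "(\<integral>\<^sup>+x. (\<Sum>j. ennreal (norm (g j x))) \<partial>N) \<noteq> \<infinity>" by simp
    then have "AE x in N. (\<Sum>j. ennreal (norm (g j x))) \<noteq> \<infinity>"
      by (intro nn_integral_PInf_AE) auto
    then show ?thesis by (rule AE_mp) (auto intro!: AE_I2 summable_suminf_not_top)
  qed
  define f where "f x = k (\<phi> 0) x + (\<Sum>j. g j x)" for x
  have fi: "integrable N f" unfolding f_def
    using integrable_suminf[OF gi ae sum1] ki by auto
  have lim: "(\<lambda>j. \<integral>x. indicator A x * k (\<phi> j) x \<partial>N) \<longlonglongrightarrow> (\<integral>x. indicator A x * f x \<partial>N)"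
    if A [measurable]: "A \<in> sets N" for A
  proof -
    have int: "integrable N (\<lambda>x. indicator A x * u x)" if "integrable N u" for u :: "'b \<Rightarrow> real"
      using integrable_mult_indicator[OF A that] by simp
    have s1: "summable (\<lambda>j. \<integral>x. norm (indicator A x * g j x) \<partial>N)"
    proof (rule summable_comparison_test'[OF sum1, where N=0])
      fix j
      have "(\<integral>x. norm (indicator A x * g j x) \<partial>N) \<le> (\<integral>x. norm (g j x) \<partial>N)"
        using int[OF gi] gi by (intro integral_mono) (auto simp: indicator_def)
      moreover have "0 \<le> (\<integral>x. norm (indicator A x * g j x) \<partial>N)"
        by (intro integral_nonneg_AE) auto
      ultimately show "norm (\<integral>x. norm (indicator A x * g j x) \<partial>N) \<le> (\<integral>x. norm (g j x) \<partial>N)"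
        by simp
    qed
    have s2: "AE x in N. summable (\<lambda>j. norm (indicator A x * g j x))"
      using ae by eventually_elim (auto simp: indicator_def)
    have S: "(\<lambda>j. \<integral>x. indicator A x * g j x \<partial>N) sums (\<integral>x. (\<Sum>j. indicator A x * g j x) \<partial>N)"
      by (rule sums_integral[OF int[OF gi] s2 s1])
    have e1: "(\<integral>x. (\<Sum>j. indicator A x * g j x) \<partial>N) = (\<integral>x. indicator A x * f x \<partial>N) - (\<integral>x. indicator A x * k (\<phi> 0) x \<partial>N)"
      unfolding Bochner_Integration.integral_diff[OF int[OF fi] int[OF ki], symmetric]
      by (intro Bochner_Integration.integral_cong) (auto simp: f_def indicator_def)
    have e2: "(\<Sum>j<n. \<integral>x. indicator A x * g j x \<partial>N) = (\<integral>x. indicator A x * k (\<phi> n) x \<partial>N) - (\<integral>x. indicator A x * k (\<phi> 0) x \<partial>N)" for n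
    proof -
      have "(\<integral>x. indicator A x * g j x \<partial>N) = (\<integral>x. indicator A x * k (\<phi> (Suc j)) x \<partial>N) - (\<integral>x. indicator A x * k (\<phi> j) x \<partial>N)" for j
        unfolding Bochner_Integration.integral_diff[OF int[OF ki] int[OF ki], symmetric]
        by (intro Bochner_Integration.integral_cong) (auto simp: g_def indicator_def)
      then show ?thesis
        using sum_lessThan_telescope[of "\<lambda>j. \<integral>x. indicator A x * k (\<phi> j) x \<partial>N" n] by simp
    qed
    show ?thesis
      using tendsto_add[OF S[unfolded sums_def e1 e2] tendsto_const[of "\<integral>x. indicator A x * k (\<phi> 0) x \<partial>N"]]
      by simp
  qed
  show thesis using that[OF phi fi] lim by blast
qed

text \<open>On each dyadic interval of level \<open>n\<close> the step function \<open>k n\<close>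
  is the increment of \<open>\<rho>\<close> divided by the \<open>N\<close>-measure of the interval.
  This is a martingale, \<open>K\<close> bounds its squared L2 norm, and its limit is the density of
  the increments of \<open>\<rho>\<close> with respect to \<open>N\<close>. A general
  \<open>N\<close> also admits functions whose derivative is not square integrable for Lebesgue
  measure.\<close>

lemma dyadic_martingale_limit:
  fixes \<rho> :: "real \<Rightarrow> real" and N :: "real measure" and T :: real
  defines "p \<equiv> \<lambda>n i. T * real i / 2^n"
  assumes T: "T > 0" and N: "finite_measure N" and sets: "sets borel \<subseteq> sets N"
    and pos: "\<And>n i. i < 2^n \<Longrightarrow> measure N {p n i..<p n (Suc i)} > 0"
    and bd: "\<And>n. (\<Sum>i<2^n. (\<rho> (p n (Suc i)) - \<rho> (p n i))\<^sup>2 / measure N {p n i..<p n (Suc i)}) \<le> K"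
  obtains f where "integrable N f"
    "\<forall>n i. i \<le> 2^n \<longrightarrow> (\<integral>x. indicator {0..<p n i} x * f x \<partial>N) = \<rho> (p n i) - \<rho> 0"
proof -
  interpret finite_measure N by fact
  have ivl [measurable]: "{a..<b} \<in> sets N" for a b :: real using sets by (rule subsetD) simp
  define I where "I n i = {p n i..<p n (Suc i)}" for n i
  define D where "D n i = \<rho> (p n (Suc i)) - \<rho> (p n i)" for n i
  define a where "a n i = D n i / measure N (I n i)" for n i
  define k where "k n x = (\<Sum>i<2^n. a n i * indicator (I n i) x)" for n x
  have Im [measurable]: "I n i \<in> sets N" for n i by (simp add: I_def)
  have km [measurable]: "k n \<in> borel_measurable N" for n unfolding k_def by measurable
  have ind: "integrable N (indicator A :: real \<Rightarrow> real)" if "A \<in> sets N" for A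
    using that emeasure_finite[of A] by (intro integrable_real_indicator) (auto simp: less_top[symmetric])
  have pmono: "p n i \<le> p n j" if "i \<le> j" for n i j
    using that T by (auto simp: p_def divide_right_mono)
  have pref: "p (n + d) (i * 2^d) = p n i" for n d i
    by (simp add: p_def power_add)
  \<comment> \<open>The martingale property: over a union of level \<open>n\<close> intervals the
    finer step function integrates to a telescoping sum, so the value is the same for all
    \<open>m \<ge> n\<close>.\<close>
  have inner: "(\<integral>x. k m x * indicator {p n b..<p n c} x \<partial>N) = \<rho> (p n c) - \<rho> (p n b)"
    if "n \<le> m" "b \<le> c" "c \<le> 2^n" for m n b c
  proof -
    obtain d where m: "m = n + d" using \<open>n \<le> m\<close> le_Suc_ex by blast
    let ?J = "{b * 2^d..<c * 2^d}"
    have cap: "I m i \<inter> {p n b..<p n c} = (if i \<in> ?J then I m i else {})" for i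
    proof (cases "i \<in> ?J")
      case True
      then have "p n b \<le> p m i" "p m (Suc i) \<le> p n c"
        using pmono[of "b*2^d" i m] pmono[of "Suc i" "c*2^d" m] pref[of n d b] pref[of n d c] by (auto simp: m)
      with True show ?thesis by (auto simp: I_def)
    next
      case False
      then consider "Suc i \<le> b * 2^d" | "c * 2^d \<le> i" by fastforce
      then have "p m (Suc i) \<le> p n b \<or> p n c \<le> p m i"
        using pmono[of "Suc i" "b*2^d" m] pmono[of "c*2^d" i m] pref[of n d b] pref[of n d c]
        by cases (auto simp: m)
      with False show ?thesis by (auto simp: I_def)
    qed
    have sub: "c * 2^d \<le> 2^m" using that by (simp add: m power_add)
    have "(\<integral>x. k m x * indicator {p n b..<p n c} x \<partial>N) = (\<integral>x. (\<Sum>i<2^m. a m i * indicator (I m i \<inter> {p n b..<p n c}) x) \<partial>N)"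
      by (simp only: k_def sum_distrib_right mult.assoc indicator_inter_arith)
    also have "\<dots> = (\<Sum>i<2^m. a m i * measure N (I m i \<inter> {p n b..<p n c}))"
      by (subst Bochner_Integration.integral_sum) (auto intro!: ind)
    also have "\<dots> = (\<Sum>i<2^m. if i \<in> ?J then D m i else 0)"
    proof (intro sum.cong refl)
      fix i assume "i \<in> {..<2^m::nat}"
      then have "measure N (I m i) > 0" using pos by (simp add: I_def)
      then show "a m i * measure N (I m i \<inter> {p n b..<p n c}) = (if i \<in> ?J then D m i else 0)"
        unfolding cap by (simp add: a_def)
    qed
    also have "\<dots> = (\<Sum>i\<in>?J. D m i)"
      using sub by (subst sum.inter_restrict[symmetric]) (auto intro!: sum.cong)
    also have "\<dots> = \<rho> (p m (c * 2^d)) - \<rho> (p m (b * 2^d))"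
      unfolding D_def using \<open>b \<le> c\<close> by (intro sum_Suc_diff') simp
    finally show ?thesis by (simp add: m pref)
  qed
  have sq: "integrable N (\<lambda>x. k m x * k n x)" for m n
  proof -
    have "k m x * k n x = (\<Sum>i<2^m. \<Sum>j<2^n. a m i * a n j * indicator (I m i \<inter> I n j) x)" for x
      unfolding k_def sum_product by (intro sum.cong refl) (simp add: indicator_def)
    then show ?thesis
      by (simp only:) (intro Bochner_Integration.integrable_sum integrable_mult_right ind; simp)
  qed
  have ip: "(\<integral>x. k m x * k n x \<partial>N) = (\<Sum>j<2^n. a n j * D n j)" if "n \<le> m" for m n
  proof -
    have ki: "integrable N (\<lambda>x. k m x * indicator A x)" if "A \<in> sets N" for A
    proof -
      have "k m x * indicator A x = (\<Sum>i<2^m. a m i * indicator (I m i \<inter> A) x)" for x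
        by (simp only: k_def sum_distrib_right mult.assoc indicator_inter_arith)
      then show ?thesis using that
        by (simp only:) (intro Bochner_Integration.integrable_sum integrable_mult_right ind; simp)
    qed
    have "k m x * k n x = (\<Sum>j<2^n. a n j * (k m x * indicator (I n j) x))" for x
      unfolding k_def[of n] sum_distrib_left by (intro sum.cong refl) (rule mult.left_commute)
    then have "(\<integral>x. k m x * k n x \<partial>N) = (\<integral>x. (\<Sum>j<2^n. a n j * (k m x * indicator (I n j) x)) \<partial>N)"
      by (simp only:)
    also have "\<dots> = (\<Sum>j<2^n. a n j * (\<integral>x. k m x * indicator (I n j) x \<partial>N))"
      using ki by (subst Bochner_Integration.integral_sum) auto
    also have "\<dots> = (\<Sum>j<2^n. a n j * D n j)"
      using inner[OF that, of j "Suc j" for j] by (intro sum.cong) (auto simp: I_def D_def)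
    finally show ?thesis .
  qed
  have orth: "(\<integral>x. k m x * k n x \<partial>N) = (\<integral>x. k n x * k n x \<partial>N)" if "n \<le> m" for m n
    using ip that by simp
  have bd': "(\<integral>x. k n x * k n x \<partial>N) \<le> K" for n
    using bd[of n] unfolding ip[OF order_refl] a_def D_def I_def
    by (simp add: power2_eq_square)
  obtain \<phi> f where phi: "strict_mono \<phi>" and f: "integrable N f" and
    lim: "\<forall>A\<in>sets N. (\<lambda>j. \<integral>x. indicator A x * k (\<phi> j) x \<partial>N) \<longlonglongrightarrow> (\<integral>x. indicator A x * f x \<partial>N)"
    by (rule orthogonal_increments_L1_limit[where k=k and K=K, OF N km sq orth bd'])
  \<comment> \<open>The approximating integrals are constant once \<open>\<phi> j\<close> has
    reached \<open>n\<close>, so their limit is the increment itself.\<close>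
  have "(\<integral>x. indicator {0..<p n i} x * f x \<partial>N) = \<rho> (p n i) - \<rho> 0" if "i \<le> 2^n" for n i
  proof (rule LIMSEQ_unique[OF lim[rule_format]])
    show "(\<lambda>j. \<integral>x. indicator {0..<p n i} x * k (\<phi> j) x \<partial>N) \<longlonglongrightarrow> \<rho> (p n i) - \<rho> 0"
    proof (rule tendsto_eventually)
      show "\<forall>\<^sub>F j in sequentially. (\<integral>x. indicator {0..<p n i} x * k (\<phi> j) x \<partial>N) = \<rho> (p n i) - \<rho> 0"
        using eventually_ge_at_top[of n]
      proof eventually_elim
        case (elim j)
        have "n \<le> \<phi> j" using elim seq_suble[OF phi, of j] by simp
        from inner[OF this, of 0 i] that show ?case
          by (simp add: p_def mult.commute)
      qed
    qed
  qed simp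
  with f show thesis using that by blast
qed

section \<open>Indefinite integrals, dyadic times and absolute continuity\<close>

lemma set_integrable_subinterval:
  fixes f :: "real \<Rightarrow> real"
  assumes "set_integrable lebesgue {0..T} f" "0 \<le> s" "s \<le> t" "t \<le> T"
  shows "set_integrable lebesgue {s..t} f"
  by (rule set_integrable_subset[OF assms(1)]) (use assms in auto)

lemma set_integral_Icc_combine:
  fixes f :: "real \<Rightarrow> real"
  assumes "set_integrable lebesgue {0..T} f" "0 \<le> s" "s \<le> t" "t \<le> T"
  shows "(LINT u:{0..t}|lebesgue. f u) = (LINT u:{0..s}|lebesgue. f u) + (LINT u:{s..t}|lebesgue. f u)"
proof -
  have "set_integrable lebesgue {0..s} f" "set_integrable lebesgue {s..t} f" "set_integrable lebesgue {0..t} f"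
    using assms by (auto intro: set_integrable_subinterval)
  then show ?thesis
    using assms by (simp add: set_lebesgue_integral_eq_integral Henstock_Kurzweil_Integration.integral_combine)
qed

lemma indefinite_set_integral_continuous:
  fixes f :: "real \<Rightarrow> real"
  assumes "set_integrable lebesgue {0..T} f"
  shows "continuous_on {0..T} (\<lambda>t. LINT u:{0..t}|lebesgue. f u)"
proof -
  have cont: "continuous_on {0..T} (\<lambda>t. integral {0..t} f)"
    using assms by (intro indefinite_integral_continuous_1) (simp add: set_lebesgue_integral_eq_integral)
  have eq: "integral {0..t} f = (LINT u:{0..t}|lebesgue. f u)" if "t \<in> {0..T}" for t
    using that by (intro set_lebesgue_integral_eq_integral(2)[symmetric] set_integrable_subinterval[OF assms]) auto
  show ?thesis by (rule continuous_on_cong[THEN iffD1, OF refl eq cont])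
qed

definition dyadic_floor :: "real \<Rightarrow> nat \<Rightarrow> real \<Rightarrow> nat" where
  "dyadic_floor T n t = nat \<lfloor>t / T * 2^n\<rfloor>"

lemma dyadic_floor_bounds:
  assumes "T > 0" "0 \<le> t"
  shows "T * real (dyadic_floor T n t) / 2^n \<le> t" "t < T * real (Suc (dyadic_floor T n t)) / 2^n"
proof -
  have 0: "0 \<le> t / T * 2^n" using assms by simp
  then have "real (dyadic_floor T n t) \<le> t / T * 2^n" "t / T * 2^n < real (Suc (dyadic_floor T n t))"
    by (simp_all add: dyadic_floor_def) linarith+
  then show "T * real (dyadic_floor T n t) / 2^n \<le> t" "t < T * real (Suc (dyadic_floor T n t)) / 2^n"
    using assms by (simp_all add: field_simps)
qed

lemma dyadic_floor_less:
  assumes "T > 0" "0 \<le> t" "t < T"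
  shows "dyadic_floor T n t < 2^n"
proof -
  have "t / T * 2^n < 1 * 2^n" using assms by (intro mult_strict_right_mono) auto
  then have "\<lfloor>t / T * 2^n\<rfloor> < 2^n" by (simp only: mult_1 floor_less_iff of_int_power of_int_numeral)
  then have "\<lfloor>t / T * 2^n\<rfloor> < 2^n" by (simp add: floor_less_iff)
  then show ?thesis using assms by (simp add: dyadic_floor_def nat_less_iff)
qed

lemma dyadic_floor_tendsto:
  assumes "T > 0" "0 \<le> t"
  shows "(\<lambda>n. T * real (dyadic_floor T n t) / 2^n) \<longlonglongrightarrow> t"
    "(\<lambda>n. T * real (Suc (dyadic_floor T n t)) / 2^n) \<longlonglongrightarrow> t"
proof -
  have z: "(\<lambda>n. T / 2^n) \<longlonglongrightarrow> 0"
    using tendsto_mult_right_zero[OF LIMSEQ_realpow_zero[of "1/2::real"], of T] by (simp add: power_divide)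
  have e: "T * real (Suc (dyadic_floor T n t)) / 2^n = T * real (dyadic_floor T n t) / 2^n + T / 2^n" for n
    by (simp add: field_simps)
  have lt: "t \<le> T * real (dyadic_floor T n t) / 2^n + T / 2^n" for n
    using dyadic_floor_bounds(2)[OF assms, of n] e[of n] by linarith
  have l: "(\<lambda>n. t - T / 2^n) \<longlonglongrightarrow> t" and u: "(\<lambda>n. t + T / 2^n) \<longlonglongrightarrow> t"
    using tendsto_diff[OF tendsto_const z, of t] tendsto_add[OF tendsto_const z, of t] by simp_all
  show "(\<lambda>n. T * real (dyadic_floor T n t) / 2^n) \<longlonglongrightarrow> t"
    by (rule tendsto_sandwich[OF _ _ l tendsto_const])
      (use dyadic_floor_bounds(1)[OF assms] lt in \<open>simp_all only: e add.commute[of t] diff_le_eq add_le_cancel_right eventually_sequentially, auto\<close>)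
  show "(\<lambda>n. T * real (Suc (dyadic_floor T n t)) / 2^n) \<longlonglongrightarrow> t"
    by (rule tendsto_sandwich[OF _ _ tendsto_const u])
      (use dyadic_floor_bounds(1)[OF assms] lt in \<open>simp_all only: e add.commute[of t] diff_le_eq add_le_cancel_right eventually_sequentially, auto\<close>)
qed

text \<open>Absolute continuity of a real function with its density carried along, so that the
  differentiation theorem can name the derivative.\<close>

definition has_integral_rep :: "real \<Rightarrow> (real \<Rightarrow> real) \<Rightarrow> (real \<Rightarrow> real) \<Rightarrow> bool" where
  "has_integral_rep T \<rho> k \<longleftrightarrow> set_integrable lebesgue {0..T} k \<and>
    (\<forall>s t. 0 \<le> s \<longrightarrow> s \<le> t \<longrightarrow> t \<le> T \<longrightarrow> \<rho> t - \<rho> s = (LINT u:{s..t}|lebesgue. k u))"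

text \<open>The weight \<open>m = 1\<close> is the case of finite energy; if \<open>\<rho>\<close> is absolutely continuous with
  increments bounded by integrals of \<open>w\<close>, the hypothesis holds with \<open>m = 1 + \<bar>w\<bar>\<close>.\<close>

lemma integral_representation:
  fixes \<rho> m :: "real \<Rightarrow> real" and T :: real
  defines "p \<equiv> \<lambda>n i. T * real i / 2^n"
  assumes T: "T > 0" and cont: "continuous_on {0..T} \<rho>"
    and m: "set_integrable lebesgue {0..T} m" and mpos: "\<And>t. m t > 0"
    and bd: "\<And>n. (\<Sum>i<2^n. (\<rho> (p n (Suc i)) - \<rho> (p n i))\<^sup>2 / (LINT u:{p n i..p n (Suc i)}|lebesgue. m u)) \<le> K"
  shows "\<exists>k. has_integral_rep T \<rho> k"
proof -
  \<comment> \<open>Cutting \<open>m\<close> off outside \<open>{0..T}\<close> yields a finite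
    measure \<open>N\<close> whose mass replaces the length of the interval in the difference
    quotients.\<close>
  define w where "w t = indicator {0..T} t * m t" for t
  have w: "integrable lebesgue w" using m by (simp add: set_integrable_def w_def[abs_def])
  then have wm [measurable]: "w \<in> borel_measurable lebesgue" by (rule borel_measurable_integrable)
  have w0: "0 \<le> w t" for t using mpos[of t] by (simp add: w_def indicator_def)
  define N where "N = density lebesgue (\<lambda>t. ennreal (w t))"
  have N: "finite_measure N"
  proof
    have "emeasure N (space N) = (\<integral>\<^sup>+t. ennreal (w t) \<partial>lebesgue)"
      by (simp add: N_def emeasure_density)
    also have "\<dots> = ennreal (LINT t|lebesgue. w t)"
      using w w0 by (intro nn_integral_eq_integral) auto
    finally show "emeasure N (space N) \<noteq> \<infinity>" by simp
  qed
  have sN: "sets N = sets lebesgue" by (simp add: N_def)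
  have sets: "sets borel \<subseteq> sets N" by (auto simp: sN)
  have pm: "p n i \<le> p n (Suc i)" "0 \<le> p n i" "i < 2^n \<Longrightarrow> p n (Suc i) \<le> T" for n i
  proof -
    show "p n i \<le> p n (Suc i)" "0 \<le> p n i" using T by (auto simp: p_def divide_right_mono)
    assume "i < 2^n"
    then have "real (Suc i) \<le> 2^n" by (metis Suc_leI of_nat_le_iff of_nat_numeral of_nat_power)
    then have "T * real (Suc i) \<le> T * 2^n" using T by (intro mult_left_mono) auto
    then show "p n (Suc i) \<le> T" by (simp add: p_def pos_divide_le_eq)
  qed
  have meas: "measure N {a..<b} = (LINT u:{a..b}|lebesgue. m u)" if "0 \<le> a" "b \<le> T" for a b
  proof -
    have "emeasure N {a..<b} = (\<integral>\<^sup>+t. ennreal (w t) * indicator {a..<b} t \<partial>lebesgue)"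
      by (simp add: N_def emeasure_density)
    also have "\<dots> = (\<integral>\<^sup>+t. ennreal (indicator {a..b} t * m t) \<partial>lebesgue)"
    proof (rule nn_integral_cong_AE)
      have "AE t in lebesgue. t \<noteq> b"
        by (rule AE_completion) (simp add: AE_lborel_singleton)
      then show "AE t in lebesgue. ennreal (w t) * indicator {a..<b} t = ennreal (indicator {a..b} t * m t)"
        by eventually_elim (use that in \<open>auto simp: w_def indicator_def\<close>)
    qed
    also have "\<dots> = ennreal (LINT t|lebesgue. indicator {a..b} t * m t)"
    proof (rule nn_integral_eq_integral)
      show "integrable lebesgue (\<lambda>t. indicator {a..b} t * m t)"
        using set_integrable_subset[OF m, of "{a..b}"] that by (auto simp: set_integrable_def)
    qed (use mpos in \<open>auto simp: indicator_def less_imp_le\<close>)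
    finally show ?thesis
      using mpos by (subst measure_def) (auto simp: set_lebesgue_integral_def indicator_def less_imp_le intro!: enn2real_ennreal integral_nonneg_AE)
  qed
  \<comment> \<open>Strict positivity of \<open>m\<close> enters here: on an \<open>N\<close>-null
    interval the positive density would have to vanish almost everywhere.\<close>
  have pos: "measure N {p n i..<p n (Suc i)} > 0" if "i < 2^n" for n i
  proof -
    have lt: "p n i < p n (Suc i)" using T by (simp add: p_def divide_strict_right_mono)
    have "emeasure N {p n i..<p n (Suc i)} \<noteq> 0"
    proof
      assume "emeasure N {p n i..<p n (Suc i)} = 0"
      then have "(\<integral>\<^sup>+t. ennreal (w t) * indicator {p n i..<p n (Suc i)} t \<partial>lebesgue) = 0"
        by (simp add: N_def emeasure_density)
      then have "AE t in lebesgue. ennreal (w t) * indicator {p n i..<p n (Suc i)} t = 0"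
        by (subst (asm) nn_integral_0_iff_AE) (auto intro!: borel_measurable_times_ennreal borel_measurable_indicator measurable_compose[OF wm])
      then have "AE t in lebesgue. t \<notin> {p n i..<p n (Suc i)}"
      proof eventually_elim
        case (elim t)
        show ?case
        proof
          assume t: "t \<in> {p n i..<p n (Suc i)}"
          then have "t \<in> {0..T}" using pm(2)[of n i] pm(3)[OF that] by simp
          with t elim mpos[of t] show False by (simp add: w_def ennreal_eq_0_iff)
        qed
      qed
      then have "emeasure lebesgue {p n i..<p n (Suc i)} = 0"
        by (subst (asm) AE_iff_measurable[of "{p n i..<p n (Suc i)}"]) auto
      with lt show False by simp
    qed
    then show ?thesis
      using N by (simp add: finite_measure.emeasure_eq_measure zero_less_measure_iff)
  qed
  have bd': "(\<Sum>i<2^n. (\<rho> (p n (Suc i)) - \<rho> (p n i))\<^sup>2 / measure N {p n i..<p n (Suc i)}) \<le> K" for n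
    using bd[of n] pm by (simp add: meas)
  obtain f where f: "integrable N f" and
    fe: "\<forall>n i. i \<le> 2^n \<longrightarrow> (\<integral>x. indicator {0..<p n i} x * f x \<partial>N) = \<rho> (p n i) - \<rho> 0"
    unfolding p_def by (rule dyadic_martingale_limit[where \<rho>=\<rho> and K=K, OF T N sets pos[unfolded p_def] bd'[unfolded p_def]])
  \<comment> \<open>Passing from \<open>N\<close> back to Lebesgue measure multiplies the density by
    \<open>m\<close>.\<close>
  define k where "k t = m t * f t" for t
  have fm [measurable]: "f \<in> borel_measurable lebesgue"
    using borel_measurable_integrable[OF f] by (simp add: measurable_cong_sets[OF sN refl])
  have dens: "(\<integral>x. indicator A x * f x \<partial>N) = (LINT u:A \<inter> {0..T}|lebesgue. k u)" if "A \<in> sets lebesgue" for A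
    unfolding N_def set_lebesgue_integral_def using w0 that
    by (subst integral_density) (auto simp: w_def k_def indicator_def intro!: Bochner_Integration.integral_cong)
  have ki: "set_integrable lebesgue {0..T} k"
  proof -
    have "integrable lebesgue (\<lambda>t. w t *\<^sub>R f t)"
      using f w0 unfolding N_def by (subst (asm) integrable_density) auto
    then show ?thesis unfolding set_integrable_def
      by (rule Bochner_Integration.integrable_cong[THEN iffD1, rotated -1]) (auto simp: w_def k_def)
  qed
  have dy: "\<rho> (p n i) - \<rho> 0 = (LINT u:{0..p n i}|lebesgue. k u)" if "i \<le> 2^n" for n i
  proof -
    have "real i \<le> 2^n" using that by (metis of_nat_le_iff of_nat_numeral of_nat_power)
    then have pT: "p n i \<le> T" using T by (simp add: p_def field_simps)
    have "\<rho> (p n i) - \<rho> 0 = (LINT u:{0..<p n i}|lebesgue. k u)"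
      using fe[rule_format, OF that] dens[of "{0..<p n i}"] pT by (simp add: Int_absorb2 subset_iff)
    also have "\<dots> = (LINT u:{0..p n i}|lebesgue. k u)"
      unfolding set_lebesgue_integral_def
    proof (rule integral_cong_AE)
      have "AE t in lebesgue. t \<noteq> p n i"
        by (rule AE_completion) (simp add: AE_lborel_singleton)
      then show "AE t in lebesgue. indicator {0..<p n i} t *\<^sub>R k t = indicator {0..p n i} t *\<^sub>R k t"
        by eventually_elim (auto simp: indicator_def)
      have 1: "set_integrable lebesgue {0..p n i} k" 
        by (rule set_integrable_subinterval[OF ki]) (use pm pT in auto)
      have 2: "set_integrable lebesgue {0..<p n i} k" 
        by (rule set_integrable_subset[OF 1]) auto
      from 1 2 show "(\<lambda>t. indicator {0..<p n i} t *\<^sub>R k t) \<in> borel_measurable lebesgue"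
        "(\<lambda>t. indicator {0..p n i} t *\<^sub>R k t) \<in> borel_measurable lebesgue"
        unfolding set_integrable_def by (blast dest: borel_measurable_integrable)+
    qed
    finally show ?thesis .
  qed
  \<comment> \<open>Both sides are continuous in \<open>t\<close>, so the identity extends from
    dyadic times. The endpoint is treated apart because its floor index \<open>2^n\<close> is
    excluded from \<open>dyadic_floor_less\<close>; it is dyadic of level zero.\<close>
  have all: "\<rho> t - \<rho> 0 = (LINT u:{0..t}|lebesgue. k u)" if t: "0 \<le> t" "t \<le> T" for t
  proof (cases "t = T")
    case True
    then show ?thesis using dy[of "2^0" 0] by (simp add: p_def)
  next
    case False
    with t have tT: "t < T" by simp
    define q where "q n = p n (dyadic_floor T n t)" for n
    have q: "q \<longlonglongrightarrow> t" unfolding q_def p_def by (rule dyadic_floor_tendsto[OF T t(1)])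
    have qin: "q n \<in> {0..T}" for n
      using dyadic_floor_bounds(1)[OF T t(1), of n] tT T by (simp add: q_def p_def)
    have L1: "(\<lambda>n. \<rho> (q n) - \<rho> 0) \<longlonglongrightarrow> \<rho> t - \<rho> 0"
      by (intro tendsto_diff tendsto_const continuous_on_tendsto_compose[OF cont q]) (use t qin in auto)
    have L2: "(\<lambda>n. LINT u:{0..q n}|lebesgue. k u) \<longlonglongrightarrow> (LINT u:{0..t}|lebesgue. k u)"
      by (intro continuous_on_tendsto_compose[OF indefinite_set_integral_continuous[OF ki] q]) (use t qin in auto)
    have "\<rho> (q n) - \<rho> 0 = (LINT u:{0..q n}|lebesgue. k u)" for n
      unfolding q_def by (intro dy less_imp_le dyadic_floor_less[OF T t(1) tT])
    with L1 L2 show ?thesis using LIMSEQ_unique by simp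
  qed
  have "\<rho> t - \<rho> s = (LINT u:{s..t}|lebesgue. k u)" if st: "0 \<le> s" "s \<le> t" "t \<le> T" for s t
    using all[of s] all[of t] set_integral_Icc_combine[OF ki st] st by simp
  with ki have "has_integral_rep T \<rho> k" by (simp add: has_integral_rep_def)
  then show ?thesis by blast
qed

section \<open>Lebesgue differentiation\<close>

lemma integral_right_derivative_AE:
  fixes f :: "real \<Rightarrow> real"
  assumes "\<And>a b. f integrable_on {a..b}"
  shows "AE t in lebesgue. \<forall>e>0. \<exists>d>0. \<forall>h. 0 < h \<and> h < d \<longrightarrow> \<bar>integral {t..t+h} f / h - f t\<bar> < e"
proof -
  obtain N where N: "negligible N" and *: "\<And>x e. x \<notin> N \<Longrightarrow> 0 < e \<Longrightarrow> \<exists>d>0. \<forall>h. 0 < h \<and> h < d \<longrightarrow>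
                         norm (integral (cbox x (x + h *\<^sub>R One)) f /\<^sub>R h ^ DIM(real) - f x) < e"
    using integrable_ccontinuous_explicit[of f] assms by auto
  have "AE t in lebesgue. t \<notin> N"
    using N by (intro AE_not_in) (simp add: negligible_iff_null_sets)
  then show ?thesis
    by eventually_elim (use * in \<open>force simp: divide_inverse_commute\<close>)
qed

text \<open>The differentiation theorem speaks of cubes with the point as lower corner, that is, of
  right averages. Left averages follow by applying it to the reflected function. Extending
  \<open>k\<close> by zero makes all these averages meaningful.\<close>

lemma Lebesgue_differentiation_AE:
  fixes \<rho> k :: "real \<Rightarrow> real"
  assumes T: "T > 0" and rep: "has_integral_rep T \<rho> k"
  shows "AE t in lebesgue. t \<in> {0<..<T} \<longrightarrow> (\<rho> has_real_derivative k t) (at t)"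
proof -
  have k: "set_integrable lebesgue {0..T} k"
    and rep: "\<And>s t. 0 \<le> s \<Longrightarrow> s \<le> t \<Longrightarrow> t \<le> T \<Longrightarrow> \<rho> t - \<rho> s = (LINT u:{s..t}|lebesgue. k u)"
    using rep by (simp_all add: has_integral_rep_def)
  define f where "f u = indicator {0..T} u * k u" for u
  have fi: "integrable lebesgue f" using k by (simp add: set_integrable_def f_def[abs_def])
  then have fon: "f integrable_on UNIV"
    using integrable_on_lebesgue by blast
  have fI: "f integrable_on {a..b}" for a b
    using integrable_on_subinterval[OF fon, of a b] by simp
  have gI: "(\<lambda>u. f (- u)) integrable_on {a..b}" for a b
    using fI[of "-b" "-a"] by (subst Henstock_Kurzweil_Integration.integrable_reflect_real[symmetric]) simp
  have eq: "integral {s..t} f = \<rho> t - \<rho> s" if "0 \<le> s" "s \<le> t" "t \<le> T" for s t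
  proof -
    have "set_integrable lebesgue {s..t} k" using set_integrable_subinterval[OF k that] .
    then have "\<rho> t - \<rho> s = integral {s..t} k"
      using rep[OF that] by (simp add: set_lebesgue_integral_eq_integral)
    also have "\<dots> = integral {s..t} f"
      by (intro Henstock_Kurzweil_Integration.integral_cong) (use that in \<open>auto simp: f_def\<close>)
    finally show ?thesis by simp
  qed
  have R: "AE t in lebesgue. \<forall>e>0. \<exists>d>0. \<forall>h. 0 < h \<and> h < d \<longrightarrow> \<bar>integral {t..t+h} f / h - f t\<bar> < e"
    by (rule integral_right_derivative_AE[OF fI])
  \<comment> \<open>Right averages of the reflected function at \<open>-t\<close> are left averages
    of \<open>f\<close> at \<open>t\<close>; the exceptional set has to be reflected as
    well.\<close>
  obtain N where N: "negligible N" and *: "\<And>x e. x \<notin> N \<Longrightarrow> 0 < e \<Longrightarrow> \<exists>d>0. \<forall>h. 0 < h \<and> h < d \<longrightarrow>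
                         norm (integral (cbox x (x + h *\<^sub>R One)) (\<lambda>u. f (- u)) /\<^sub>R h ^ DIM(real) - f (- x)) < e"
    using integrable_ccontinuous_explicit[of "\<lambda>u. f (- u)"] gI by auto
  have "negligible (uminus ` N)"
    by (rule negligible_differentiable_image_negligible[OF _ N]) (auto intro: derivative_intros)
  then have "AE t in lebesgue. t \<notin> uminus ` N"
    by (intro AE_not_in) (simp add: negligible_iff_null_sets)
  then have L: "AE t in lebesgue. \<forall>e>0. \<exists>d>0. \<forall>h. 0 < h \<and> h < d \<longrightarrow> \<bar>integral {t-h..t} f / h - f t\<bar> < e"
  proof eventually_elim
    case (elim t)
    have "- t \<notin> N" using elim by force
    have "integral {-t..-t+h} (\<lambda>u. f (- u)) = integral {t-h..t} f" for h
      using Henstock_Kurzweil_Integration.integral_reflect_real[of t "t-h" f] by simp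
    then show ?case using *[OF \<open>- t \<notin> N\<close>] by (force simp: divide_inverse_commute)
  qed
  from R L show ?thesis
  proof eventually_elim
    case (elim t)
    show ?case
    proof
      assume t: "t \<in> {0<..<T}"
      then have ft: "f t = k t" by (simp add: f_def)
      show "(\<rho> has_real_derivative k t) (at t)"
        unfolding DERIV_def
      proof (rule LIM_I)
        fix e :: real assume "0 < e"
        obtain d1 where d1: "d1 > 0" "\<forall>h. 0 < h \<and> h < d1 \<longrightarrow> \<bar>integral {t..t+h} f / h - f t\<bar> < e"
          using elim(1) \<open>0 < e\<close> by blast
        obtain d2 where d2: "d2 > 0" "\<forall>h. 0 < h \<and> h < d2 \<longrightarrow> \<bar>integral {t-h..t} f / h - f t\<bar> < e"
          using elim(2) \<open>0 < e\<close> by blast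
        show "\<exists>s>0. \<forall>h. h \<noteq> 0 \<and> norm (h - 0) < s \<longrightarrow> norm ((\<rho> (t + h) - \<rho> t) / h - k t) < e"
        proof (intro exI[of _ "min (min d1 d2) (min t (T - t))"] conjI allI impI)
          show "0 < min (min d1 d2) (min t (T - t))" using d1 d2 t by simp
          fix h :: real assume h: "h \<noteq> 0 \<and> norm (h - 0) < min (min d1 d2) (min t (T - t))"
          consider "h > 0" | "h < 0" using h by linarith
          then show "norm ((\<rho> (t + h) - \<rho> t) / h - k t) < e"
          proof cases
            case 1
            then show ?thesis using d1(2)[rule_format, of h] h t eq[of t "t+h"] by (simp add: ft)
          next
            case 2
            have "(\<rho> (t + h) - \<rho> t) / h = (\<rho> t - \<rho> (t - (-h))) / (-h)" using 2 by (simp add: field_simps)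
            then show ?thesis using d2(2)[rule_format, of "-h"] h t 2 eq[of "t+h" t] by (simp add: ft)
          qed
        qed
      qed
    qed
  qed
qed

section \<open>Weak compactness of tight families in a metric space\<close>

text \<open>Base 3 with digits 0 and 1 only. The tail behind any digit is at most 1/2, which leaves
  gaps between codes: each digit can be read off by a floor and is locally constant on the set of
  codes. In base 2 the two expansions of a dyadic rational would destroy both properties.\<close>

definition ternary :: "(nat \<Rightarrow> nat) \<Rightarrow> real" where
  "ternary b = (\<Sum>n. real (b n) * (1/3)^Suc n)"

definition ternary_digit :: "nat \<Rightarrow> real \<Rightarrow> int" where
  "ternary_digit n y = \<lfloor>y * 3^Suc n\<rfloor> mod 3"

lemma ternary_summable:
  assumes "\<And>n. b n \<le> 1"
  shows "summable (\<lambda>n. real (b n) * (1/3)^Suc n)"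
proof (rule summable_comparison_test'[where g="\<lambda>n. (1/3::real)^Suc n" and N=0])
  show "summable (\<lambda>n. (1/3::real)^Suc n)" by (simp add: summable_mult)
  show "norm (real (b n) * (1/3)^Suc n) \<le> (1/3)^Suc n" for n
    using assms[of n] by (simp add: abs_mult mult_left_le_one_le)
qed

lemma ternary_bounds:
  assumes "\<And>n. b n \<le> 1"
  shows "0 \<le> ternary b" "ternary b \<le> 1/2"
proof -
  show "0 \<le> ternary b" unfolding ternary_def by (intro suminf_nonneg ternary_summable assms) auto
  have g: "(\<lambda>n. (1/3::real)^Suc n) sums (1/2)"
    using sums_mult[OF geometric_sums[of "1/3::real"], of "1/3"] by simp
  have "ternary b \<le> (\<Sum>n. (1/3::real)^Suc n)" unfolding ternary_def
    by (intro suminf_le ternary_summable assms sums_summable[OF g])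
      (use assms in \<open>auto simp: mult_left_le_one_le\<close>)
  then show "ternary b \<le> 1/2" using sums_unique[OF g] by simp
qed

lemma ternary_shift:
  assumes "\<And>n. b n \<le> 1"
  shows "ternary b * 3 = real (b 0) + ternary (\<lambda>n. b (Suc n))"
proof -
  have "ternary b = real (b 0) / 3 + (\<Sum>n. real (b (Suc n)) * (1/3)^Suc (Suc n))"
    unfolding ternary_def using suminf_split_head[OF ternary_summable[of b]] assms by simp
  also have "(\<Sum>n. real (b (Suc n)) * (1/3)^Suc (Suc n)) = ternary (\<lambda>n. b (Suc n)) * (1/3)"
    unfolding ternary_def by (subst suminf_mult2[OF ternary_summable]) (use assms in \<open>auto simp: mult_ac\<close>)
  finally show ?thesis by simp
qed

text \<open>Multiplying by \<open>3^Suc n\<close> shifts the first digits into an integer whose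
  residue modulo 3 is digit \<open>n\<close>; what remains is the code of the tail.\<close>

lemma ternary_expansion:
  assumes "\<And>n. b n \<le> 1"
  shows "\<exists>i::int. ternary b * 3^Suc n = of_int i + ternary (\<lambda>m. b (m + Suc n)) \<and> i mod 3 = int (b n)"
proof (induction n)
  case 0
  show ?case using assms[of 0] ternary_shift[OF assms]
    by (intro exI[of _ "int (b 0)"]) auto
next
  case (Suc n)
  then obtain i :: int where i: "ternary b * 3^Suc n = of_int i + ternary (\<lambda>m. b (m + Suc n))" by blast
  have "ternary b * 3^Suc (Suc n) = (ternary b * 3^Suc n) * 3" by simp
  also have "\<dots> = of_int (3 * i + int (b (Suc n))) + ternary (\<lambda>m. b (m + Suc (Suc n)))"
    unfolding i distrib_right using ternary_shift[of "\<lambda>m. b (m + Suc n)"] assms by simp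
  finally show ?case
    using assms[of "Suc n"] by (intro exI[of _ "3 * i + int (b (Suc n))"]) auto
qed

lemma ternary_digit_ternary:
  assumes "\<And>n. b n \<le> 1"
  shows "ternary_digit n (ternary b) = int (b n)"
proof -
  obtain i :: int where i: "ternary b * 3^Suc n = of_int i + ternary (\<lambda>m. b (m + Suc n))" "i mod 3 = int (b n)"
    using ternary_expansion[of b n] assms by blast
  have "\<lfloor>ternary b * 3^Suc n\<rfloor> = i"
    unfolding i using ternary_bounds[of "\<lambda>m. b (m + Suc n)"] assms by (intro floor_unique) auto
  with i show ?thesis by (simp add: ternary_digit_def)
qed

text \<open>After the shift the two numbers differ by less than 1/2 and the two tails by at most
  1/2. The integer parts therefore differ by less than 1 and coincide.\<close>

lemma ternary_close:
  assumes b: "\<And>n. b n \<le> 1" and b': "\<And>n. b' n \<le> 1"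
    and close: "\<bar>ternary b - ternary b'\<bar> * 3^Suc n < 1/2"
  shows "b n = b' n"
proof -
  obtain i :: int where i: "ternary b * 3^Suc n = of_int i + ternary (\<lambda>m. b (m + Suc n))" "i mod 3 = int (b n)"
    using ternary_expansion[of b n] b by blast
  obtain j :: int where j: "ternary b' * 3^Suc n = of_int j + ternary (\<lambda>m. b' (m + Suc n))" "j mod 3 = int (b' n)"
    using ternary_expansion[of b' n] b' by blast
  have "\<bar>ternary b * 3^Suc n - ternary b' * 3^Suc n\<bar> < 1/2"
    using close by (simp add: abs_mult flip: left_diff_distrib)
  moreover have "0 \<le> ternary (\<lambda>m. b (m + Suc n))" "ternary (\<lambda>m. b (m + Suc n)) \<le> 1/2"
    "0 \<le> ternary (\<lambda>m. b' (m + Suc n))" "ternary (\<lambda>m. b' (m + Suc n)) \<le> 1/2"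
    by (intro ternary_bounds b b')+
  ultimately have "\<bar>of_int i - of_int j :: real\<bar> < 1"
    unfolding i j by linarith
  then have "i = j" by linarith
  with i j show ?thesis by simp
qed

section \<open>Borel sets of a metric space given by a carrier\<close>

context Metric_space
begin

definition mborel :: "'a measure" where
  "mborel = sigma M {W. openin mtopology W}"

lemma mborel_Pow: "{W. openin mtopology W} \<subseteq> Pow M"
  using openin_subset by force

lemma space_mborel [simp]: "space mborel = M"
  unfolding mborel_def by (rule space_measure_of[OF mborel_Pow])

lemma openin_sets_mborel: "openin mtopology W \<Longrightarrow> W \<in> sets mborel"
  unfolding mborel_def by (subst sets_measure_of[OF mborel_Pow]) auto

lemma measurable_mborelI:
  assumes "\<And>x. x \<in> space N \<Longrightarrow> f x \<in> M"
    and "\<And>W. openin mtopology W \<Longrightarrow> f -` W \<inter> space N \<in> sets N"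
  shows "f \<in> measurable N mborel"
  unfolding mborel_def by (rule measurable_measure_of[OF mborel_Pow]) (use assms in auto)

text \<open>Continuity is required in sequential form, which is how it is obtained for functionals
  of paths from limit theorems for integrals. Preimages of closed sets are then sequentially closed,
  hence closed.\<close>

lemma borel_measurable_mborel_sequential:
  fixes F :: "'a \<Rightarrow> 'b::metric_space"
  assumes F: "\<And>\<sigma> l. range \<sigma> \<subseteq> M \<Longrightarrow> limitin mtopology \<sigma> l sequentially \<Longrightarrow> (\<lambda>n. F (\<sigma> n)) \<longlonglongrightarrow> F l"
  shows "F \<in> borel_measurable mborel"
proof (rule borel_measurableI)
  fix W :: "'b set" assume "open W"
  then have cl: "closed (- W)" by (rule closed_Compl)
  have "closedin mtopology {z \<in> M. F z \<notin> W}"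
    unfolding metric_closedin_iff_sequentially_closed
  proof (intro conjI allI impI)
    fix \<sigma> l assume "range \<sigma> \<subseteq> {z \<in> M. F z \<notin> W} \<and> limitin mtopology \<sigma> l sequentially"
    then have r: "range \<sigma> \<subseteq> M" and n: "\<And>n. F (\<sigma> n) \<in> - W" and l: "limitin mtopology \<sigma> l sequentially" by auto
    have "F l \<in> - W" using closed_sequentially[OF cl n F[OF r l]] .
    then show "l \<in> {z \<in> M. F z \<notin> W}" using l by (simp add: limitin_metric)
  qed auto
  then have "openin mtopology (M - {z \<in> M. F z \<notin> W})" by (simp add: closedin_def)
  moreover have "M - {z \<in> M. F z \<notin> W} = F -` W \<inter> space mborel" by auto
  ultimately show "F -` W \<inter> space mborel \<in> sets mborel" by (simp add: openin_sets_mborel)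
qed

lemma measurable_mborel_sequential:
  assumes FM: "\<And>z. z \<in> M \<Longrightarrow> F z \<in> M"
    and F: "\<And>\<sigma> l. range \<sigma> \<subseteq> M \<Longrightarrow> limitin mtopology \<sigma> l sequentially \<Longrightarrow> limitin mtopology (\<lambda>n. F (\<sigma> n)) (F l) sequentially"
  shows "F \<in> measurable mborel mborel"
proof (rule measurable_mborelI)
  fix W assume W: "openin mtopology W"
  have "closedin mtopology {z \<in> M. F z \<notin> W}"
    unfolding metric_closedin_iff_sequentially_closed
  proof (intro conjI allI impI)
    fix \<sigma> l assume "range \<sigma> \<subseteq> {z \<in> M. F z \<notin> W} \<and> limitin mtopology \<sigma> l sequentially"
    then have r: "range \<sigma> \<subseteq> M" and n: "\<And>n. F (\<sigma> n) \<notin> W" and l: "limitin mtopology \<sigma> l sequentially" by auto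
    have "F l \<notin> W"
    proof
      assume "F l \<in> W"
      from limitinD[OF F[OF r l] W this] n show False by simp
    qed
    then show "l \<in> {z \<in> M. F z \<notin> W}" using l by (simp add: limitin_metric)
  qed auto
  then have "openin mtopology (M - {z \<in> M. F z \<notin> W})" by (simp add: closedin_def)
  moreover have "M - {z \<in> M. F z \<notin> W} = F -` W \<inter> space mborel" by auto
  ultimately show "F -` W \<inter> space mborel \<in> sets mborel" by (simp add: openin_sets_mborel)
qed (use FM in simp)

text \<open>A limit lies in the open set \<open>W\<close> exactly when, for some \<open>k\<close>,
  the sequence is eventually in the set \<open>F k\<close> of points at distance at least
  \<open>1/(k+1)\<close> from the complement. Each \<open>F k\<close> is closed, so the preimage of
  \<open>W\<close> is a countable combination of measurable sets, and no separability is
  involved.\<close>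

lemma measurable_mborel_limit:
  assumes Z: "\<And>n. Z n \<in> measurable N mborel"
    and lim: "\<And>x. x \<in> space N \<Longrightarrow> limitin mtopology (\<lambda>n. Z n x) (Z' x) sequentially"
  shows "Z' \<in> measurable N mborel"
proof (rule measurable_mborelI)
  show Z'M: "Z' x \<in> M" if "x \<in> space N" for x
    using lim[OF that] by (simp add: limitin_metric)
  fix W assume W: "openin mtopology W"
  then have WM: "W \<subseteq> M" using openin_subset by fastforce
  define F where "F k = {z \<in> M. \<forall>y\<in>M - W. 1 / real (Suc k) \<le> d y z}" for k
  have F: "F k \<in> sets mborel" for k
  proof -
    have "F k = space mborel - (\<Union>y\<in>M - W. mball y (1 / real (Suc k)))"
      by (auto simp: F_def not_le[symmetric])
    moreover have "(\<Union>y\<in>M - W. mball y (1 / real (Suc k))) \<in> sets mborel"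
      by (intro openin_sets_mborel openin_Union) auto
    ultimately show ?thesis by (metis sets.compl_sets)
  qed
  have iff: "Z' x \<in> W \<longleftrightarrow> (\<exists>k m. \<forall>n\<ge>m. Z n x \<in> F k)" if x: "x \<in> space N" for x
  proof
    assume "Z' x \<in> W"
    then obtain r where r: "r > 0" "mball (Z' x) r \<subseteq> W"
      using W by (auto simp: openin_mtopology)
    obtain k where k: "1 / real (Suc k) < r / 2"
      using r(1) nat_approx_posE[of "r/2"] by auto
    obtain m where m: "\<forall>n\<ge>m. Z n x \<in> M \<and> d (Z n x) (Z' x) < r / 2"
      using lim[OF x] r(1) unfolding limitin_metric eventually_sequentially by (meson half_gt_zero)
    have "Z n x \<in> F k" if "n \<ge> m" for n
      unfolding F_def
    proof (intro CollectI conjI ballI)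
      show "Z n x \<in> M" using m that by blast
      fix y assume y: "y \<in> M - W"
      then have "\<not> d (Z' x) y < r" using r Z'M[OF x] by auto
      then show "1 / real (Suc k) \<le> d y (Z n x)"
        using k m[rule_format, OF that] triangle[of "Z' x" "Z n x" y] Z'M[OF x] y
        by (simp add: commute)
    qed
    then show "\<exists>k m. \<forall>n\<ge>m. Z n x \<in> F k" by blast
  next
    assume "\<exists>k m. \<forall>n\<ge>m. Z n x \<in> F k"
    then obtain k m where km: "\<And>n. n \<ge> m \<Longrightarrow> Z n x \<in> F k" by blast
    show "Z' x \<in> W"
    proof (rule ccontr)
      assume n: "Z' x \<notin> W"
      obtain m' where m': "\<forall>n\<ge>m'. Z n x \<in> M \<and> d (Z n x) (Z' x) < 1 / real (Suc k)"
        using lim[OF x] unfolding limitin_metric eventually_sequentially by (metis of_nat_0_less_iff zero_less_Suc zero_less_divide_1_iff)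
      have "Z (max m m') x \<in> F k" by (rule km) simp
      moreover have "d (Z (max m m') x) (Z' x) < 1 / real (Suc k)" using m' by simp
      ultimately show False using n Z'M[OF x] by (auto simp: F_def commute not_le[symmetric])
    qed
  qed
  have "Z' -` W \<inter> space N = (\<Union>k. \<Union>m. \<Inter>n\<in>{m..}. Z n -` F k \<inter> space N)"
  proof (rule set_eqI)
    fix x
    have "x \<in> (\<Union>k. \<Union>m. \<Inter>n\<in>{m..}. Z n -` F k \<inter> space N) \<longleftrightarrow> (\<exists>k m. \<forall>n\<ge>m. Z n x \<in> F k \<and> x \<in> space N)"
      by (simp only: UN_iff INT_iff Int_iff vimage_eq UNIV_I simp_thms atLeast_iff Ball_def Bex_def)
    also have "\<dots> \<longleftrightarrow> x \<in> space N \<and> (\<exists>k m. \<forall>n\<ge>m. Z n x \<in> F k)" by auto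
    also have "\<dots> \<longleftrightarrow> x \<in> Z' -` W \<inter> space N"
      by (cases "x \<in> space N") (simp_all add: iff)
    finally show "x \<in> Z' -` W \<inter> space N \<longleftrightarrow> x \<in> (\<Union>k. \<Union>m. \<Inter>n\<in>{m..}. Z n -` F k \<inter> space N)" ..
  qed
  also have "\<dots> \<in> sets N"
    by (intro sets.countable_UN'' sets.countable_INT' image_subsetI countableI_type measurable_sets[OF Z F]) auto
  finally show "Z' -` W \<inter> space N \<in> sets N" .
qed

lemma measurable_mborel_countable_range:
  assumes "h \<in> measurable N (count_space UNIV)" "\<And>i::nat. c i \<in> M"
  shows "(\<lambda>x. c (h x)) \<in> measurable N mborel"
  by (rule measurable_compose[OF assms(1)]) (use assms(2) in auto)

text \<open>The limit is found through a Borel isomorphism of the union of the \<open>K j\<close> with a set of reals: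
  the ternary digits of a point record in which small balls around a countable set of centres it
  lies. For a sequence of points, convergence of the codes makes the membership in each ball
  eventually constant; if the sequence also meets one \<open>K j\<close> infinitely often, it is Cauchy.\<close>

theorem Skorohod_tight:
  fixes \<mu> :: "nat \<Rightarrow> 'a measure"
  assumes comp: mcomplete
    and pr: "\<And>n. prob_space (\<mu> n)" and sets: "\<And>n. sets (\<mu> n) = sets mborel"
    and K: "\<And>j. K j \<in> sets mborel" and tb: "\<And>j. mtotally_bounded (K j)"
    and tight: "\<And>n j. measure (\<mu> n) (K j) \<ge> 1 - (1/2)^j"
  obtains s :: "nat \<Rightarrow> nat" and P :: "real measure" and Z Z' where
    "strict_mono s" "prob_space P" "\<forall>n. Z n \<in> measurable P mborel" "Z' \<in> measurable P mborel"
    "\<forall>n. distr P mborel (Z n) = \<mu> (s n)"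
    "AE u in P. limitin mtopology (\<lambda>n. Z n u) (Z' u) sequentially"
proof -
  interpret \<mu>: prob_space "\<mu> n" for n by (rule pr)
  have sp: "space (\<mu> n) = M" for n using sets_eq_imp_space_eq[OF sets] by simp
  obtain a where a: "a \<in> M" using \<mu>.not_empty[of 0] sp by auto
  have "\<forall>j k. \<exists>F. finite F \<and> F \<subseteq> K j \<and> K j \<subseteq> (\<Union>x\<in>F. mball x ((1/2)^k))"
    using tb unfolding mtotally_bounded_def by simp
  then obtain F where F: "\<And>j k. finite (F j k)" "\<And>j k. F j k \<subseteq> K j" "\<And>j k. K j \<subseteq> (\<Union>x\<in>F j k. mball x ((1/2)^k))"
    by metis
  have KM: "K j \<subseteq> M" for j using sets.sets_into_space[OF K] by simp
  \<comment> \<open>The point \<open>a\<close> makes \<open>C\<close> nonempty, so that the natural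
    numbers enumerate it.\<close>
  define C where "C = insert a (\<Union>j k. F j k)"
  have "countable C" unfolding C_def by (auto intro!: countable_UN countable_finite[OF F(1)])
  have "C \<subseteq> M" unfolding C_def using a F(2) KM by blast
  define c where "c = from_nat_into C"
  have rc: "range c = C" unfolding c_def using \<open>countable C\<close> by (simp add: C_def range_from_nat_into)
  have cM: "c i \<in> M" for i using rc \<open>C \<subseteq> M\<close> by blast
  have cover: "\<exists>n. K j \<subseteq> (\<Union>i<n. mball (c i) ((1/2)^k))" for j k
  proof -
    have "F j k \<subseteq> range c" unfolding rc C_def by blast
    then obtain I where I: "finite I" "F j k = c ` I" using F(1) finite_subset_image[of "F j k" c UNIV] by blast
    obtain n where "I \<subseteq> {..<n}" using finite_nat_bounded[OF I(1)] by blast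
    then have "K j \<subseteq> (\<Union>i<n. mball (c i) ((1/2)^k))" using F(3)[of j k] I(2) by fastforce
    then show ?thesis by blast
  qed
  \<comment> \<open>The pairing of natural numbers lets one sequence of bits store the tests for all
    centres \<open>c i\<close> and all radii \<open>(1/2)^k\<close>.\<close>
  define bit where "bit n z = (if d (c (fst (prod_decode n))) z < (1/2)^(snd (prod_decode n)) then 1 else 0 :: nat)" for n z
  have bit1: "bit n z \<le> 1" for n z by (simp add: bit_def)
  define e where "e z = ternary (\<lambda>n. bit n z)" for z
  have bitm [measurable]: "bit n \<in> measurable mborel (count_space UNIV)" for n
  proof -
    have "{z \<in> space mborel. d (c (fst (prod_decode n))) z < (1/2)^(snd (prod_decode n))} \<in> sets mborel"
    proof -
      have "{z \<in> space mborel. d (c (fst (prod_decode n))) z < (1/2)^(snd (prod_decode n))} = mball (c (fst (prod_decode n))) ((1/2)^(snd (prod_decode n)))"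
        using cM by auto
      then show ?thesis by (simp add: openin_sets_mborel)
    qed
    then show ?thesis unfolding bit_def by (intro measurable_If) auto
  qed
  have em [measurable]: "e \<in> borel_measurable mborel"
    unfolding e_def ternary_def by measurable
  \<comment> \<open>Decoding at scale \<open>k\<close>: the least index with a set bit names a
    centre within \<open>(1/2)^k\<close> of the coded point. On a number that codes no such centre
    the value is unspecified, yet still a measurable function of \<open>y\<close>.\<close>
  define idx where "idx k y = (LEAST i. ternary_digit (prod_encode (i,k)) y = 1)" for k y
  have idxm [measurable]: "idx k \<in> measurable borel (count_space UNIV)" for k
    unfolding idx_def ternary_digit_def by measurable
  \<comment> \<open>On \<open>G\<close> the decoded centres are Cauchy. Elsewhere \<open>h\<close>
    falls back on the constant centre \<open>c 0\<close>, so that the decoder \<open>g\<close> is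
    defined and measurable on the whole line.\<close>
  define G where "G = {y. \<forall>m. \<exists>N. \<forall>n\<ge>N. \<forall>n'\<ge>N. d (c (idx n y)) (c (idx n' y)) < 1 / real (Suc m)}"
  have Gm [measurable]: "G \<in> sets borel"
  proof -
    have [measurable]: "(\<lambda>y. d (c (idx n y)) (c (idx n' y))) \<in> borel_measurable borel" for n n'
      by measurable
    show ?thesis unfolding G_def by measurable
  qed
  define h where "h k y = c (if y \<in> G then idx k y else 0)" for k y
  have hm: "h k \<in> measurable borel mborel" for k
    unfolding h_def by (rule measurable_mborel_countable_range) (use cM in auto)
  have hC: "MCauchy (\<lambda>k. h k y)" for y
  proof (cases "y \<in> G")
    case True
    show ?thesis unfolding MCauchy_def
    proof (intro conjI allI impI)
      show "range (\<lambda>k. h k y) \<subseteq> M" using cM by (auto simp: h_def)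
      fix \<epsilon> :: real assume "\<epsilon> > 0"
      then obtain m where m: "1 / real (Suc m) < \<epsilon>" using nat_approx_posE by blast
      then show "\<exists>N. \<forall>n n'. N \<le> n \<longrightarrow> N \<le> n' \<longrightarrow> d (h n y) (h n' y) < \<epsilon>"
        using True unfolding G_def h_def by (simp del: of_nat_Suc) (meson less_trans)
    qed
  next
    case False
    then show ?thesis using cM by (simp add: h_def)
  qed
  define g where "g y = (SOME l. limitin mtopology (\<lambda>k. h k y) l sequentially)" for y
  have g: "limitin mtopology (\<lambda>k. h k y) (g y) sequentially" for y
    unfolding g_def using hC[of y] comp unfolding mcomplete_def by (rule_tac someI_ex) blast
  have gm [measurable]: "g \<in> measurable borel mborel"
    by (rule measurable_mborel_limit[OF hm g])
  define S where "S = (\<Union>j. K j)"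
  have S [measurable]: "S \<in> sets mborel" unfolding S_def using K by auto
  \<comment> \<open>For a point of some \<open>K j\<close> there is a centre within
    \<open>(1/2)^k\<close> at every scale, since the enumeration contains all the finite nets. The
    decoded centres converge to the point, so \<open>g\<close> inverts \<open>e\<close> on
    \<open>S\<close>.\<close>
  have ge: "g (e z) = z" if "z \<in> S" for z
  proof -
    obtain j where j: "z \<in> K j" using \<open>z \<in> S\<close> by (auto simp: S_def)
    then have zM: "z \<in> M" using KM by blast
    have ex: "d (c (idx k (e z))) z < (1/2)^k" for k
    proof -
      have dig: "ternary_digit (prod_encode (i,k)) (e z) = 1 \<longleftrightarrow> d (c i) z < (1/2)^k" for i
        unfolding e_def using ternary_digit_ternary[of "\<lambda>n. bit n z" "prod_encode (i,k)"] bit1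
        by (simp add: bit_def)
      obtain i where "d (c i) z < (1/2)^k" using cover[of j k] j by (fastforce dest: subsetD)
      then show ?thesis unfolding idx_def dig by (rule LeastI)
    qed
    have L: "limitin mtopology (\<lambda>k. c (idx k (e z))) z sequentially"
      unfolding limitin_metric
    proof (intro conjI allI impI zM)
      fix \<epsilon> :: real assume "\<epsilon> > 0"
      have "\<forall>\<^sub>F k in sequentially. (1/2::real)^k < \<epsilon>"
        using order_tendstoD(2)[OF LIMSEQ_realpow_zero[of "1/2::real"] _ ] \<open>\<epsilon> > 0\<close> by simp
      then show "\<forall>\<^sub>F k in sequentially. c (idx k (e z)) \<in> M \<and> d (c (idx k (e z))) z < \<epsilon>"
        by eventually_elim (use ex cM less_trans in blast)
    qed
    have "e z \<in> G"
    proof -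
      have "MCauchy (\<lambda>k. c (idx k (e z)))"
        by (rule convergent_imp_MCauchy[OF _ L]) (use cM in auto)
      then show ?thesis unfolding G_def MCauchy_def by simp
    qed
    then have "limitin mtopology (\<lambda>k. c (idx k (e z))) (g (e z)) sequentially"
      using g[of "e z"] by (simp add: h_def)
    then show ?thesis using L limitin_metric_unique trivial_limit_sequentially by blast
  qed
  have AES: "AE z in \<mu> n. z \<in> S" for n
  proof -
    have "1 \<le> measure (\<mu> n) S"
    proof (rule LIMSEQ_le_const2)
      show "(\<lambda>j. 1 - (1/2::real)^j) \<longlonglongrightarrow> 1"
        using tendsto_diff[OF tendsto_const[of "1::real"] LIMSEQ_realpow_zero[of "1/2::real"]] by simp
      have "1 - (1/2)^j \<le> measure (\<mu> n) S" for j
      proof -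
        have "measure (\<mu> n) (K j) \<le> measure (\<mu> n) S"
          by (rule \<mu>.finite_measure_mono) (use S sets in \<open>auto simp: S_def\<close>)
        with tight[of j n] show ?thesis by linarith
      qed
      then show "\<exists>N. \<forall>j\<ge>N. 1 - (1/2)^j \<le> measure (\<mu> n) S" by blast
    qed
    then show ?thesis
      using \<mu>.prob_le_1[of n S] by (intro \<mu>.AE_prob_1) linarith
  qed
  have em' [measurable]: "e \<in> borel_measurable (\<mu> n)" for n
    using em by (simp add: measurable_cong_sets[OF sets refl])
  define \<nu> where "\<nu> n = distr (\<mu> n) borel e" for n
  have rd: "real_distribution (\<nu> n)" for n
    unfolding \<nu>_def real_distribution_def real_distribution_axioms_def using \<mu>.prob_space_distr[OF em'] by simp
  \<comment> \<open>All codes lie between 0 and 1/2, so their laws are tight automatically. The sets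
    \<open>K j\<close> are what later lifts convergence of codes to convergence of points.\<close>
  have tightn: "tight \<nu>" unfolding tight_def
  proof (intro conjI allI impI rd)
    fix \<epsilon> :: real assume "\<epsilon> > 0"
    have "measure (\<nu> n) {-1<..1} = 1" for n
    proof -
      have "measure (\<nu> n) {-1<..1} = measure (\<mu> n) (e -` {-1<..1} \<inter> space (\<mu> n))"
        unfolding \<nu>_def by (rule measure_distr) auto
      also have "e -` {-1<..1} \<inter> space (\<mu> n) = space (\<mu> n)"
        unfolding e_def using ternary_bounds[of "\<lambda>n. bit n z" for z] bit1 by (force intro: order.trans[of _ "1/2::real"] less_le_trans[of _ "0::real"])
      finally show ?thesis by (simp add: \<mu>.prob_space)
    qed
    then show "\<exists>a b. a < b \<and> (\<forall>n. 1 - \<epsilon> < measure (\<nu> n) {a<..b})"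
      using \<open>\<epsilon> > 0\<close> by (intro exI[of _ "-1"] exI[of _ 1]) auto
  qed
  obtain s \<nu>' where s: "strict_mono s" and \<nu>': "real_distribution \<nu>'" and wc: "weak_conv_m (\<nu> \<circ> id \<circ> s) \<nu>'"
    using tight_imp_convergent_subsubsequence[OF tightn strict_mono_id] by blast
  obtain P :: "real measure" and Y Y' where P: "prob_space P"
    and Ym: "\<forall>n. Y n \<in> measurable P borel" and Yd: "\<forall>n. distr P borel (Y n) = \<nu> (s n)"
    and Ylim: "\<forall>u\<in>space P. (\<lambda>n. Y n u) \<longlonglongrightarrow> Y' u"
    using Skorohod[OF _ \<nu>' wc] rd by auto
  interpret P: prob_space P by (rule P)
  have Ym [measurable]: "Y n \<in> measurable P borel" for n using Ym by blast
  define Z where "Z n u = g (Y n u)" for n u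
  have Zm [measurable]: "Z n \<in> measurable P mborel" for n unfolding Z_def by measurable
  have ZM: "u \<in> space P \<Longrightarrow> Z n u \<in> M" for n u using measurable_space[OF Zm] by simp
  have Zd: "distr P mborel (Z n) = \<mu> (s n)" for n
  proof -
    have "distr P mborel (Z n) = distr (distr P borel (Y n)) mborel g"
      unfolding Z_def by (subst distr_distr) (auto simp: comp_def)
    also have "\<dots> = distr (distr (\<mu> (s n)) borel e) mborel g"
      using Yd by (simp add: \<nu>_def)
    also have "\<dots> = distr (\<mu> (s n)) mborel (\<lambda>z. g (e z))"
      by (subst distr_distr) (auto simp: comp_def)
    also have "\<dots> = distr (\<mu> (s n)) (\<mu> (s n)) (\<lambda>z. z)"
    proof (rule distr_cong_AE)
      show "AE z in \<mu> (s n). g (e z) = z" using AES[of "s n"] by eventually_elim (rule ge)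
    qed (auto simp: sets measurable_cong_sets[OF refl sets] measurable_ident_sets)
    finally show ?thesis by simp
  qed
  \<comment> \<open>\<open>Y n\<close> has the law of a code under \<open>\<mu> (s n)\<close>, so it
    almost surely equals the code of a point of \<open>S\<close>, and encoding the decoded point
    gives it back.\<close>
  have AE1: "AE u in P. e (Z n u) = Y n u" for n
  proof -
    have "AE y in distr (\<mu> (s n)) borel e. e (g y) = y"
    proof (subst AE_distr_iff)
      show "AE z in \<mu> (s n). e (g (e z)) = e z" using AES[of "s n"] by eventually_elim (simp add: ge)
    qed auto
    then have "AE y in distr P borel (Y n). e (g y) = y" unfolding Yd[rule_format] \<nu>_def .
    then show ?thesis unfolding Z_def by (rule AE_distrD[OF Ym])
  qed
  \<comment> \<open>The event of avoiding \<open>K j\<close> from time \<open>m\<close> on has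
    probability at most \<open>(1/2)^j\<close> by looking at time \<open>m\<close> alone. Letting
    \<open>m\<close> and then \<open>j\<close> grow shows that almost surely some \<open>K j\<close>
    is visited infinitely often.\<close>
  define A where "A j m = {u \<in> space P. \<forall>n\<ge>m. Z n u \<notin> K j}" for j m
  have Km [measurable]: "K j \<in> sets mborel" for j by (rule K)
  have Am [measurable]: "A j m \<in> sets P" for j m unfolding A_def by measurable
  have Ab: "measure P (A j m) \<le> (1/2)^j" for j m
  proof -
    have "measure P (A j m) \<le> measure P (space P - (Z m -` K j \<inter> space P))"
      by (rule P.finite_measure_mono) (auto simp: A_def)
    also have "\<dots> = 1 - measure P (Z m -` K j \<inter> space P)"
      by (rule P.prob_compl) measurable
    also have "measure P (Z m -` K j \<inter> space P) = measure (\<mu> (s m)) (K j)"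
      unfolding Zd[symmetric] by (rule measure_distr[symmetric]) auto
    finally show ?thesis using tight[of j "s m"] by linarith
  qed
  have Ab': "measure P (\<Union>m. A j m) \<le> (1/2)^j" for j
  proof (rule LIMSEQ_le_const2)
    show "(\<lambda>m. measure P (A j m)) \<longlonglongrightarrow> measure P (\<Union>m. A j m)"
      by (rule P.finite_Lim_measure_incseq) (auto simp: A_def incseq_def)
  qed (use Ab in blast)
  have "measure P (\<Inter>j. \<Union>m. A j m) \<le> 0"
  proof (rule LIMSEQ_le_const)
    show "(\<lambda>j. (1/2::real)^j) \<longlonglongrightarrow> 0" by (rule LIMSEQ_realpow_zero) auto
    have "measure P (\<Inter>j. \<Union>m. A j m) \<le> (1/2)^j" for j
      by (rule order.trans[OF P.finite_measure_mono Ab'[of j]]) auto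
    then show "\<exists>N. \<forall>j\<ge>N. measure P (\<Inter>j. \<Union>m. A j m) \<le> (1/2)^j" by blast
  qed
  then have "emeasure P (\<Inter>j. \<Union>m. A j m) = 0"
    by (simp add: P.emeasure_eq_measure measure_le_0_iff)
  then have AE2: "AE u in P. u \<notin> (\<Inter>j. \<Union>m. A j m)"
    by (intro AE_not_in null_setsI) auto
  have AE3: "AE u in P. \<forall>n. e (Z n u) = Y n u" using AE1 by (simp add: AE_all_countable)
  have conv: "AE u in P. MCauchy (\<lambda>n. Z n u)"
    using AE2 AE3 AE_space
  proof eventually_elim
    case (elim u)
    then obtain j where j: "\<forall>m. \<exists>n\<ge>m. Z n u \<in> K j" by (auto simp: A_def)
    have "Cauchy (\<lambda>n. Y n u)" using Ylim elim by (intro LIMSEQ_imp_Cauchy) blast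
    then have C: "Cauchy (\<lambda>n. e (Z n u))" using elim by simp
    \<comment> \<open>The codes converge, and codes closer than \<open>(1/2) / 3^Suc i\<close> agree
      in digit \<open>i\<close>.\<close>
    have stab: "\<exists>m0. \<forall>n\<ge>m0. \<forall>n'\<ge>m0. bit i (Z n u) = bit i (Z n' u)" for i
    proof -
      obtain m0 where m0: "\<forall>n\<ge>m0. \<forall>n'\<ge>m0. \<bar>e (Z n u) - e (Z n' u)\<bar> < (1/2) / 3^Suc i"
        using C[unfolded Cauchy_def dist_real_def, rule_format, of "(1/2) / 3^Suc i"] by auto
      have "bit i (Z n u) = bit i (Z n' u)" if "n \<ge> m0" "n' \<ge> m0" for n n'
        using ternary_close[of "\<lambda>m. bit m (Z n u)" "\<lambda>m. bit m (Z n' u)" i] bit1 m0[rule_format, OF that]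
        unfolding e_def by (simp add: pos_less_divide_eq)
      then show ?thesis by blast
    qed
    show ?case unfolding MCauchy_def
    proof (intro conjI allI impI)
      show "range (\<lambda>n. Z n u) \<subseteq> M" using ZM elim by auto
      fix \<epsilon> :: real assume "\<epsilon> > 0"
      then obtain k where k: "(1/2::real)^k < \<epsilon> / 2" using real_arch_pow_inv[of "\<epsilon>/2" "1/2"] by auto
      obtain q where q: "K j \<subseteq> (\<Union>i<q. mball (c i) ((1/2)^k))" using cover by blast
      obtain m0 where m0: "\<And>i n n'. n \<ge> m0 i \<Longrightarrow> n' \<ge> m0 i \<Longrightarrow> bit i (Z n u) = bit i (Z n' u)"
        using stab by metis
      \<comment> \<open>Only the finitely many balls covering \<open>K j\<close> at scale
        \<open>k\<close> matter. After \<open>m1\<close> their bits are frozen, so one visit to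
        \<open>K j\<close> after \<open>m1\<close> puts all points after \<open>m1\<close> into the
        same ball.\<close>
      define m1 where "m1 = (\<Sum>i<q. m0 (prod_encode (i,k)))"
      have m1: "m0 (prod_encode (i,k)) \<le> m1" if "i < q" for i
        unfolding m1_def using that member_le_sum[of i "{..<q}" "\<lambda>i. m0 (prod_encode (i,k))"] by auto
      obtain n1 where n1: "n1 \<ge> m1" "Z n1 u \<in> K j" using j by blast
      then obtain i where i: "i < q" "d (c i) (Z n1 u) < (1/2)^k" using q by auto
      have near: "d (c i) (Z n u) < (1/2)^k" if "n \<ge> m1" for n
      proof -
        have "bit (prod_encode (i,k)) (Z n u) = bit (prod_encode (i,k)) (Z n1 u)"
          using m0[of "prod_encode (i,k)" n n1] m1[OF i(1)] n1(1) that by simp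
        also have "\<dots> = 1" using i(2) by (simp add: bit_def)
        finally show ?thesis by (simp add: bit_def split: if_splits)
      qed
      have "d (Z n u) (Z n' u) < \<epsilon>" if "n \<ge> m1" "n' \<ge> m1" for n n'
        using near[OF that(1)] near[OF that(2)] k triangle[of "Z n u" "c i" "Z n' u"] ZM elim cM[of i]
        by (simp add: commute)
      then show "\<exists>N. \<forall>n n'. N \<le> n \<longrightarrow> N \<le> n' \<longrightarrow> d (Z n u) (Z n' u) < \<epsilon>" by blast
    qed
  qed
  have "\<exists>N\<in>null_sets P. {u \<in> space P. \<not> MCauchy (\<lambda>n. Z n u)} \<subseteq> N"
    using conv by (simp only: eventually_ae_filter)
  then obtain N where N: "{u \<in> space P. \<not> MCauchy (\<lambda>n. Z n u)} \<subseteq> N" "N \<in> null_sets P" by (elim bexE)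
  have Nm [measurable]: "N \<in> sets P" using N(2) by auto
  \<comment> \<open>Replacing the sequence by a constant on a null set makes the limit exist
    everywhere, as measurability of \<open>Z'\<close> requires.\<close>
  define V where "V n u = (if u \<in> N then a else Z n u)" for n u
  have Vm: "V n \<in> measurable P mborel" for n unfolding V_def
    by (rule measurable_If_set) (use a Nm in auto)
  have VC: "MCauchy (\<lambda>n. V n u)" if "u \<in> space P" for u
  proof (cases "u \<in> N")
    case False
    then have "MCauchy (\<lambda>n. Z n u)" using N(1) that by blast
    with False show ?thesis by (simp add: V_def)
  qed (simp add: V_def a)
  define Z' where "Z' u = (SOME l. limitin mtopology (\<lambda>n. V n u) l sequentially)" for u
  have V': "limitin mtopology (\<lambda>n. V n u) (Z' u) sequentially" if "u \<in> space P" for u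
    unfolding Z'_def by (rule someI_ex) (use VC[OF that] comp in \<open>simp add: mcomplete_def\<close>)
  have Z'm: "Z' \<in> measurable P mborel" by (rule measurable_mborel_limit[OF Vm V'])
  have "AE u in P. limitin mtopology (\<lambda>n. Z n u) (Z' u) sequentially"
    using AE_not_in[OF N(2)] AE_space
  proof eventually_elim
    case (elim u)
    then show ?case using V'[of u] by (simp add: V_def)
  qed
  then show thesis by (rule that[OF s P allI[OF Zm] Z'm allI[OF Zd]])
qed

end

section \<open>Geometry of the cone\<close>

lemma cone_exhaust: obtains x r where "r \<ge> 0" "p = cone_pt x r"
proof -
  have "\<exists>x r. r \<ge> 0 \<and> p = cone_pt x r"
    by transfer (auto simp: cone_rel_def max_def)
  then show thesis using that by blast
qed

lemma cone_radius_nonneg [simp]: "0 \<le> cone_radius p"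
  by (cases p rule: cone_exhaust) simp

lemma cone_pt_base_radius [simp]: "cone_pt (cone_base xbar p) (cone_radius p) = p"
proof (cases p rule: cone_exhaust)
  case (1 x r)
  then show ?thesis by (cases "r = 0") (auto simp: cone_pt_eq_iff)
qed

lemma cone_base_in: "p \<in> cone_over M \<Longrightarrow> xbar \<in> M \<Longrightarrow> cone_base xbar p \<in> M"
  by (auto simp: cone_over_def) (metis cone_base_apex cone_base_pt order_le_less)

text \<open>The identity \<open>1 - cos \<theta> = 2 * (sin (\<theta>/2))^2\<close> turns the law of
  cosines into a sum of a radial and an angular term, both nonnegative. The choice of
  \<open>xbar\<close> is immaterial, since at the apex the product of radii vanishes.\<close>

lemma dist_cone_sq:
  fixes p q :: "'a::metric_space cone"
  shows "(dist p q)\<^sup>2 = (cone_radius p - cone_radius q)\<^sup>2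
    + 4 * (cone_radius p * cone_radius q) * (sin (min (dist (cone_base xbar p) (cone_base xbar q)) pi / 2))\<^sup>2"
proof -
  let ?\<theta> = "min (dist (cone_base xbar p) (cone_base xbar q)) pi"
  have "(dist p q)\<^sup>2 = (cone_radius p)\<^sup>2 + (cone_radius q)\<^sup>2 - 2 * cone_radius p * cone_radius q * cos ?\<theta>"
    using dist_cone_pt[of "cone_radius p" "cone_radius q" "cone_base xbar p" "cone_base xbar q"] by simp
  also have "cos ?\<theta> = 1 - 2 * (sin (?\<theta> / 2))\<^sup>2"
    using cos_double_sin[of "?\<theta> / 2"] by simp
  finally show ?thesis by (simp add: power2_eq_square algebra_simps)
qed

lemma cone_radius_lipschitz:
  fixes p q :: "'a::metric_space cone"
  shows "\<bar>cone_radius p - cone_radius q\<bar> \<le> dist p q"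
proof -
  have "(cone_radius p - cone_radius q)\<^sup>2 \<le> (dist p q)\<^sup>2"
    unfolding dist_cone_sq[of p q undefined] by simp
  then show ?thesis by (metis abs_le_square_iff abs_of_nonneg zero_le_dist)
qed

lemma dist_cone_le_radius_sum:
  fixes p q :: "'a::metric_space cone"
  shows "dist p q \<le> cone_radius p + cone_radius q"
proof (rule power2_le_imp_le)
  define s where "s = (sin (min (dist (cone_base undefined p) (cone_base undefined q)) pi / 2))\<^sup>2"
  have "s \<le> 1" unfolding s_def by (simp add: abs_square_le_1)
  then have "4 * (cone_radius p * cone_radius q) * s \<le> 4 * (cone_radius p * cone_radius q) * 1"
    by (intro mult_left_mono) auto
  then show "(dist p q)\<^sup>2 \<le> (cone_radius p + cone_radius q)\<^sup>2"
    unfolding dist_cone_sq[of p q undefined] s_def[symmetric] by (simp add: power2_eq_square algebra_simps)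
qed simp

section \<open>Comparison of the cone distance with the map (r, r x)\<close>

text \<open>A deliberately crude constant. Up to \<open>pi/3\<close> the cosine is at least 1/2, so
  the difference of the two sides is increasing; beyond, the sine is at least 1/2 while
  \<open>u/4\<close> is below 1/2.\<close>

lemma sin_ge_quarter:
  assumes "0 \<le> u" "u \<le> pi / 2"
  shows "u / 4 \<le> sin u"
proof (cases "u \<le> pi / 3")
  case True
  have "sin 0 - 0 / 4 \<le> sin u - u / 4"
  proof (rule DERIV_nonneg_imp_nondecreasing[OF assms(1)])
    fix v assume v: "0 \<le> v" "v \<le> u"
    have "cos (pi / 3) \<le> cos v" using v True by (intro cos_monotone_0_pi_le) auto
    then have "0 \<le> cos v - 1/4" by (simp add: cos_60)
    moreover have "((\<lambda>v. sin v - v / 4) has_real_derivative cos v - 1/4) (at v)"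
      by (auto intro!: derivative_eq_intros)
    ultimately show "\<exists>y. ((\<lambda>v. sin v - v / 4) has_real_derivative y) (at v) \<and> 0 \<le> y" by blast
  qed
  then show ?thesis by simp
next
  case False
  have "sin (pi / 6) \<le> sin u" using assms False by (intro sin_monotone_2pi_le) auto
  moreover have "u / 4 \<le> 1 / 2" using assms pi_less_4 by linarith
  ultimately show ?thesis by (simp add: sin_30)
qed

text \<open>The second component of the map \<open>(r, r x)\<close>. Unlike the base point it has a
  limit at the apex when the base is bounded.\<close>

definition cone_vec :: "'a::real_normed_vector \<Rightarrow> 'a cone \<Rightarrow> 'a" where
  "cone_vec xbar p = cone_radius p *\<^sub>R cone_base xbar p"

text \<open>The angular term of \<open>dist_cone_sq\<close> controls the geometric mean of the radii
  times the truncated base distance; the factor 4 comes from \<open>sin_ge_quarter\<close>, and the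
  factor \<open>1 + L\<close> undoes the truncation.\<close>

lemma sqrt_radii_dist_le:
  fixes p q :: "'a::real_normed_vector cone"
  assumes L: "norm (cone_base xbar p) \<le> L" "norm (cone_base xbar q) \<le> L"
  shows "sqrt (cone_radius p * cone_radius q) * dist (cone_base xbar p) (cone_base xbar q) \<le> 4 * (1 + L) * dist p q"
proof -
  define R where "R = sqrt (cone_radius p * cone_radius q)"
  define D where "D = dist (cone_base xbar p) (cone_base xbar q)"
  define \<theta> where "\<theta> = min D pi"
  have R2: "R\<^sup>2 = cone_radius p * cone_radius q" "0 \<le> R" by (simp_all add: R_def)
  have \<theta>: "0 \<le> \<theta>" "\<theta> \<le> pi" by (simp_all add: \<theta>_def D_def)
  have L0: "0 \<le> L" using L(1) norm_ge_zero order_trans by blast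
  have D: "0 \<le> D" "D \<le> 2 * L"
    using order.trans[OF norm_triangle_ineq4 add_mono[OF L]] by (simp_all add: D_def dist_norm)
  \<comment> \<open>Truncation at \<open>pi\<close> loses little because base distances are at most
    \<open>2 * L\<close>, which is below \<open>L * pi\<close>.\<close>
  have D\<theta>: "D \<le> (1 + L) * \<theta>"
  proof (cases "D \<le> pi")
    case True
    then show ?thesis using L0 D by (simp add: \<theta>_def algebra_simps)
  next
    case False
    have "2 * L \<le> L * pi" using L0 pi_ge_two by (simp add: mult.commute mult_left_mono)
    with False D show ?thesis by (simp add: \<theta>_def algebra_simps) (use pi_gt_zero in linarith)
  qed
  have "(R * \<theta> / 4)\<^sup>2 = 4 * R\<^sup>2 * (\<theta> / 2 / 4)\<^sup>2" by (simp add: power2_eq_square)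
  also have "\<dots> \<le> 4 * R\<^sup>2 * (sin (\<theta> / 2))\<^sup>2"
    using sin_ge_quarter[of "\<theta> / 2"] \<theta> by (intro mult_left_mono power_mono) auto
  also have "\<dots> \<le> (dist p q)\<^sup>2"
    unfolding dist_cone_sq[of p q xbar] R2 \<theta>_def D_def by simp
  finally have "R * \<theta> / 4 \<le> dist p q" by (rule power2_le_imp_le) simp
  then have "R * \<theta> \<le> 4 * dist p q" by simp
  then have "(1 + L) * (R * \<theta>) \<le> (1 + L) * (4 * dist p q)" using L0 by (intro mult_left_mono) auto
  moreover have "R * D \<le> R * ((1 + L) * \<theta>)" using D\<theta> R2 by (intro mult_left_mono) auto
  ultimately show ?thesis unfolding R_def[symmetric] D_def[symmetric] by (simp add: algebra_simps)
qed

text \<open>With \<open>a \<le> b\<close> for the radii,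
  \<open>a x - b y = a (x - y) + (a - b) y\<close>. Having the smaller radius in front of
  \<open>x - y\<close> allows \<open>a \<le> sqrt (a b)\<close>, so the constant is
  \<open>4 * (1 + L)\<close> for the angular and \<open>L\<close> for the radial part.\<close>

lemma cone_vec_lipschitz:
  fixes p q :: "'a::real_normed_vector cone"
  assumes L: "norm (cone_base xbar p) \<le> L" "norm (cone_base xbar q) \<le> L"
  shows "norm (cone_vec xbar p - cone_vec xbar q) \<le> (4 + 5 * L) * dist p q"
proof -
  have L0: "0 \<le> L" using L(1) norm_ge_zero order_trans by blast
  have *: "norm (cone_vec xbar p - cone_vec xbar q) \<le> (4 + 5 * L) * dist p q"
    if L: "norm (cone_base xbar p) \<le> L" "norm (cone_base xbar q) \<le> L" and le: "cone_radius p \<le> cone_radius q"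
    for p q :: "'a cone"
  proof -
    have "cone_vec xbar p - cone_vec xbar q = cone_radius p *\<^sub>R (cone_base xbar p - cone_base xbar q)
       + (cone_radius p - cone_radius q) *\<^sub>R cone_base xbar q"
      by (simp add: cone_vec_def algebra_simps)
    also have "norm \<dots> \<le> cone_radius p * dist (cone_base xbar p) (cone_base xbar q)
       + \<bar>cone_radius p - cone_radius q\<bar> * norm (cone_base xbar q)"
      by (rule order.trans[OF norm_triangle_ineq]) (simp add: dist_norm)
    also have "cone_radius p * dist (cone_base xbar p) (cone_base xbar q)
        \<le> sqrt (cone_radius p * cone_radius q) * dist (cone_base xbar p) (cone_base xbar q)"
    proof (intro mult_right_mono)
      show "cone_radius p \<le> sqrt (cone_radius p * cone_radius q)"
        by (rule real_le_rsqrt) (use le in \<open>simp add: power2_eq_square mult_left_mono\<close>)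
    qed simp
    also have "\<dots> \<le> 4 * (1 + L) * dist p q" by (rule sqrt_radii_dist_le[OF L])
    also have "\<bar>cone_radius p - cone_radius q\<bar> * norm (cone_base xbar q) \<le> dist p q * L"
      using cone_radius_lipschitz L L0 by (intro mult_mono) auto
    finally show ?thesis by (simp add: algebra_simps)
  qed
  show ?thesis
    using *[of p q] *[of q p] L by (metis dist_commute linear norm_minus_commute)
qed

lemma dist_cone_le:
  fixes p q :: "'a::real_normed_vector cone"
  shows "dist p q \<le> \<bar>cone_radius p - cone_radius q\<bar>
    + sqrt (cone_radius p * cone_radius q) * dist (cone_base xbar p) (cone_base xbar q)"
proof (rule power2_le_imp_le)
  define D where "D = dist (cone_base xbar p) (cone_base xbar q)"
  define R where "R = sqrt (cone_radius p * cone_radius q)"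
  have R2: "R\<^sup>2 = cone_radius p * cone_radius q" "0 \<le> R" by (simp_all add: R_def)
  have "(sin (min D pi / 2))\<^sup>2 \<le> (D / 2)\<^sup>2"
  proof (rule power2_le_iff_abs_le[THEN iffD2])
    show "0 \<le> D / 2" by (simp add: D_def)
    have "\<bar>sin (min D pi / 2)\<bar> \<le> \<bar>min D pi / 2\<bar>" by (rule abs_sin_x_le_abs_x)
    also have "\<dots> \<le> D / 2" by (simp add: D_def)
    finally show "\<bar>sin (min D pi / 2)\<bar> \<le> D / 2" .
  qed
  then have "4 * R\<^sup>2 * (sin (min D pi / 2))\<^sup>2 \<le> 4 * R\<^sup>2 * (D / 2)\<^sup>2"
    by (intro mult_left_mono) auto
  then have "(dist p q)\<^sup>2 \<le> (cone_radius p - cone_radius q)\<^sup>2 + (R * D)\<^sup>2"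
    unfolding dist_cone_sq[of p q xbar] power_mult_distrib R2 D_def by (simp add: power2_eq_square)
  also have "\<dots> \<le> (\<bar>cone_radius p - cone_radius q\<bar> + R * D)\<^sup>2"
    using R2(2) by (simp add: power2_sum D_def)
  finally show "(dist p q)\<^sup>2 \<le> (\<bar>cone_radius p - cone_radius q\<bar>
    + sqrt (cone_radius p * cone_radius q) * dist (cone_base xbar p) (cone_base xbar q))\<^sup>2"
    by (simp add: R_def D_def)
qed simp

text \<open>The converse comparison. If the larger radius is at most twice the smaller one, the
  angular term is estimated by \<open>a (x - y)\<close>, which is rewritten through
  \<open>a x - b y\<close>. Otherwise \<open>sqrt (a b)\<close> is at most twice the difference of
  the radii, and bounded base distances suffice.\<close>

lemma dist_cone_le_vec:
  fixes p q :: "'a::real_normed_vector cone"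
  assumes L: "norm (cone_base xbar p) \<le> L" "norm (cone_base xbar q) \<le> L"
  shows "dist p q \<le> (3 + 6 * L) * \<bar>cone_radius p - cone_radius q\<bar> + 2 * norm (cone_vec xbar p - cone_vec xbar q)"
proof -
  have L0: "0 \<le> L" using L(1) norm_ge_zero order_trans by blast
  have *: "dist p q \<le> (3 + 6 * L) * \<bar>cone_radius p - cone_radius q\<bar> + 2 * norm (cone_vec xbar p - cone_vec xbar q)"
    if L: "norm (cone_base xbar p) \<le> L" "norm (cone_base xbar q) \<le> L" and le: "cone_radius p \<le> cone_radius q"
    for p q :: "'a cone"
  proof -
    define a where "a = cone_radius p"
    define b where "b = cone_radius q"
    define x where "x = cone_base xbar p"
    define y where "y = cone_base xbar q"
    have ab: "0 \<le> a" "a \<le> b" using le by (auto simp: a_def b_def)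
    have xy: "dist x y \<le> 2 * L"
      using order.trans[OF norm_triangle_ineq4 add_mono[OF L]] by (simp add: x_def y_def dist_norm)
    have "sqrt (a * b) * dist x y \<le> (2 + 6 * L) * (b - a) + 2 * norm (a *\<^sub>R x - b *\<^sub>R y)"
    proof (cases "b \<le> 2 * a")
      case True
      have "a * b \<le> (2 * a) * (2 * a)" using ab True by (intro mult_mono) auto
      then have "sqrt (a * b) \<le> 2 * a" using ab by (intro real_le_lsqrt) (auto simp: power2_eq_square)
      then have "sqrt (a * b) * dist x y \<le> 2 * (a * dist x y)" using mult_right_mono[of _ _ "dist x y"] by fastforce
      also have "a * dist x y = norm (a *\<^sub>R (x - y))" using ab by (simp add: dist_norm)
      also have "a *\<^sub>R (x - y) = (a *\<^sub>R x - b *\<^sub>R y) + (b - a) *\<^sub>R y" by (simp add: algebra_simps)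
      also have "norm \<dots> \<le> norm (a *\<^sub>R x - b *\<^sub>R y) + (b - a) * norm y"
        using norm_triangle_ineq[of "a *\<^sub>R x - b *\<^sub>R y" "(b - a) *\<^sub>R y"] ab by simp
      also have "(b - a) * norm y \<le> (b - a) * L" using ab L by (intro mult_left_mono) (auto simp: y_def)
      finally have "sqrt (a * b) * dist x y \<le> 2 * (norm (a *\<^sub>R x - b *\<^sub>R y) + (b - a) * L)" by simp
      moreover have "0 \<le> (b - a) * (2 + 4 * L)" using ab L0 by simp
      ultimately show ?thesis by (simp add: algebra_simps)
    next
      case False
      have "a * b \<le> (2 * (b - a)) * (2 * (b - a))" using ab False by (intro mult_mono) auto
      then have "sqrt (a * b) \<le> 2 * (b - a)" using ab by (intro real_le_lsqrt) (auto simp: power2_eq_square)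
      then have "sqrt (a * b) * dist x y \<le> 2 * (b - a) * (2 * L)" using xy ab by (intro mult_mono) auto
      also have "\<dots> = (2 + 6 * L) * (b - a) - (2 + 2 * L) * (b - a)" by (simp add: algebra_simps)
      also have "\<dots> \<le> (2 + 6 * L) * (b - a)" using ab L0 by simp
      also have "\<dots> \<le> (2 + 6 * L) * (b - a) + 2 * norm (a *\<^sub>R x - b *\<^sub>R y)" by simp
      finally show ?thesis .
    qed
    then show ?thesis
      using dist_cone_le[of p q xbar] ab L0 unfolding a_def[symmetric] b_def[symmetric] x_def[symmetric] y_def[symmetric] cone_vec_def
      by (simp add: algebra_simps)
  qed
  show ?thesis
    using *[of p q] *[of q p] L by (metis abs_minus_commute dist_commute linear norm_minus_commute)
qed

section \<open>Dilations, compactness and continuity on the cone\<close>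

text \<open>The base point \<open>undefined\<close> is harmless: it is read only at the apex, where
  the new radius is zero and every base point gives the same cone point.\<close>

definition cone_scale :: "real \<Rightarrow> 'a cone \<Rightarrow> 'a cone" where
  "cone_scale c p = cone_pt (cone_base undefined p) (c * cone_radius p)"

lemma cone_scale_pt: "0 \<le> c \<Longrightarrow> 0 \<le> r \<Longrightarrow> cone_scale c (cone_pt x r) = cone_pt x (c * r)"
  by (cases "r = 0") (auto simp: cone_scale_def cone_pt_eq_iff)

lemma cone_radius_scale [simp]: "0 \<le> c \<Longrightarrow> cone_radius (cone_scale c p) = c * cone_radius p"
  by (simp add: cone_scale_def)

lemma cone_base_scale [simp]: "0 < c \<Longrightarrow> cone_base xbar (cone_scale c p) = cone_base xbar p"
proof (cases p rule: cone_exhaust)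
  case (1 x r)
  assume "0 < c"
  with 1 show ?thesis by (cases "r = 0") (simp_all add: cone_scale_pt)
qed

lemma cone_scale_in: "0 \<le> c \<Longrightarrow> p \<in> cone_over M \<Longrightarrow> cone_scale c p \<in> cone_over M"
  by (auto simp: cone_over_def) (metis cone_scale_pt mult_nonneg_nonneg)

lemma dist_cone_scale:
  fixes p q :: "'a::metric_space cone"
  assumes "0 < c"
  shows "dist (cone_scale c p) (cone_scale c q) = c * dist p q"
proof (rule power2_eq_imp_eq)
  show "(dist (cone_scale c p) (cone_scale c q))\<^sup>2 = (c * dist p q)\<^sup>2"
    using assms unfolding power_mult_distrib dist_cone_sq[of _ _ undefined]
    by (simp add: power2_eq_square algebra_simps)
qed (use assms in auto)

lemma dist_cone_scale_same:
  fixes p :: "'a::metric_space cone"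
  assumes "0 \<le> a" "0 \<le> b"
  shows "dist (cone_scale a p) (cone_scale b p) = \<bar>a - b\<bar> * cone_radius p"
proof (rule power2_eq_imp_eq)
  show "(dist (cone_scale a p) (cone_scale b p))\<^sup>2 = (\<bar>a - b\<bar> * cone_radius p)\<^sup>2"
  proof (cases "a = 0 \<or> b = 0")
    case True
    then show ?thesis
      using assms unfolding dist_cone_sq[of _ _ undefined] by (auto simp: power_mult_distrib)
  next
    case False
    with assms show ?thesis
      unfolding dist_cone_sq[of _ _ undefined] by (simp add: power2_eq_square algebra_simps)
  qed
qed auto

lemma continuous_on_cone_pt:
  "continuous_on (UNIV \<times> {0..}) (\<lambda>(x::'a::real_normed_vector, r). cone_pt x r)"
proof (clarsimp simp: continuous_on_def)
  fix x :: 'a and r :: real assume r: "0 \<le> r"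
  let ?F = "at (x, r) within UNIV \<times> {0..}"
  have "((\<lambda>q. dist (case q of (x, r) \<Rightarrow> cone_pt x r) (cone_pt x r)) \<longlongrightarrow> 0) ?F"
  proof (rule tendsto_sandwich[OF _ _ tendsto_const])
    show "((\<lambda>q. \<bar>snd q - r\<bar> + sqrt (snd q * r) * dist (fst q) x) \<longlongrightarrow> 0) ?F"
      by (rule tendsto_eq_intros refl | simp)+
    have "dist (cone_pt y s) (cone_pt x r) \<le> \<bar>s - r\<bar> + sqrt (s * r) * dist y x" if s: "0 \<le> s" for y s
    proof (cases "r = 0 \<or> s = 0")
      case True
      then show ?thesis using r s dist_cone_le[of "cone_pt y s" "cone_pt x r"] by auto
    next
      case False
      then show ?thesis using r s dist_cone_le[of "cone_pt y s" "cone_pt x r" x] by auto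
    qed
    then show "\<forall>\<^sub>F q in ?F. dist (case q of (x, r) \<Rightarrow> cone_pt x r) (cone_pt x r) \<le> \<bar>snd q - r\<bar> + sqrt (snd q * r) * dist (fst q) x"
      by (auto simp: eventually_at_filter intro!: always_eventually)
  qed auto
  then show "((\<lambda>(x, r). cone_pt x r) \<longlongrightarrow> cone_pt x r) ?F"
    by (subst tendsto_dist_iff) (simp add: case_prod_unfold)
qed

lemma compact_cone_ball:
  fixes M :: "'a::real_normed_vector set"
  assumes "compact M"
  shows "compact {p \<in> cone_over M. cone_radius p \<le> r}"
proof -
  have "compact ((\<lambda>(x, r). cone_pt x r) ` (M \<times> {0..r}))"
    by (intro compact_continuous_image compact_Times assms compact_Icc
        continuous_on_subset[OF continuous_on_cone_pt]) auto
  moreover have "(\<lambda>(x, r). cone_pt x r) ` (M \<times> {0..r}) = {p \<in> cone_over M. cone_radius p \<le> r}"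
    by (force simp: cone_over_def image_iff)
  ultimately show ?thesis by simp
qed

text \<open>A Cauchy sequence is bounded, hence stays in a compact part of the cone of bounded
  radius.\<close>

lemma complete_cone_over:
  fixes M :: "'a::real_normed_vector set"
  assumes "compact M"
    and f: "\<And>n. f n \<in> cone_over M" and C: "Cauchy f"
  shows "\<exists>l\<in>cone_over M. f \<longlonglongrightarrow> l"
proof -
  obtain B where B: "\<And>n. dist (f 0) (f n) \<le> B"
    using cauchy_imp_bounded[OF C] by (metis bounded_any_center rangeI)
  have "f n \<in> {p \<in> cone_over M. cone_radius p \<le> cone_radius (f 0) + B}" for n
    using f cone_radius_lipschitz[of "f 0" "f n"] B[of n] by auto
  from completeE[OF compact_imp_complete[OF compact_cone_ball[OF assms(1)]] allI[OF this] C]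
  show ?thesis by blast
qed

lemma continuous_on_cone_radius: "continuous_on S (cone_radius :: 'a::metric_space cone \<Rightarrow> real)"
  unfolding continuous_on_iff
  by (metis cone_radius_lipschitz dist_commute dist_real_def le_less_trans)

lemma continuous_on_cone_vec:
  fixes M :: "'a::real_normed_vector set"
  assumes L: "\<And>x. x \<in> M \<Longrightarrow> norm x \<le> L" and xbar: "xbar \<in> M"
  shows "continuous_on (cone_over M) (cone_vec xbar)"
proof -
  have "0 \<le> L" using L[OF xbar] norm_ge_zero order_trans by blast
  then have "(4 + 5 * L)-lipschitz_on (cone_over M) (cone_vec xbar)"
    by (intro lipschitz_onI) (auto simp: dist_norm intro!: cone_vec_lipschitz L cone_base_in[OF _ xbar])
  then show ?thesis by (rule lipschitz_on_continuous_on)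
qed

text \<open>At the apex the base point is discontinuous, but \<open>f\<close> is bounded and the
  factor \<open>r^2\<close> tends to zero. Elsewhere the base point is \<open>cone_vec\<close>
  divided by the radius, a quotient of continuous functions.\<close>

lemma continuous_on_cone_integrand:
  fixes M :: "'a::real_normed_vector set" and f :: "real \<times> 'a \<Rightarrow> real"
  assumes M: "compact M" and xbar: "xbar \<in> M" and f: "continuous_on ({0..T} \<times> M) f"
  shows "continuous_on ({0..T} \<times> cone_over M) (\<lambda>(t, p). f (t, cone_base xbar p) * (cone_radius p)\<^sup>2)"
  unfolding continuous_on_sequentially
proof (intro ballI allI impI, elim conjE)
  fix q :: "real \<times> 'a cone" and u
  assume q: "q \<in> {0..T} \<times> cone_over M" and u: "\<forall>n. u n \<in> {0..T} \<times> cone_over M" and lim: "u \<longlonglongrightarrow> q"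
  obtain L where L: "\<And>x. x \<in> M \<Longrightarrow> norm x \<le> L" using compact_imp_bounded[OF M] by (auto simp: bounded_iff)
  have "bounded (f ` ({0..T} \<times> M))"
    by (intro compact_imp_bounded compact_continuous_image f compact_Times M compact_Icc)
  then obtain B where B: "\<And>x. x \<in> {0..T} \<times> M \<Longrightarrow> \<bar>f x\<bar> \<le> B" by (auto simp: bounded_iff)
  define t where "t n = fst (u n)" for n
  define p where "p n = snd (u n)" for n
  have tp: "t n \<in> {0..T}" "p n \<in> cone_over M" for n using u[rule_format, of n] by (auto simp: t_def p_def mem_Times_iff)
  have q12: "fst q \<in> {0..T}" "snd q \<in> cone_over M" using q by auto
  have tl: "t \<longlonglongrightarrow> fst q" and pl: "p \<longlonglongrightarrow> snd q"
    unfolding t_def p_def by (intro tendsto_intros lim)+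
  have rl: "(\<lambda>n. cone_radius (p n)) \<longlonglongrightarrow> cone_radius (snd q)"
    by (rule continuous_on_tendsto_compose[OF continuous_on_cone_radius[of UNIV] pl]) auto
  have "(\<lambda>n. f (t n, cone_base xbar (p n)) * (cone_radius (p n))\<^sup>2) \<longlonglongrightarrow> f (fst q, cone_base xbar (snd q)) * (cone_radius (snd q))\<^sup>2"
  proof (cases "cone_radius (snd q) = 0")
    case True
    have z: "(\<lambda>n. B * (cone_radius (p n))\<^sup>2) \<longlonglongrightarrow> 0"
      using tendsto_mult[OF tendsto_const tendsto_power[OF rl, of 2], of B] True by simp
    have "(\<lambda>n. f (t n, cone_base xbar (p n)) * (cone_radius (p n))\<^sup>2) \<longlonglongrightarrow> 0"
      by (rule Lim_null_comparison[OF _ z])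
        (use B tp cone_base_in[OF _ xbar] in \<open>auto simp: abs_mult intro!: always_eventually mult_right_mono\<close>)
    then show ?thesis using True by simp
  next
    case False
    then have pos: "cone_radius (snd q) > 0" using cone_radius_nonneg[of "snd q"] by linarith
    have base: "cone_base xbar p = (1 / cone_radius p) *\<^sub>R cone_vec xbar p" if "cone_radius p > 0" for p :: "'a cone"
      using that by (simp add: cone_vec_def)
    have vl: "(\<lambda>n. cone_vec xbar (p n)) \<longlonglongrightarrow> cone_vec xbar (snd q)"
      by (rule continuous_on_tendsto_compose[OF continuous_on_cone_vec[OF L xbar] pl]) (use tp q12 in auto)
    have "(\<lambda>n. (1 / cone_radius (p n)) *\<^sub>R cone_vec xbar (p n)) \<longlonglongrightarrow> (1 / cone_radius (snd q)) *\<^sub>R cone_vec xbar (snd q)"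
      using pos by (intro tendsto_intros rl vl) auto
    then have bl: "(\<lambda>n. cone_base xbar (p n)) \<longlonglongrightarrow> cone_base xbar (snd q)"
      unfolding base[OF pos]
    proof (rule Lim_transform_eventually)
      show "\<forall>\<^sub>F n in sequentially. (1 / cone_radius (p n)) *\<^sub>R cone_vec xbar (p n) = cone_base xbar (p n)"
        using order_tendstoD(1)[OF rl pos] by eventually_elim (simp add: base)
    qed
    have "(\<lambda>n. f (t n, cone_base xbar (p n))) \<longlonglongrightarrow> f (fst q, cone_base xbar (snd q))"
      by (rule continuous_on_tendsto_compose[OF f tendsto_Pair[OF tl bl]])
        (use tp q12 cone_base_in[OF _ xbar] in auto)
    then show ?thesis by (intro tendsto_intros rl)
  qed
  then show "((\<lambda>(t, p). f (t, cone_base xbar p) * (cone_radius p)\<^sup>2) \<circ> u) \<longlonglongrightarrow> (case q of (t, p) \<Rightarrow> f (t, cone_base xbar p) * (cone_radius p)\<^sup>2)"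
    by (simp add: comp_def case_prod_unfold t_def p_def)
qed

section \<open>Metric speed and action of paths in the cone\<close>

text \<open>For intervals containing \<open>t\<close> the two remainders add up to
  \<open>o(b - a)\<close>, because \<open>\<bar>b - t\<bar> + \<bar>a - t\<bar> = b - a\<close>.
  This is the form that suits dyadic intervals, which rarely have \<open>t\<close> as an endpoint;
  for intervals merely close to \<open>t\<close> it would fail.\<close>

lemma vector_derivative_straddle:
  fixes g :: "real \<Rightarrow> 'b::real_normed_vector"
  assumes g: "(g has_vector_derivative D) (at t)"
    and ab: "\<forall>\<^sub>F i in F. a i \<le> t \<and> t \<le> b i \<and> a i < b i" and a: "(a \<longlongrightarrow> t) F" and b: "(b \<longlongrightarrow> t) F"
  shows "((\<lambda>i. (g (b i) - g (a i)) /\<^sub>R (b i - a i)) \<longlongrightarrow> D) F"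
proof (rule tendstoI)
  fix e :: real assume e: "e > 0"
  have "(g has_derivative (\<lambda>h. h *\<^sub>R D)) (at t)" using g by (simp add: has_vector_derivative_def)
  then obtain d where d: "d > 0" "\<And>s. norm (s - t) < d \<Longrightarrow> norm (g s - g t - (s - t) *\<^sub>R D) \<le> (e / 2) * norm (s - t)"
    unfolding has_derivative_at_alt using e half_gt_zero by metis
  have "\<forall>\<^sub>F i in F. dist (a i) t < d" "\<forall>\<^sub>F i in F. dist (b i) t < d"
    using a b d(1) by (auto dest: tendstoD)
  with ab show "\<forall>\<^sub>F i in F. dist ((g (b i) - g (a i)) /\<^sub>R (b i - a i)) D < e"
  proof eventually_elim
    case (elim i)
    have pos: "b i - a i > 0" using elim by simp
    have "g (b i) - g (a i) - (b i - a i) *\<^sub>R D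
        = (g (b i) - g t - (b i - t) *\<^sub>R D) - (g (a i) - g t - (a i - t) *\<^sub>R D)"
      by (simp add: algebra_simps)
    also have "norm \<dots> \<le> (e / 2) * \<bar>b i - t\<bar> + (e / 2) * \<bar>a i - t\<bar>"
      using d(2)[of "b i"] d(2)[of "a i"] elim
      by (intro order.trans[OF norm_triangle_ineq4 add_mono]) (auto simp: dist_norm)
    also have "\<dots> = (e / 2) * (b i - a i)"
      proof -
        have "\<bar>a i - t\<bar> = t - a i" "\<bar>b i - t\<bar> = b i - t" using elim by auto
        then show ?thesis by (simp only: distrib_left[symmetric]) simp
      qed
    finally have "norm (g (b i) - g (a i) - (b i - a i) *\<^sub>R D) / (b i - a i) \<le> e / 2"
      using pos by (simp add: pos_divide_le_eq)
    moreover have "v /\<^sub>R h - D = (v - h *\<^sub>R D) /\<^sub>R h" "norm (v /\<^sub>R h) = norm v / h" if "h > 0" for v :: 'b and h :: real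
      using that by (simp_all add: scaleR_diff_right divide_inverse mult.commute)
    ultimately have "norm ((g (b i) - g (a i)) /\<^sub>R (b i - a i) - D) \<le> e / 2"
      using pos by (simp only:)
    then show ?case using e unfolding dist_norm by linarith
  qed
qed

text \<open>Where the radius is positive, the base point is a differentiable quotient and the
  half-angle formula passes to the limit. Where it vanishes, the radius has a minimum, so
  \<open>r' = 0\<close>; the distance, at most the sum of the radii, is then
  \<open>o(b - a)\<close>, in agreement with the speed being zero there by definition.\<close>

lemma cone_speed_sq_limit:
  fixes z :: "real \<Rightarrow> 'a::euclidean_space cone"
  assumes t: "t \<in> {0<..<T}"
    and dr: "((\<lambda>s. cone_radius (z s)) has_real_derivative r') (at t)"
    and dw: "((\<lambda>s. cone_vec xbar (z s)) has_vector_derivative w') (at t)"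
    and ab: "\<forall>\<^sub>F i in F. a i \<le> t \<and> t \<le> b i \<and> a i < b i" and a: "(a \<longlongrightarrow> t) F" and b: "(b \<longlongrightarrow> t) F"
  shows "((\<lambda>i. (dist (z (a i)) (z (b i)) / (b i - a i))\<^sup>2) \<longlongrightarrow> cone_speed_sq xbar T z t) F"
proof -
  define r where "r s = cone_radius (z s)" for s
  define x where "x s = cone_base xbar (z s)" for s
  have at: "at t within {0..T} = at t" using t by (intro at_within_interior) auto
  have dr: "(r has_real_derivative r') (at t)" using dr by (simp add: r_def[abs_def])
  have rq: "((\<lambda>i. (r (b i) - r (a i)) / (b i - a i)) \<longlongrightarrow> r') F"
    using vector_derivative_straddle[OF dr[unfolded has_real_derivative_iff_has_vector_derivative] ab a b]
    by (simp add: divide_inverse_commute)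
  have rc: "isCont r t" using dr by (rule DERIV_isCont)
  have ra: "((\<lambda>i. r (a i)) \<longlongrightarrow> r t) F" and rb: "((\<lambda>i. r (b i)) \<longlongrightarrow> r t) F"
    using isCont_tendsto_compose[OF rc a] isCont_tendsto_compose[OF rc b] .
  show ?thesis
  proof (cases "r t = 0")
    case True
    have "r' = 0"
    proof (rule DERIV_local_min[OF dr])
      show "0 < (1::real)" "\<forall>y. \<bar>t - y\<bar> < 1 \<longrightarrow> r t \<le> r y" using True by (auto simp: r_def)
    qed
    have 1: "((\<lambda>i. (dist (z (a i)) (z (b i)) / (b i - a i))) \<longlongrightarrow> 0) F"
    proof (rule tendstoI)
      fix e :: real assume e: "e > 0"
      have "(r has_derivative (\<lambda>h. h *\<^sub>R 0)) (at t)"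
      proof -
        have "(*) (0::real) = (\<lambda>h. h *\<^sub>R 0)" by auto
        then show ?thesis using dr \<open>r' = 0\<close> by (simp only: has_field_derivative_def)
      qed
      then obtain d where d: "d > 0" "\<And>s. norm (s - t) < d \<Longrightarrow> norm (r s - r t - (s - t) *\<^sub>R 0) \<le> (e / 2) * norm (s - t)"
        unfolding has_derivative_at_alt using e half_gt_zero by metis
      have "\<forall>\<^sub>F i in F. dist (a i) t < d" "\<forall>\<^sub>F i in F. dist (b i) t < d"
        using a b d(1) by (auto dest: tendstoD)
      with ab show "\<forall>\<^sub>F i in F. dist (dist (z (a i)) (z (b i)) / (b i - a i)) 0 < e"
      proof eventually_elim
        case (elim i)
        have "dist (z (a i)) (z (b i)) \<le> r (a i) + r (b i)"
          unfolding r_def by (rule dist_cone_le_radius_sum)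
        also have "\<dots> \<le> (e / 2) * \<bar>a i - t\<bar> + (e / 2) * \<bar>b i - t\<bar>"
          using d(2)[of "b i"] d(2)[of "a i"] elim True
          by (intro add_mono) (auto simp: dist_norm r_def)
        also have "\<dots> = (e / 2) * (b i - a i)"
      proof -
        have "\<bar>a i - t\<bar> = t - a i" "\<bar>b i - t\<bar> = b i - t" using elim by auto
        then show ?thesis by (simp only: distrib_left[symmetric]) simp
      qed
        finally have "dist (z (a i)) (z (b i)) / (b i - a i) \<le> e / 2"
          using elim by (simp add: pos_divide_le_eq)
        moreover have "0 \<le> dist (z (a i)) (z (b i)) / (b i - a i)" using elim by simp
        ultimately show ?case unfolding dist_real_def using e by linarith
      qed
    qed
    have "cone_speed_sq xbar T z t = 0"
      using True unfolding cone_speed_sq_def Let_def r_def by simp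
    then show ?thesis using tendsto_power[OF 1, of 2] by simp
  next
    case False
    then have rt: "r t > 0" using cone_radius_nonneg[of "z t"] unfolding r_def by linarith
    have "((\<lambda>s. inverse (r s)) has_real_derivative - (r' * inverse (r t ^ Suc (Suc 0)))) (at t)"
      using rt by (intro DERIV_inverse_fun dr) simp
    from has_vector_derivative_scaleR[OF this dw]
    obtain x' where dx0: "((\<lambda>s. inverse (r s) *\<^sub>R cone_vec xbar (z s)) has_vector_derivative x') (at t)" by blast
    have ev: "\<forall>\<^sub>F s in at t. inverse (r s) *\<^sub>R cone_vec xbar (z s) = x s"
      using order_tendstoD(1)[OF isContD[OF rc] rt]
      by eventually_elim (simp add: cone_vec_def r_def x_def)
    have dx: "(x has_vector_derivative x') (at t)"
    proof -
      have "\<exists>d>0. \<forall>s\<in>UNIV. s \<noteq> t \<and> dist s t < d \<longrightarrow> inverse (r s) *\<^sub>R cone_vec xbar (z s) = x s"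
        using ev unfolding eventually_at .
      then obtain d where d: "d > 0" "\<forall>s\<in>UNIV. s \<noteq> t \<and> dist s t < d \<longrightarrow> inverse (r s) *\<^sub>R cone_vec xbar (z s) = x s"
        by (elim exE conjE)
      have "inverse (r t) *\<^sub>R cone_vec xbar (z t) = x t"
        using rt by (simp add: cone_vec_def r_def x_def)
      with d(2) have "inverse (r s) *\<^sub>R cone_vec xbar (z s) = x s" if "dist s t < d" for s
        using that by (cases "s = t") auto
      then show ?thesis
        by (intro has_vector_derivative_transform_within[OF dx0 d(1)]) auto
    qed
    have xq: "((\<lambda>i. norm ((x (b i) - x (a i)) /\<^sub>R (b i - a i))) \<longlongrightarrow> norm x') F"
      by (intro tendsto_norm vector_derivative_straddle[OF dx ab a b])
    have xc: "isCont x t" using dx by (rule has_vector_derivative_continuous)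
    have xa: "((\<lambda>i. x (a i)) \<longlongrightarrow> x t) F" and xb: "((\<lambda>i. x (b i)) \<longlongrightarrow> x t) F"
      using isCont_tendsto_compose[OF xc a] isCont_tendsto_compose[OF xc b] .
    have \<theta>: "((\<lambda>i. dist (x (a i)) (x (b i))) \<longlongrightarrow> 0) F"
      using tendsto_dist[OF xa xb] by simp
    have cs: "cone_speed_sq xbar T z t = r'\<^sup>2 + 4 * (r t * r t) * (norm x' * 1 / 2)\<^sup>2"
    proof -
      have "vector_derivative x (at t) = x'" "vector_derivative r (at t) = r'"
        using vector_derivative_at[OF dx] vector_derivative_at[OF dr[unfolded has_real_derivative_iff_has_vector_derivative]] .
      moreover have "x differentiable at t" "r differentiable at t"
        using differentiableI_vector[OF dx] differentiableI_vector[OF dr[unfolded has_real_derivative_iff_has_vector_derivative]] .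
      ultimately show ?thesis
        unfolding cone_speed_sq_def Let_def x_def[symmetric] r_def[symmetric] at
        using rt by (simp only: if_True simp_thms) (simp add: power2_eq_square)
    qed
    \<comment> \<open>Writing \<open>sin u = u * sinc u\<close> with \<open>sinc\<close> continuous
      at 0 also covers intervals whose endpoints have the same base point.\<close>
    define sn where "sn = sinc"
    have sn: "isCont sn 0" "sn 0 = 1" "sin u = u * sn u" for u
      using isCont_sinc[of 0] by (auto simp: sn_def)
    have sc: "((\<lambda>i. sn (dist (x (a i)) (x (b i)) / 2)) \<longlongrightarrow> 1) F"
    proof -
      have "((\<lambda>i. dist (x (a i)) (x (b i)) / 2) \<longlongrightarrow> 0) F"
        using tendsto_divide[OF \<theta> tendsto_const[of 2]] by simp
      from isCont_tendsto_compose[OF sn(1) this] show ?thesis by (simp only: sn(2))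
    qed
    have "((\<lambda>i. ((r (b i) - r (a i)) / (b i - a i))\<^sup>2 + 4 * (r (a i) * r (b i)) *
        (norm ((x (b i) - x (a i)) /\<^sub>R (b i - a i)) * sn (dist (x (a i)) (x (b i)) / 2) / 2)\<^sup>2)
        \<longlongrightarrow> cone_speed_sq xbar T z t) F"
      unfolding cs
      by (intro tendsto_add tendsto_power tendsto_mult[OF tendsto_mult[OF tendsto_const tendsto_mult[OF ra rb]]]
          tendsto_divide[OF tendsto_mult[OF xq sc] tendsto_const] rq) simp
    then show ?thesis
    proof (rule Lim_transform_eventually)
      \<comment> \<open>Eventually the base distance is below \<open>pi\<close>, and the truncation
        in the cone distance is inactive.\<close>
      have "\<forall>\<^sub>F i in F. dist (x (a i)) (x (b i)) < pi"
        using order_tendstoD(2)[OF \<theta> pi_gt_zero] .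
      with ab show "\<forall>\<^sub>F i in F. ((r (b i) - r (a i)) / (b i - a i))\<^sup>2 + 4 * (r (a i) * r (b i)) *
        (norm ((x (b i) - x (a i)) /\<^sub>R (b i - a i)) * sn (dist (x (a i)) (x (b i)) / 2) / 2)\<^sup>2
        = (dist (z (a i)) (z (b i)) / (b i - a i))\<^sup>2"
      proof eventually_elim
        case (elim i)
        define h where "h = b i - a i"
        define D where "D = dist (x (a i)) (x (b i))"
        have h: "h > 0" using elim by (simp add: h_def)
        define S where "S = sn (D / 2)"
        have S: "sin (D / 2) = D / 2 * S" unfolding S_def by (rule sn(3))
        have D: "min D pi = D" using elim by (simp add: D_def)
        have "(dist (z (a i)) (z (b i)))\<^sup>2 = (r (b i) - r (a i))\<^sup>2 + 4 * (r (a i) * r (b i)) * (D / 2 * S)\<^sup>2"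
          unfolding dist_cone_sq[of _ _ xbar] r_def[symmetric] x_def[symmetric] D_def[symmetric] D S
          by (subst power2_commute) simp
        then have "(dist (z (a i)) (z (b i)))\<^sup>2 / h\<^sup>2 = ((r (b i) - r (a i))\<^sup>2 + 4 * (r (a i) * r (b i)) * (D / 2 * S)\<^sup>2) / h\<^sup>2"
          by (rule arg_cong)
        also have "\<dots> = ((r (b i) - r (a i)) / h)\<^sup>2 + 4 * (r (a i) * r (b i)) * (D / h * S / 2)\<^sup>2"
          using h by (simp add: power2_eq_square add_divide_distrib)
        also have "D / h = norm ((x (b i) - x (a i)) /\<^sub>R h)"
          using h by (simp add: D_def dist_norm norm_minus_commute divide_inverse_commute)
        finally show ?case by (simp add: h_def D_def S_def power_divide)
      qed
    qed
  qed
qed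

section \<open>Absolutely continuous observables of a path\<close>

lemma dyadic_points:
  assumes "(T::real) > 0" "i < 2^n"
  shows "0 \<le> T * real i / 2^n" "T * real i / 2^n \<le> T * real (Suc i) / 2^n"
    "T * real (Suc i) / 2^n \<le> T" "T * real (Suc i) / 2^n - T * real i / 2^n = T / 2^n"
proof -
  have "real (Suc i) \<le> 2^n" using assms(2) by (metis Suc_leI of_nat_le_iff of_nat_numeral of_nat_power)
  then have "T * real (Suc i) \<le> T * 2^n" using assms(1) by (intro mult_left_mono) auto
  then show "T * real (Suc i) / 2^n \<le> T" by (simp add: pos_divide_le_eq)
  show "0 \<le> T * real i / 2^n" "T * real i / 2^n \<le> T * real (Suc i) / 2^n"
    using assms(1) by (auto simp: divide_right_mono)
  show "T * real (Suc i) / 2^n - T * real i / 2^n = T / 2^n"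
    unfolding diff_divide_distrib[symmetric] by (simp add: algebra_simps)
qed

lemma sum_dyadic_set_integral:
  fixes m :: "real \<Rightarrow> real"
  assumes T: "T > 0" and m: "set_integrable lebesgue {0..T} m"
  shows "(\<Sum>i<2^n. LINT u:{T * real i / 2^n..T * real (Suc i) / 2^n}|lebesgue. m u) = (LINT u:{0..T}|lebesgue. m u)"
proof -
  have "(\<Sum>i<j. LINT u:{T * real i / 2^n..T * real (Suc i) / 2^n}|lebesgue. m u) = (LINT u:{0..T * real j / 2^n}|lebesgue. m u)"
    if "j \<le> 2^n" for j
    using that
  proof (induction j)
    case 0
    have "set_integrable lebesgue {0} m" by (rule set_integrable_subset[OF m]) (use T in auto)
    then have "(LINT u:{0}|lebesgue. m u) = integral {0} m" by (rule set_lebesgue_integral_eq_integral)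
    then show ?case by simp
  next
    case (Suc j)
    then have j: "j < 2^n" by simp
    show ?case
      using Suc set_integral_Icc_combine[OF m dyadic_points(1-3)[OF T j]] by simp
  qed
  from this[of "2^n"] show ?thesis by simp
qed

lemma abs_set_integral_le:
  fixes k :: "real \<Rightarrow> real"
  assumes "set_integrable lebesgue A k"
  shows "\<bar>LINT u:A|lebesgue. k u\<bar> \<le> (LINT u:A|lebesgue. \<bar>k u\<bar>)"
  using set_integral_norm_bound[OF assms] by simp

text \<open>The weight \<open>w\<close> is positive and its integrals dominate the increments. From
  \<open>0 \<le> x \<le> y\<close> follows \<open>x^2 / y \<le> y\<close>, so the weighted sums of
  squares are bounded by the total integral of \<open>w\<close>.\<close>

lemma absolutely_continuous_rep:
  fixes \<rho> m :: "real \<Rightarrow> real"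
  assumes T: "T > 0" and m: "set_integrable lebesgue {0..T} m" and C: "0 \<le> C"
    and le: "\<And>s t. 0 \<le> s \<Longrightarrow> s \<le> t \<Longrightarrow> t \<le> T \<Longrightarrow> \<bar>\<rho> t - \<rho> s\<bar> \<le> C * (LINT u:{s..t}|lebesgue. m u)"
  shows "\<exists>k. has_integral_rep T \<rho> k"
proof -
  define w where "w u = 1 + C * \<bar>m u\<bar>" for u
  have one: "set_integrable lebesgue {s..t} (\<lambda>u. 1::real)" for s t :: real
    by (rule absolutely_integrable_on_const) simp
  have w: "set_integrable lebesgue {0..T} w"
    unfolding w_def using m by (intro set_integral_add one set_integrable_mult_right set_integrable_abs) auto
  have le': "\<bar>\<rho> t - \<rho> s\<bar> \<le> (LINT u:{s..t}|lebesgue. w u)" if st: "0 \<le> s" "s \<le> t" "t \<le> T" for s t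
  proof -
    have ms: "set_integrable lebesgue {s..t} m" and ws: "set_integrable lebesgue {s..t} w"
      using set_integrable_subinterval[OF m st] set_integrable_subinterval[OF w st] .
    have "\<bar>\<rho> t - \<rho> s\<bar> \<le> (LINT u:{s..t}|lebesgue. C * m u)" using le[OF st] by simp
    also have "\<dots> \<le> (LINT u:{s..t}|lebesgue. w u)"
    proof (rule set_integral_mono)
      fix u assume "u \<in> {s..t}"
      have "C * m u \<le> C * \<bar>m u\<bar>" using C by (intro mult_left_mono) auto
      then show "C * m u \<le> w u" by (simp add: w_def)
    qed (use ms ws in auto)
    finally show ?thesis .
  qed
  define F where "F t = (LINT u:{0..t}|lebesgue. w u)" for t
  have F: "continuous_on {0..T} F" unfolding F_def by (rule indefinite_set_integral_continuous[OF w])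
  have leF: "\<bar>\<rho> t - \<rho> s\<bar> \<le> F t - F s" if "0 \<le> s" "s \<le> t" "t \<le> T" for s t
    using le'[OF that] set_integral_Icc_combine[OF w that] by (simp add: F_def)
  have leF': "dist (\<rho> t) (\<rho> s) \<le> dist (F t) (F s)" if "t \<in> {0..T}" "s \<in> {0..T}" for s t
    using leF[of s t] leF[of t s] that by (cases "s \<le> t") (auto simp: dist_real_def abs_minus_commute)
  have cont: "continuous_on {0..T} \<rho>"
    unfolding continuous_on_iff
  proof (intro ballI allI impI)
    fix t e :: real assume t: "t \<in> {0..T}" and e: "0 < e"
    then obtain d where d: "d > 0" "\<forall>s\<in>{0..T}. dist s t < d \<longrightarrow> dist (F s) (F t) < e"
      using F unfolding continuous_on_iff by blast
    have "dist (\<rho> s) (\<rho> t) < e" if "s \<in> {0..T}" "dist s t < d" for s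
      using leF'[OF that(1) t] d(2) that by (meson le_less_trans)
    with d(1) show "\<exists>d>0. \<forall>s\<in>{0..T}. dist s t < d \<longrightarrow> dist (\<rho> s) (\<rho> t) < e" by blast
  qed
  have "(\<Sum>i<2^n. (\<rho> (T * real (Suc i) / 2^n) - \<rho> (T * real i / 2^n))\<^sup>2 /
       (LINT u:{T * real i / 2^n..T * real (Suc i) / 2^n}|lebesgue. w u)) \<le> (LINT u:{0..T}|lebesgue. w u)" for n
    unfolding sum_dyadic_set_integral[OF T w, of n, symmetric]
  proof (rule sum_mono)
    fix i assume "i \<in> {..<2^n::nat}"
    then have i: "i < 2^n" by simp
    define x where "x = \<bar>\<rho> (T * real (Suc i) / 2^n) - \<rho> (T * real i / 2^n)\<bar>"
    define y where "y = (LINT u:{T * real i / 2^n..T * real (Suc i) / 2^n}|lebesgue. w u)"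
    have xy: "0 \<le> x" "x \<le> y" using le'[OF dyadic_points(1-3)[OF T i]] by (auto simp: x_def y_def)
    have "x\<^sup>2 / y \<le> y"
    proof (cases "y = 0")
      case False
      with xy have "y > 0" by simp
      moreover have "x\<^sup>2 \<le> y * y" using xy by (simp add: power2_eq_square mult_mono)
      ultimately show ?thesis by (simp add: pos_divide_le_eq)
    qed simp
    then show "(\<rho> (T * real (Suc i) / 2^n) - \<rho> (T * real i / 2^n))\<^sup>2 /
       (LINT u:{T * real i / 2^n..T * real (Suc i) / 2^n}|lebesgue. w u)
       \<le> (LINT u:{T * real i / 2^n..T * real (Suc i) / 2^n}|lebesgue. w u)"
      by (simp add: x_def y_def)
  qed
  moreover have "w u > 0" for u using C by (simp add: w_def add_pos_nonneg)
  ultimately show ?thesis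
    by (intro integral_representation[OF T cont w])
qed

lemma finite_energy_rep:
  fixes \<rho> :: "real \<Rightarrow> real"
  assumes T: "T > 0" and cont: "continuous_on {0..T} \<rho>"
    and bd: "\<And>n. (\<Sum>i<2^n. (\<rho> (T * real (Suc i) / 2^n) - \<rho> (T * real i / 2^n))\<^sup>2 * 2^n / T) \<le> K"
  shows "\<exists>k. has_integral_rep T \<rho> k"
proof -
  have one: "set_integrable lebesgue {0..T} (\<lambda>u. 1::real)"
    by (rule absolutely_integrable_on_const) simp
  have v: "(LINT u:{T * real i / 2^n..T * real (Suc i) / 2^n}|lebesgue. 1) = T / 2^n" if "i < 2^n" for n i
    using dyadic_points[OF T that] by (simp add: set_lebesgue_integral_def)
  have "(\<Sum>i<2^n. (\<rho> (T * real (Suc i) / 2^n) - \<rho> (T * real i / 2^n))\<^sup>2 /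
       (LINT u:{T * real i / 2^n..T * real (Suc i) / 2^n}|lebesgue. 1)) \<le> K" for n
    using bd[of n] v by (simp del: of_nat_Suc)
  then show ?thesis by (rule integral_representation[OF T cont one zero_less_one])
qed

text \<open>Differentiability in the coordinates \<open>(r, r x)\<close>, which remains meaningful
  at the apex.\<close>

definition cone_differentiable :: "'a::euclidean_space \<Rightarrow> (real \<Rightarrow> 'a cone) \<Rightarrow> real \<Rightarrow> bool" where
  "cone_differentiable xbar z t \<longleftrightarrow>
    (\<exists>r'. ((\<lambda>s. cone_radius (z s)) has_real_derivative r') (at t)) \<and>
    (\<exists>w'. ((\<lambda>s. cone_vec xbar (z s)) has_vector_derivative w') (at t))"

lemma cone_speed_sq_nonneg [simp]: "0 \<le> cone_speed_sq xbar T z t"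
  by (simp add: cone_speed_sq_def Let_def)

text \<open>The intervals between \<open>s\<close> and \<open>t\<close> have \<open>t\<close> as an
  endpoint and hence are straddling intervals.\<close>

lemma metric_speed_limit:
  fixes z :: "real \<Rightarrow> 'a::euclidean_space cone"
  assumes t: "t \<in> {0<..<T}" and d: "cone_differentiable xbar z t"
  shows "((\<lambda>s. dist (z s) (z t) / \<bar>s - t\<bar>) \<longlongrightarrow> sqrt (cone_speed_sq xbar T z t)) (at t)"
proof -
  have "((\<lambda>s. (dist (z (min s t)) (z (max s t)) / (max s t - min s t))\<^sup>2) \<longlongrightarrow> cone_speed_sq xbar T z t) (at t)"
  proof -
    have m1: "((\<lambda>s. min s t) \<longlongrightarrow> t) (at t)" and m2: "((\<lambda>s. max s t) \<longlongrightarrow> t) (at t)"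
      by (rule tendsto_eq_intros refl | simp)+
    have "\<forall>\<^sub>F s in at t. min s t \<le> t \<and> t \<le> max s t \<and> min s t < max s t"
      by (auto simp: eventually_at_filter min_def max_def intro!: always_eventually)
    with d show ?thesis
      unfolding cone_differentiable_def by (elim conjE exE) (rule cone_speed_sq_limit[OF t _ _ _ m1 m2])
  qed
  then have "((\<lambda>s. sqrt ((dist (z (min s t)) (z (max s t)) / (max s t - min s t))\<^sup>2)) \<longlongrightarrow> sqrt (cone_speed_sq xbar T z t)) (at t)"
    by (rule tendsto_real_sqrt)
  moreover have "sqrt ((dist (z (min s t)) (z (max s t)) / (max s t - min s t))\<^sup>2) = dist (z s) (z t) / \<bar>s - t\<bar>" for s
    by (cases "s \<le> t") (auto simp: dist_commute min_def max_def abs_minus_commute)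
  ultimately show ?thesis by simp
qed

lemma metric_derivative_sq:
  fixes z :: "real \<Rightarrow> 'a::euclidean_space cone"
  assumes t: "t \<in> {0<..<T}" and d: "cone_differentiable xbar z t"
  shows "(metric_derivative T z t)\<^sup>2 = cone_speed_sq xbar T z t"
proof -
  have "at t within {0..T} = at t" using t by (intro at_within_interior) auto
  then have "metric_derivative T z t = sqrt (cone_speed_sq xbar T z t)"
    unfolding metric_derivative_def using metric_speed_limit[OF assms] by (simp add: tendsto_Lim)
  then show ?thesis by simp
qed

lemma cone_radius_lipschitz_on: "1-lipschitz_on S (cone_radius :: 'a::metric_space cone \<Rightarrow> real)"
  by (rule lipschitz_onI) (auto simp: dist_real_def cone_radius_lipschitz)

lemma cone_vec_lipschitz_on:
  fixes M :: "'a::euclidean_space set"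
  assumes L: "\<And>x. x \<in> M \<Longrightarrow> norm x \<le> L" and xbar: "xbar \<in> M" and b: "b \<in> Basis"
  shows "(4 + 5 * L)-lipschitz_on (cone_over M) (\<lambda>p. cone_vec xbar p \<bullet> b)"
proof (rule lipschitz_onI)
  show "0 \<le> 4 + 5 * L" using L[OF xbar] norm_ge_zero[of xbar] by linarith
  fix p q assume pq: "p \<in> cone_over M" "q \<in> cone_over M"
  have "\<bar>(cone_vec xbar p - cone_vec xbar q) \<bullet> b\<bar> \<le> norm (cone_vec xbar p - cone_vec xbar q)"
    by (rule Basis_le_norm[OF b])
  also have "\<dots> \<le> (4 + 5 * L) * dist p q"
    by (intro cone_vec_lipschitz L cone_base_in[OF _ xbar] pq)
  finally show "dist (cone_vec xbar p \<bullet> b) (cone_vec xbar q \<bullet> b) \<le> (4 + 5 * L) * dist p q"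
    by (simp add: inner_diff_left dist_real_def)
qed

text \<open>The radius and the coordinates of \<open>cone_vec\<close> are finitely many Lipschitz
  observables, so the union of their exceptional sets is still null.\<close>

lemma cone_differentiable_AE:
  fixes z :: "real \<Rightarrow> 'a::euclidean_space cone"
  assumes T: "T > 0" and L: "\<And>x. x \<in> M \<Longrightarrow> norm x \<le> L" and xbar: "xbar \<in> M"
    and H: "\<And>g C. C-lipschitz_on (cone_over M) g \<Longrightarrow> \<exists>k. has_integral_rep T (\<lambda>t. g (z t)) k"
  shows "AE t in lebesgue. t \<in> {0<..<T} \<longrightarrow> cone_differentiable xbar z t"
proof -
  obtain kr where "has_integral_rep T (\<lambda>t. cone_radius (z t)) kr"
    using H[OF cone_radius_lipschitz_on] by blast
  from Lebesgue_differentiation_AE[OF T this]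
  have 1: "AE t in lebesgue. t \<in> {0<..<T} \<longrightarrow> (\<exists>r'. ((\<lambda>s. cone_radius (z s)) has_real_derivative r') (at t))"
    by eventually_elim blast
  have "AE t in lebesgue. t \<in> {0<..<T} \<longrightarrow> (\<exists>w'. ((\<lambda>s. cone_vec xbar (z s) \<bullet> b) has_real_derivative w') (at t))"
    if b: "b \<in> Basis" for b
  proof -
    obtain k where "has_integral_rep T (\<lambda>t. cone_vec xbar (z t) \<bullet> b) k"
      using H[OF cone_vec_lipschitz_on[OF L xbar b]] by blast
    from Lebesgue_differentiation_AE[OF T this] show ?thesis by eventually_elim blast
  qed
  then have "AE t in lebesgue. \<forall>b\<in>Basis. t \<in> {0<..<T} \<longrightarrow> (\<exists>w'. ((\<lambda>s. cone_vec xbar (z s) \<bullet> b) has_real_derivative w') (at t))"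
    by (intro AE_finite_allI) auto
  with 1 show ?thesis
  proof eventually_elim
    case (elim t)
    show ?case
    proof
      assume t: "t \<in> {0<..<T}"
      with elim obtain w where w: "\<And>b. b \<in> Basis \<Longrightarrow> ((\<lambda>s. cone_vec xbar (z s) \<bullet> b) has_real_derivative w b) (at t)"
        by metis
      have "((\<lambda>s. \<Sum>b\<in>Basis. (cone_vec xbar (z s) \<bullet> b) *\<^sub>R b) has_vector_derivative (\<Sum>b\<in>Basis. w b *\<^sub>R b)) (at t)"
      proof (rule has_vector_derivative_sum)
        fix b :: 'a assume "b \<in> Basis"
        from has_vector_derivative_scaleR[OF w[OF this] has_vector_derivative_const[of b]]
        show "((\<lambda>s. (cone_vec xbar (z s) \<bullet> b) *\<^sub>R b) has_vector_derivative w b *\<^sub>R b) (at t)" by simp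
      qed
      then have "((\<lambda>s. cone_vec xbar (z s)) has_vector_derivative (\<Sum>b\<in>Basis. w b *\<^sub>R b)) (at t)"
        by (simp add: euclidean_representation)
      with elim(1) t show "cone_differentiable xbar z t" unfolding cone_differentiable_def by blast
    qed
  qed
qed

section \<open>The action as a supremum of dyadic energies\<close>

definition dyadic_energy :: "real \<Rightarrow> nat \<Rightarrow> (real \<Rightarrow> 'b::metric_space) \<Rightarrow> real" where
  "dyadic_energy T n z = (\<Sum>i<2^n. (dist (z (T * real i / 2^n)) (z (T * real (Suc i) / 2^n)))\<^sup>2 * 2^n / T)"

lemma dyadic_energy_nonneg: "T > 0 \<Longrightarrow> 0 \<le> dyadic_energy T n z"
  unfolding dyadic_energy_def by (intro sum_nonneg) auto

text \<open>Composition with a Lipschitz function is the passage from paths in a metric space to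
  real functions, for which integral representations are known.\<close>

lemma absolutely_continuous_path_rep:
  fixes z :: "real \<Rightarrow> 'b::metric_space" and g :: "'b \<Rightarrow> real"
  assumes T: "T > 0" and ac: "absolutely_continuous_path T z" and z: "\<forall>t\<in>{0..T}. z t \<in> S"
    and lip: "C-lipschitz_on S g"
  shows "\<exists>k. has_integral_rep T (\<lambda>t. g (z t)) k"
proof -
  have C: "0 \<le> C" using lip by (rule lipschitz_on_nonneg)
  have g: "\<bar>g p - g q\<bar> \<le> C * dist p q" if "p \<in> S" "q \<in> S" for p q
    using lipschitz_onD[OF lip that] by (simp add: dist_real_def)
  obtain m where m: "set_integrable lebesgue {0..T} m"
    and mz: "\<And>s t. 0 \<le> s \<Longrightarrow> s \<le> t \<Longrightarrow> t \<le> T \<Longrightarrow> dist (z s) (z t) \<le> (LINT u:{s..t}|lebesgue. m u)"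
    using ac unfolding absolutely_continuous_path_def by blast
  have "\<bar>g (z t) - g (z s)\<bar> \<le> C * (LINT u:{s..t}|lebesgue. m u)" if "0 \<le> s" "s \<le> t" "t \<le> T" for s t
  proof -
    have "z s \<in> S" "z t \<in> S" using z that by auto
    from g[OF this(2,1)] have "\<bar>g (z t) - g (z s)\<bar> \<le> C * dist (z s) (z t)"
      by (simp only: dist_commute)
    also have "\<dots> \<le> C * (LINT u:{s..t}|lebesgue. m u)" using mz[OF that] C by (rule mult_left_mono)
    finally show ?thesis .
  qed
  then show ?thesis by (rule absolutely_continuous_rep[OF T m C])
qed

lemma dyadic_energy_rep:
  fixes z :: "real \<Rightarrow> 'b::metric_space" and g :: "'b \<Rightarrow> real"
  assumes T: "T > 0" and cont: "continuous_on {0..T} z" and bd: "\<And>n. dyadic_energy T n z \<le> K"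
    and z: "\<forall>t\<in>{0..T}. z t \<in> S"
    and lip: "C-lipschitz_on S g"
  shows "\<exists>k. has_integral_rep T (\<lambda>t. g (z t)) k"
proof (rule finite_energy_rep[OF T])
  have g: "\<bar>g p - g q\<bar> \<le> C * dist p q" if "p \<in> S" "q \<in> S" for p q
    using lipschitz_onD[OF lip that] by (simp add: dist_real_def)
  have "continuous_on S g" using lip by (rule lipschitz_on_continuous_on)
  then show "continuous_on {0..T} (\<lambda>t. g (z t))"
    by (rule continuous_on_compose2[OF _ cont]) (use z in blast)
  fix n
  have "(\<Sum>i<2^n. (g (z (T * real (Suc i) / 2^n)) - g (z (T * real i / 2^n)))\<^sup>2 * 2^n / T) \<le> C\<^sup>2 * dyadic_energy T n z"
    unfolding dyadic_energy_def sum_distrib_left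
  proof (rule sum_mono)
    fix i assume "i \<in> {..<2^n::nat}"
    then have i: "i < 2^n" by simp
    let ?a = "T * real i / 2^n" and ?b = "T * real (Suc i) / 2^n"
    have "?a \<in> {0..T}" "?b \<in> {0..T}"
      unfolding atLeastAtMost_iff using dyadic_points(1-3)[OF T i] by (meson order_trans)+
    then have "z ?a \<in> S" "z ?b \<in> S" using z by blast+
    from g[OF this(2,1)] have "\<bar>g (z ?b) - g (z ?a)\<bar> \<le> C * dist (z ?a) (z ?b)"
      by (simp only: dist_commute)
    from power_mono[OF this abs_ge_zero, of 2] have "(g (z ?b) - g (z ?a))\<^sup>2 \<le> (C * dist (z ?a) (z ?b))\<^sup>2"
      by (simp only: power2_abs)
    then have "(g (z ?b) - g (z ?a))\<^sup>2 * (2^n / T) \<le> (C * dist (z ?a) (z ?b))\<^sup>2 * (2^n / T)"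
      using T by (intro mult_right_mono) auto
    then show "(g (z ?b) - g (z ?a))\<^sup>2 * 2^n / T \<le> C\<^sup>2 * ((dist (z ?a) (z ?b))\<^sup>2 * 2^n / T)"
      unfolding power_mult_distrib times_divide_eq_right mult.assoc .
  qed
  also have "\<dots> \<le> C\<^sup>2 * K" by (intro mult_left_mono bd) auto
  finally show "(\<Sum>i<2^n. (g (z (T * real (Suc i) / 2^n)) - g (z (T * real i / 2^n)))\<^sup>2 * 2^n / T) \<le> C\<^sup>2 * K" .
qed

lemma AE_lebesgue_interior:
  "AE t in lebesgue. t \<in> {0..T::real} \<longrightarrow> t \<in> {0<..<T}"
proof -
  have "AE t in lebesgue. t \<noteq> c" for c :: real
    by (rule AE_completion) (simp add: AE_lborel_singleton)
  from this[of 0] this[of T] show ?thesis by eventually_elim auto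
qed

lemma AC2_differentiable_AE:
  fixes z :: "real \<Rightarrow> 'a::euclidean_space cone"
  assumes T: "T > 0" and M: "bounded M" and xbar: "xbar \<in> M"
    and ac: "absolutely_continuous_path T z" and z: "\<forall>t\<in>{0..T}. z t \<in> cone_over M"
  shows "AE t in lebesgue. t \<in> {0..T} \<longrightarrow> t \<in> {0<..<T} \<and> cone_differentiable xbar z t"
proof -
  obtain L where L: "\<And>x. x \<in> M \<Longrightarrow> norm x \<le> L" using M by (auto simp: bounded_iff)
  have "AE t in lebesgue. t \<in> {0<..<T} \<longrightarrow> cone_differentiable xbar z t"
    by (rule cone_differentiable_AE[OF T L xbar absolutely_continuous_path_rep[OF T ac z]])
  with AE_lebesgue_interior[of T] show ?thesis by eventually_elim blast
qed

lemma path_action_AC2: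
  fixes z :: "real \<Rightarrow> 'a::euclidean_space cone"
  assumes T: "T > 0" and M: "bounded M" and xbar: "xbar \<in> M"
    and ac: "AC2 T z" and z: "\<forall>t\<in>{0..T}. z t \<in> cone_over M"
  shows "path_action xbar T z = ennreal (LINT t:{0..T}|lebesgue. (metric_derivative T z t)\<^sup>2)"
proof -
  have ac': "absolutely_continuous_path T z" and md: "set_integrable lebesgue {0..T} (\<lambda>t. (metric_derivative T z t)\<^sup>2)"
    using ac by (auto simp: AC2_def)
  have "path_action xbar T z = (\<integral>\<^sup>+t\<in>{0..T}. ennreal (cone_speed_sq xbar T z t) \<partial>lebesgue)"
    using ac by (simp add: path_action_def)
  also have "\<dots> = (\<integral>\<^sup>+t. ennreal (indicator {0..T} t *\<^sub>R (metric_derivative T z t)\<^sup>2) \<partial>lebesgue)"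
  proof (rule nn_integral_cong_AE)
    show "AE t in lebesgue. ennreal (cone_speed_sq xbar T z t) * indicator {0..T} t
        = ennreal (indicator {0..T} t *\<^sub>R (metric_derivative T z t)\<^sup>2)"
      using AC2_differentiable_AE[OF T M xbar ac' z]
      by eventually_elim (auto simp: indicator_def metric_derivative_sq)
  qed
  also have "\<dots> = ennreal (LINT t:{0..T}|lebesgue. (metric_derivative T z t)\<^sup>2)"
    unfolding set_lebesgue_integral_def
    by (rule nn_integral_eq_integral) (use md in \<open>auto simp: set_integrable_def\<close>)
  finally show ?thesis .
qed

text \<open>The real function \<open>\<rho> u = dist (z u) (z s)\<close> has a derivative bounded
  almost everywhere by the metric speed. Integrating it from \<open>s\<close> to \<open>t\<close>
  gives the distance as at most the integral of the speed, and Cauchy-Schwarz gives the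
  square.\<close>

lemma dist_sq_le_AC2:
  fixes z :: "real \<Rightarrow> 'a::euclidean_space cone"
  assumes T: "T > 0" and M: "bounded M" and xbar: "xbar \<in> M"
    and ac: "AC2 T z" and z: "\<forall>t\<in>{0..T}. z t \<in> cone_over M"
    and st: "0 \<le> s" "s \<le> t" "t \<le> T"
  shows "(dist (z s) (z t))\<^sup>2 \<le> (t - s) * (LINT u:{s..t}|lebesgue. (metric_derivative T z u)\<^sup>2)"
proof -
  have ac': "absolutely_continuous_path T z" and md: "set_integrable lebesgue {0..T} (\<lambda>t. (metric_derivative T z t)\<^sup>2)"
    using ac by (auto simp: AC2_def)
  have mdst: "set_integrable lebesgue {s..t} (\<lambda>t. (metric_derivative T z t)\<^sup>2)"
    by (rule set_integrable_subinterval[OF md st])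
  define I where "I = (LINT u:{s..t}|lebesgue. (metric_derivative T z u)\<^sup>2)"
  define \<delta> where "\<delta> = dist (z s) (z t)"
  define \<rho> where "\<rho> u = dist (z u) (z s)" for u
  have "1-lipschitz_on (cone_over M) (\<lambda>p. dist p (z s))"
    by (intro lipschitz_onI) (use abs_dist_diff_le[of _ "z s"] in \<open>simp_all add: dist_real_def dist_commute[of "z s"]\<close>)
  from absolutely_continuous_path_rep[OF T ac' z this]
  obtain k where k: "has_integral_rep T \<rho> k" unfolding \<rho>_def by blast
  have kb: "AE u in lebesgue. u \<in> {0..T} \<longrightarrow> (k u)\<^sup>2 \<le> (metric_derivative T z u)\<^sup>2"
    using Lebesgue_differentiation_AE[OF T k] AC2_differentiable_AE[OF T M xbar ac' z]
  proof eventually_elim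
    case (elim u)
    show ?case
    proof
      assume "u \<in> {0..T}"
      with elim have u: "u \<in> {0<..<T}" and d: "cone_differentiable xbar z u" and D: "(\<rho> has_real_derivative k u) (at u)"
        by auto
      have "((\<lambda>v. \<bar>(\<rho> v - \<rho> u) / (v - u)\<bar>) \<longlongrightarrow> \<bar>k u\<bar>) (at u)"
        using D by (intro tendsto_rabs) (simp add: has_field_derivative_iff)
      moreover have "\<bar>(\<rho> v - \<rho> u) / (v - u)\<bar> \<le> dist (z v) (z u) / \<bar>v - u\<bar>" for v
      proof -
        have "\<bar>\<rho> v - \<rho> u\<bar> \<le> dist (z v) (z u)"
          unfolding \<rho>_def using abs_dist_diff_le[of "z v" "z s" "z u"] by (simp only: dist_commute[of "z s"])
        then show ?thesis by (simp add: abs_divide divide_right_mono)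
      qed
      ultimately have "\<bar>k u\<bar> \<le> sqrt (cone_speed_sq xbar T z u)"
        by (intro tendsto_le[OF _ metric_speed_limit[OF u d]]) auto
      then have "\<bar>k u\<bar>\<^sup>2 \<le> (sqrt (cone_speed_sq xbar T z u))\<^sup>2" by (intro power_mono) auto
      then show "(k u)\<^sup>2 \<le> (metric_derivative T z u)\<^sup>2"
        by (simp add: metric_derivative_sq[OF u d])
    qed
  qed
  have k1: "set_integrable lebesgue {s..t} k" and k2: "\<rho> t - \<rho> s = (LINT u:{s..t}|lebesgue. k u)"
    using k st set_integrable_subinterval[OF _ st, of k] by (auto simp: has_integral_rep_def)
  have I0: "0 \<le> I" unfolding I_def set_lebesgue_integral_def by (intro integral_nonneg_AE) auto
  \<comment> \<open>Cauchy-Schwarz in the form of \<open>2 * c * k \<le> c^2 + k^2\<close> with a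
    free parameter, which requires only integrability of the squared speed.\<close>
  have main: "\<delta> * c \<le> (c\<^sup>2 * (t - s) + I) / 2" if c: "c > 0" for c
  proof -
    have "\<delta> * c = c * (LINT u:{s..t}|lebesgue. k u)"
      using k2 by (simp add: \<rho>_def \<delta>_def dist_commute)
    also have "\<dots> = (LINT u:{s..t}|lebesgue. c * k u)" by simp
    also have "\<dots> \<le> (LINT u:{s..t}|lebesgue. (c\<^sup>2 + (metric_derivative T z u)\<^sup>2) / 2)"
    proof (rule set_integral_mono_AE)
      show "set_integrable lebesgue {s..t} (\<lambda>u. c * k u)" using k1 by simp
      show "set_integrable lebesgue {s..t} (\<lambda>u. (c\<^sup>2 + (metric_derivative T z u)\<^sup>2) / 2)"
        by (intro set_integrable_divide set_integral_add mdst absolutely_integrable_on_const) simp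
      show "AE u\<in>{s..t} in lebesgue. c * k u \<le> (c\<^sup>2 + (metric_derivative T z u)\<^sup>2) / 2"
        using kb
      proof eventually_elim
        case (elim u)
        show ?case
        proof
          assume "u \<in> {s..t}"
          with elim st have "(k u)\<^sup>2 \<le> (metric_derivative T z u)\<^sup>2" by auto
          moreover have "2 * (c * k u) \<le> c\<^sup>2 + (k u)\<^sup>2" using sum_squares_bound[of c "k u"] by simp
          ultimately show "c * k u \<le> (c\<^sup>2 + (metric_derivative T z u)\<^sup>2) / 2" by simp
        qed
      qed
    qed
    also have "\<dots> = (c\<^sup>2 * (t - s) + I) / 2"
    proof -
      have "(LINT u:{s..t}|lebesgue. c\<^sup>2) = c\<^sup>2 * (t - s)"
        using st by (simp add: set_lebesgue_integral_def)
      moreover have "(LINT u:{s..t}|lebesgue. c\<^sup>2 + (metric_derivative T z u)\<^sup>2) = (LINT u:{s..t}|lebesgue. c\<^sup>2) + I"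
        unfolding I_def by (intro set_integral_add mdst absolutely_integrable_on_const) simp
      ultimately show ?thesis by simp
    qed
    finally show ?thesis .
  qed
  have "\<delta>\<^sup>2 \<le> (t - s) * I"
  proof (cases "\<delta> = 0 \<or> s = t")
    case True
    moreover have "\<delta> = 0" if "s = t" using that by (simp add: \<delta>_def)
    ultimately show ?thesis using I0 st by auto
  next
    case False
    then have pos: "t - s > 0" "\<delta> > 0" using st by (auto simp: \<delta>_def)
    \<comment> \<open>The optimal parameter, the average speed needed to cover the distance.\<close>
    define c where "c = \<delta> / (t - s)"
    have c: "c > 0" "\<delta> = c * (t - s)" using pos by (auto simp: c_def)
    have "2 * (\<delta> * c) \<le> c\<^sup>2 * (t - s) + I" using main[OF c(1)] by simp
    moreover have "\<delta> * c = c\<^sup>2 * (t - s)" using c(2) by (simp add: power2_eq_square)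
    ultimately have "c\<^sup>2 * (t - s) \<le> I" by linarith
    then have "(t - s) * (c\<^sup>2 * (t - s)) \<le> (t - s) * I" using pos by (intro mult_left_mono) auto
    then show ?thesis unfolding c(2) by (simp add: power2_eq_square mult_ac)
  qed
  then show ?thesis by (simp add: \<delta>_def I_def)
qed

lemma dyadic_energy_le_AC2:
  fixes z :: "real \<Rightarrow> 'a::euclidean_space cone"
  assumes T: "T > 0" and M: "bounded M" and xbar: "xbar \<in> M"
    and ac: "AC2 T z" and z: "\<forall>t\<in>{0..T}. z t \<in> cone_over M"
  shows "dyadic_energy T n z \<le> (LINT u:{0..T}|lebesgue. (metric_derivative T z u)\<^sup>2)"
proof -
  have md: "set_integrable lebesgue {0..T} (\<lambda>t. (metric_derivative T z t)\<^sup>2)"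
    using ac by (auto simp: AC2_def)
  show ?thesis
    unfolding sum_dyadic_set_integral[OF T md, of n, symmetric] dyadic_energy_def
  proof (rule sum_mono)
    fix i assume "i \<in> {..<2^n::nat}"
    then have i: "i < 2^n" by simp
    let ?a = "T * real i / 2^n" and ?b = "T * real (Suc i) / 2^n"
    let ?J = "LINT u:{?a..?b}|lebesgue. (metric_derivative T z u)\<^sup>2"
    have "(dist (z ?a) (z ?b))\<^sup>2 \<le> (?b - ?a) * ?J"
      by (rule dist_sq_le_AC2[OF T M xbar ac z dyadic_points(1-3)[OF T i]])
    then have "(dist (z ?a) (z ?b))\<^sup>2 * (2^n / T) \<le> (T / 2^n * ?J) * (2^n / T)"
      unfolding dyadic_points(4)[OF T i] using T by (intro mult_right_mono) auto
    then show "(dist (z ?a) (z ?b))\<^sup>2 * 2^n / T \<le> ?J"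
      using T by simp
  qed
qed

text \<open>Bounded energies give densities for the radius and the coordinates of
  \<open>cone_vec\<close>, and \<open>dist_cone_le_vec\<close> combines them into a majorant proving
  absolute continuity. The action bound is Fatou's lemma for the piecewise constant squared speeds,
  whose integrals are the dyadic energies.\<close>

lemma AC2_of_dyadic_energy:
  fixes z :: "real \<Rightarrow> 'a::euclidean_space cone"
  assumes T: "T > 0" and M: "bounded M" and xbar: "xbar \<in> M"
    and cont: "continuous_on {0..T} z" and z: "\<forall>t\<in>{0..T}. z t \<in> cone_over M"
    and bd: "\<And>n. dyadic_energy T n z \<le> K"
  shows "AC2 T z" "path_action xbar T z \<le> ennreal K"
proof -
  obtain L where L: "\<And>x. x \<in> M \<Longrightarrow> norm x \<le> L" using M by (auto simp: bounded_iff)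
  have L0: "0 \<le> L" using L[OF xbar] norm_ge_zero order_trans by blast
  note rep = dyadic_energy_rep[OF T cont bd z]
  obtain kr where kr: "has_integral_rep T (\<lambda>t. cone_radius (z t)) kr"
    using rep[OF cone_radius_lipschitz_on] by blast
  have "\<exists>k. has_integral_rep T (\<lambda>t. cone_vec xbar (z t) \<bullet> b) k" if b: "b \<in> Basis" for b
    by (rule rep[OF cone_vec_lipschitz_on[OF L xbar b]])
  then obtain kw where kw: "\<And>b. b \<in> Basis \<Longrightarrow> has_integral_rep T (\<lambda>t. cone_vec xbar (z t) \<bullet> b) (kw b)"
    by metis
  \<comment> \<open>The weights are those of \<open>dist_cone_le_vec\<close>; the norm of
    \<open>cone_vec\<close> increments is bounded by the sum over coordinates.\<close>
  define m where "m u = (3 + 6 * L) * \<bar>kr u\<bar> + 2 * (\<Sum>b\<in>Basis. \<bar>kw b u\<bar>)" for u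
  have kri: "set_integrable lebesgue {0..T} (\<lambda>u. \<bar>kr u\<bar>)"
    using kr by (auto simp: has_integral_rep_def intro: set_integrable_abs)
  have kwi: "set_integrable lebesgue {0..T} (\<lambda>u. \<bar>kw b u\<bar>)" if "b \<in> Basis" for b
    using kw[OF that] by (auto simp: has_integral_rep_def intro: set_integrable_abs)
  have mi: "set_integrable lebesgue {0..T} m"
    unfolding m_def by (intro set_integral_add set_integrable_mult_right kri absolutely_integrable_sum kwi) auto
  have ac: "absolutely_continuous_path T z"
    unfolding absolutely_continuous_path_def
  proof (intro exI[of _ m] conjI mi allI impI, elim conjE)
    fix s t assume st: "0 \<le> s" "s \<le> t" "t \<le> T"
    have zst: "norm (cone_base xbar (z s)) \<le> L" "norm (cone_base xbar (z t)) \<le> L"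
      using st by (auto intro!: L cone_base_in[OF _ xbar] z[rule_format])
    have aux: "\<bar>\<rho> s - \<rho> t\<bar> \<le> (LINT u:{s..t}|lebesgue. \<bar>k u\<bar>)" if rep: "has_integral_rep T \<rho> k" for \<rho> k
    proof -
      have ki: "set_integrable lebesgue {0..T} k" and e: "\<rho> t - \<rho> s = (LINT u:{s..t}|lebesgue. k u)"
        using rep st unfolding has_integral_rep_def by blast+
      from abs_set_integral_le[OF set_integrable_subinterval[OF ki st]] show ?thesis
        unfolding e[symmetric] by (simp only: abs_minus_commute)
    qed
    have "dist (z s) (z t) \<le> (3 + 6 * L) * \<bar>cone_radius (z s) - cone_radius (z t)\<bar>
        + 2 * norm (cone_vec xbar (z s) - cone_vec xbar (z t))"
      by (rule dist_cone_le_vec[OF zst])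
    also have "\<dots> \<le> (3 + 6 * L) * (LINT u:{s..t}|lebesgue. \<bar>kr u\<bar>) + 2 * (\<Sum>b\<in>Basis. LINT u:{s..t}|lebesgue. \<bar>kw b u\<bar>)"
    proof (intro add_mono mult_left_mono)
      show "\<bar>cone_radius (z s) - cone_radius (z t)\<bar> \<le> (LINT u:{s..t}|lebesgue. \<bar>kr u\<bar>)"
        by (rule aux[OF kr])
      have "norm (cone_vec xbar (z s) - cone_vec xbar (z t)) \<le> (\<Sum>b\<in>Basis. \<bar>(cone_vec xbar (z s) - cone_vec xbar (z t)) \<bullet> b\<bar>)"
        by (rule norm_le_l1)
      also have "\<dots> \<le> (\<Sum>b\<in>Basis. LINT u:{s..t}|lebesgue. \<bar>kw b u\<bar>)"
        using aux[OF kw] by (intro sum_mono) (simp add: inner_diff_left)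
      finally show "norm (cone_vec xbar (z s) - cone_vec xbar (z t)) \<le> (\<Sum>b\<in>Basis. LINT u:{s..t}|lebesgue. \<bar>kw b u\<bar>)" .
    qed (use L0 in auto)
    also have "\<dots> = (LINT u:{s..t}|lebesgue. m u)"
    proof -
      have 1: "set_integrable lebesgue {s..t} (\<lambda>u. \<bar>kr u\<bar>)" by (rule set_integrable_subinterval[OF kri st])
      have 2: "set_integrable lebesgue {s..t} (\<lambda>u. \<bar>kw b u\<bar>)" if "b \<in> Basis" for b
        by (rule set_integrable_subinterval[OF kwi[OF that] st])
      have 3: "set_integrable lebesgue {s..t} (\<lambda>u. \<Sum>b\<in>Basis. \<bar>kw b u\<bar>)"
        by (intro absolutely_integrable_sum 2) auto
      have 4: "(LINT u:{s..t}|lebesgue. (\<Sum>b\<in>Basis. \<bar>kw b u\<bar>)) = (\<Sum>b\<in>Basis. LINT u:{s..t}|lebesgue. \<bar>kw b u\<bar>)"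
        unfolding set_lebesgue_integral_def scaleR_sum_right
        by (intro Bochner_Integration.integral_sum) (use 2 in \<open>simp add: set_integrable_def\<close>)
      show ?thesis unfolding m_def using 1 3 4 by (simp add: set_integral_add)
    qed
    finally show "dist (z s) (z t) \<le> (LINT u:{s..t}|lebesgue. m u)" .
  qed
  note good = AC2_differentiable_AE[OF T M xbar ac z]
  \<comment> \<open>The squared average speed over the dyadic interval of level \<open>n\<close>
    that contains \<open>t\<close>.\<close>
  define q where "q n t = (\<Sum>i<2^n. (dist (z (T * real i / 2^n)) (z (T * real (Suc i) / 2^n)) * 2^n / T)\<^sup>2
      * indicator {T * real i / 2^n..<T * real (Suc i) / 2^n} t)" for n t
  have qm [measurable]: "q n \<in> borel_measurable lborel" for n unfolding q_def by measurable
  have qint: "(\<integral>\<^sup>+t. ennreal (q n t) \<partial>lborel) = ennreal (dyadic_energy T n z)" for n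
  proof -
    have "(\<integral>\<^sup>+t. ennreal (q n t) \<partial>lborel) = (\<Sum>i<2^n. (\<integral>\<^sup>+t. ennreal ((dist (z (T * real i / 2^n)) (z (T * real (Suc i) / 2^n)) * 2^n / T)\<^sup>2)
       * indicator {T * real i / 2^n..<T * real (Suc i) / 2^n} t \<partial>lborel))"
    proof -
      have "ennreal (q n t) = (\<Sum>i<2^n. ennreal ((dist (z (T * real i / 2^n)) (z (T * real (Suc i) / 2^n)) * 2^n / T)\<^sup>2)
       * indicator {T * real i / 2^n..<T * real (Suc i) / 2^n} t)" for t
      proof -
        have "ennreal (q n t) = (\<Sum>i<2^n. ennreal ((dist (z (T * real i / 2^n)) (z (T * real (Suc i) / 2^n)) * 2^n / T)\<^sup>2
          * indicator {T * real i / 2^n..<T * real (Suc i) / 2^n} t))"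
          unfolding q_def by (rule sum_ennreal[symmetric]) simp
        also have "\<dots> = (\<Sum>i<2^n. ennreal ((dist (z (T * real i / 2^n)) (z (T * real (Suc i) / 2^n)) * 2^n / T)\<^sup>2)
           * indicator {T * real i / 2^n..<T * real (Suc i) / 2^n} t)"
          by (intro sum.cong refl) (simp only: ennreal_mult'' ennreal_indicator[symmetric] indicator_pos_le ennreal_mult' zero_le_power2)
        finally show ?thesis .
      qed
      then show ?thesis
        by (simp only:) (intro nn_integral_sum; simp)
    qed
    also have "\<dots> = (\<Sum>i<2^n. ennreal ((dist (z (T * real i / 2^n)) (z (T * real (Suc i) / 2^n)))\<^sup>2 * 2^n / T))"
    proof (rule sum.cong[OF refl])
      fix i assume "i \<in> {..<2^n::nat}"
      then have i: "i < 2^n" by simp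
      let ?a = "T * real i / 2^n" and ?b = "T * real (Suc i) / 2^n"
      have "(\<integral>\<^sup>+t. ennreal ((dist (z ?a) (z ?b) * 2^n / T)\<^sup>2) * indicator {?a..<?b} t \<partial>lborel)
          = ennreal ((dist (z ?a) (z ?b) * 2^n / T)\<^sup>2) * ennreal (T / 2^n)"
        using dyadic_points[OF T i] by (simp add: nn_integral_cmult_indicator del: of_nat_Suc)
      also have "\<dots> = ennreal ((dist (z ?a) (z ?b) * 2^n / T)\<^sup>2 * (T / 2^n))"
        using T by (intro ennreal_mult[symmetric]) auto
      also have "(dist (z ?a) (z ?b) * 2^n / T)\<^sup>2 * (T / 2^n) = (dist (z ?a) (z ?b))\<^sup>2 * 2^n / T"
        using T by (simp add: power2_eq_square del: of_nat_Suc)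
      finally show "(\<integral>\<^sup>+t. ennreal ((dist (z ?a) (z ?b) * 2^n / T)\<^sup>2) * indicator {?a..<?b} t \<partial>lborel)
          = ennreal ((dist (z ?a) (z ?b))\<^sup>2 * 2^n / T)" .
    qed
    also have "\<dots> = ennreal (dyadic_energy T n z)"
      unfolding dyadic_energy_def using T by (intro sum_ennreal) auto
    finally show ?thesis .
  qed
  have qlim: "(\<lambda>n. q n t) \<longlonglongrightarrow> cone_speed_sq xbar T z t"
    if t: "t \<in> {0<..<T}" and d: "cone_differentiable xbar z t" for t
  proof -
    have t0: "0 \<le> t" "t < T" using t by auto
    define a where "a n = T * real (dyadic_floor T n t) / 2^n" for n
    define b where "b n = T * real (Suc (dyadic_floor T n t)) / 2^n" for n
    have qn: "q n t = (dist (z (a n)) (z (b n)) / (b n - a n))\<^sup>2" for n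
    proof -
      define j where "j = dyadic_floor T n t"
      have j: "j < 2^n" unfolding j_def by (rule dyadic_floor_less[OF T t0])
      have tj: "T * real j / 2^n \<le> t" "t < T * real (Suc j) / 2^n"
        unfolding j_def by (rule dyadic_floor_bounds[OF T t0(1)])+
      have ind: "indicator {T * real i / 2^n..<T * real (Suc i) / 2^n} t = (if i = j then 1 else 0::real)" for i
      proof (cases i j rule: linorder_cases)
        case less
        then have "T * real (Suc i) / 2^n \<le> T * real j / 2^n" using T by (intro divide_right_mono mult_left_mono) auto
        with tj less show ?thesis by (simp add: indicator_def del: of_nat_Suc)
      next
        case greater
        then have "T * real (Suc j) / 2^n \<le> T * real i / 2^n" using T by (intro divide_right_mono mult_left_mono) auto
        with tj greater show ?thesis by (simp add: indicator_def del: of_nat_Suc)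
      qed (use tj in \<open>simp add: indicator_def del: of_nat_Suc\<close>)
      have "q n t = (dist (z (a n)) (z (b n)) * 2^n / T)\<^sup>2"
        unfolding q_def ind a_def b_def j_def[symmetric] using j by (simp add: if_distrib sum.delta cong: if_cong)
      also have "\<dots> = (dist (z (a n)) (z (b n)) / (T / 2^n))\<^sup>2" by simp
      also have "T / 2^n = b n - a n" unfolding a_def b_def j_def[symmetric] using dyadic_points(4)[OF T j] by simp
      finally show ?thesis .
    qed
    have al: "a \<longlonglongrightarrow> t" and bl: "b \<longlonglongrightarrow> t"
      unfolding a_def b_def by (rule dyadic_floor_tendsto[OF T t0(1)])+
    have "\<forall>\<^sub>F n in sequentially. a n \<le> t \<and> t \<le> b n \<and> a n < b n"
      using dyadic_floor_bounds[OF T t0(1)] unfolding a_def b_def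
      by (intro always_eventually allI) (meson le_less_trans less_imp_le)
    with d show ?thesis unfolding qn cone_differentiable_def
      by (elim conjE exE) (rule cone_speed_sq_limit[OF t _ _ _ al bl])
  qed
  \<comment> \<open>The pointwise limit supplies a Borel function that agrees almost everywhere on
    \<open>{0..T}\<close> with the squared speed, whose own measurability is not evident.\<close>
  define f where "f t = lim (\<lambda>n. q n t)" for t
  have fm [measurable]: "f \<in> borel_measurable lborel" unfolding f_def by measurable
  have feq: "f t = cone_speed_sq xbar T z t" if "t \<in> {0<..<T}" "cone_differentiable xbar z t" for t
    unfolding f_def by (rule limI[OF qlim[OF that]])
  have AEf: "AE t in lborel. t \<in> {0..T} \<longrightarrow> (\<lambda>n. q n t) \<longlonglongrightarrow> f t \<and> f t = cone_speed_sq xbar T z t"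
  proof -
    have "AE t in lebesgue. t \<in> {0..T} \<longrightarrow> (\<lambda>n. q n t) \<longlonglongrightarrow> f t \<and> f t = cone_speed_sq xbar T z t"
      using good by eventually_elim (use qlim feq in auto)
    then show ?thesis by (simp add: AE_completion_iff)
  qed
  have fint: "(\<integral>\<^sup>+t. ennreal (indicator {0..T} t * f t) \<partial>lborel) \<le> ennreal K"
  proof -
    have "(\<integral>\<^sup>+t. ennreal (indicator {0..T} t * f t) \<partial>lborel) \<le> (\<integral>\<^sup>+t. liminf (\<lambda>n. ennreal (q n t)) \<partial>lborel)"
    proof (rule nn_integral_mono_AE)
      show "AE t in lborel. ennreal (indicator {0..T} t * f t) \<le> liminf (\<lambda>n. ennreal (q n t))"
        using AEf
      proof eventually_elim
        case (elim t)
        show ?case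
        proof (cases "t \<in> {0..T}")
          case True
          with elim have "(\<lambda>n. ennreal (q n t)) \<longlonglongrightarrow> ennreal (f t)" by (intro tendsto_ennrealI) auto
          then show ?thesis using True by (simp add: lim_imp_Liminf)
        qed simp
      qed
    qed
    also have "\<dots> \<le> liminf (\<lambda>n. \<integral>\<^sup>+t. ennreal (q n t) \<partial>lborel)" by (rule nn_integral_liminf) simp
    also have "\<dots> \<le> ennreal K" unfolding qint
    proof (rule Liminf_le)
      show "\<forall>\<^sub>F n in sequentially. ennreal (dyadic_energy T n z) \<le> ennreal K"
        using bd by (intro always_eventually allI ennreal_leI)
    qed simp
    finally show ?thesis .
  qed
  have fi: "integrable lborel (\<lambda>t. indicator {0..T} t * f t)"
  proof (rule integrableI_nonneg)
    show "AE t in lborel. 0 \<le> indicator {0..T} t * f t"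
      using AEf by eventually_elim (auto simp: indicator_def)
    show "(\<integral>\<^sup>+t. ennreal (indicator {0..T} t * f t) \<partial>lborel) < \<infinity>"
      using fint by (rule le_less_trans) simp
  qed simp
  have fa: "set_integrable lebesgue {0..T} f"
    unfolding set_integrable_def using fi by (intro integrable_completion[THEN iffD2]) auto
  show AC2: "AC2 T z"
    unfolding AC2_def
  proof (intro conjI ac)
    \<comment> \<open>An explicit null set is extracted so that integrability passes from
      \<open>f\<close> to the squared metric derivative.\<close>
    have "\<exists>N\<in>null_sets lebesgue. {t \<in> space lebesgue. \<not> (t \<in> {0..T} \<longrightarrow> t \<in> {0<..<T} \<and> cone_differentiable xbar z t)} \<subseteq> N"
      using good by (simp only: eventually_ae_filter)
    then obtain N where N: "N \<in> null_sets lebesgue" "{t \<in> space lebesgue. \<not> (t \<in> {0..T} \<longrightarrow> t \<in> {0<..<T} \<and> cone_differentiable xbar z t)} \<subseteq> N"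
      by (elim bexE)
    show "set_integrable lebesgue {0..T} (\<lambda>t. (metric_derivative T z t)\<^sup>2)"
    proof (rule absolutely_integrable_spike[OF fa])
      show "negligible N" using N(1) by (simp add: negligible_iff_null_sets)
      fix t assume "t \<in> {0..T} - N"
      then have "t \<in> {0<..<T}" "cone_differentiable xbar z t" using N(2) by auto
      then show "(metric_derivative T z t)\<^sup>2 = f t" by (simp add: feq metric_derivative_sq)
    qed
  qed
  have "path_action xbar T z = (\<integral>\<^sup>+t. ennreal (indicator {0..T} t * f t) \<partial>lborel)"
  proof -
    have "path_action xbar T z = (\<integral>\<^sup>+t\<in>{0..T}. ennreal (cone_speed_sq xbar T z t) \<partial>lebesgue)"
      using AC2 by (simp add: path_action_def)
    also have "\<dots> = (\<integral>\<^sup>+t. ennreal (indicator {0..T} t * f t) \<partial>lebesgue)"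
      by (rule nn_integral_cong_AE) (use good in \<open>eventually_elim, auto simp: indicator_def feq\<close>)
    also have "\<dots> = (\<integral>\<^sup>+t. ennreal (indicator {0..T} t * f t) \<partial>lborel)"
      by (rule nn_integral_completion)
    finally show ?thesis .
  qed
  with fint show "path_action xbar T z \<le> ennreal K" by simp
qed

theorem path_action_eq_dyadic_energy:
  fixes z :: "real \<Rightarrow> 'a::euclidean_space cone"
  assumes T: "T > 0" and M: "bounded M" and xbar: "xbar \<in> M"
    and cont: "continuous_on {0..T} z" and z: "\<forall>t\<in>{0..T}. z t \<in> cone_over M"
  shows "path_action xbar T z = (SUP n. ennreal (dyadic_energy T n z))"
proof (rule antisym)
  show "path_action xbar T z \<le> (SUP n. ennreal (dyadic_energy T n z))"
  proof (cases "(SUP n. ennreal (dyadic_energy T n z))")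
    case (real K)
    then have "ennreal (dyadic_energy T n z) \<le> ennreal K" for n
      by (metis SUP_upper UNIV_I)
    then have "dyadic_energy T n z \<le> K" for n using real by simp
    from AC2_of_dyadic_energy(2)[OF T M xbar cont z this] real show ?thesis by simp
  next
    case top
    then show ?thesis by (simp only: top_greatest)
  qed
  show "(SUP n. ennreal (dyadic_energy T n z)) \<le> path_action xbar T z"
  proof (cases "AC2 T z")
    case True
    show ?thesis
      unfolding path_action_AC2[OF T M xbar True z]
      by (intro SUP_least ennreal_leI dyadic_energy_le_AC2[OF T M xbar True z])
  qed (simp add: path_action_def)
qed

text \<open>Finite action forces the path into \<open>AC2\<close>, as the action of any other path
  is infinite. The result is the Hoelder estimate of exponent 1/2 behind equicontinuity.\<close>

lemma dist_sq_le_path_action: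
  fixes z :: "real \<Rightarrow> 'a::euclidean_space cone"
  assumes T: "T > 0" and M: "bounded M" and xbar: "xbar \<in> M"
    and z: "\<forall>t\<in>{0..T}. z t \<in> cone_over M"
    and m: "path_action xbar T z \<le> ennreal m" "0 \<le> m" and st: "0 \<le> s" "s \<le> t" "t \<le> T"
  shows "(dist (z s) (z t))\<^sup>2 \<le> m * (t - s)"
proof -
  have ac: "AC2 T z"
  proof (rule ccontr)
    assume "\<not> AC2 T z"
    then have "path_action xbar T z = \<infinity>" by (simp add: path_action_def)
    with m(1) show False by (simp add: top_unique)
  qed
  have md: "set_integrable lebesgue {0..T} (\<lambda>t. (metric_derivative T z t)\<^sup>2)"
    using ac by (auto simp: AC2_def)
  have "(LINT u:{s..t}|lebesgue. (metric_derivative T z u)\<^sup>2) \<le> (LINT u:{0..T}|lebesgue. (metric_derivative T z u)\<^sup>2)"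
    unfolding set_lebesgue_integral_def
    by (intro integral_mono) (use md set_integrable_subinterval[OF md st] st in \<open>auto simp: set_integrable_def indicator_def\<close>)
  also have "\<dots> \<le> m"
    using m(1) unfolding path_action_AC2[OF T M xbar ac z] ennreal_le_iff[OF m(2)] .
  finally have "(t - s) * (LINT u:{s..t}|lebesgue. (metric_derivative T z u)\<^sup>2) \<le> (t - s) * m"
    using st by (intro mult_left_mono) auto
  with dist_sq_le_AC2[OF T M xbar ac z st] show ?thesis by (simp add: mult.commute)
qed

section \<open>The space of paths\<close>

locale cone_paths =
  fixes M :: "'a::euclidean_space set" and xbar :: 'a and T :: real
  assumes M: "compact M" and xbar: "xbar \<in> M" and T: "T > 0"
begin

sublocale P: Metric_space "mspace (path_metric M T)" "mdist (path_metric M T)"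
  by simp

abbreviation "paths \<equiv> mspace (path_metric M T)"
abbreviation "pdist \<equiv> mdist (path_metric M T)"

lemma path_borel_eq: "path_borel M T = P.mborel"
  by (simp add: path_borel_def P.mborel_def mtopology_of_def)

lemma ends: "0 \<in> {0..T}" "T \<in> {0..T}" using T by auto

lemma pathD:
  assumes "z \<in> paths"
  shows "t \<in> {0..T} \<Longrightarrow> z t \<in> cone_over M" "continuous_on {0..T} z"
  using assms unfolding mspace_path_metric by auto

lemma path_all: "z \<in> paths \<Longrightarrow> \<forall>t\<in>{0..T}. z t \<in> cone_over M"
  using pathD(1) by blast

lemma pathI:
  assumes "\<And>t. t \<in> {0..T} \<Longrightarrow> z t \<in> cone_over M" "continuous_on {0..T} z"
  shows "restrict z {0..T} \<in> paths"
proof -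
  have "continuous_on {0..T} (restrict z {0..T})"
    by (rule continuous_on_cong[THEN iffD1, OF refl _ assms(2)]) simp
  then show ?thesis unfolding mspace_path_metric using assms(1) by auto
qed

lemma dist_le_pdist:
  assumes "z \<in> paths" "w \<in> paths" "t \<in> {0..T}"
  shows "dist (z t) (w t) \<le> pdist z w"
  using mdist_cfunspace_imp_mdist_le[of z "top_of_set {0..T}" "submetric euclidean_metric (cone_over M)" w "pdist z w" t] assms
  by (simp add: path_metric_def)

lemma pdist_le:
  assumes "0 \<le> B" "\<And>t. t \<in> {0..T} \<Longrightarrow> dist (z t) (w t) \<le> B"
  shows "pdist z w \<le> B"
  unfolding path_metric_def by (rule mdist_cfunspace_le) (use assms in auto)

lemma mcomplete_paths: "P.mcomplete"
proof -
  interpret C: Metric_space "cone_over M" "dist :: 'a cone \<Rightarrow> _"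
    by unfold_locales (auto simp: dist_commute dist_triangle)
  have self: "C.Self = submetric euclidean_metric (cone_over M)"
    by (simp add: C.Self_def submetric_def)
  have "C.mcomplete"
    unfolding C.mcomplete_def
  proof (intro allI impI)
    fix \<sigma> assume s: "C.MCauchy \<sigma>"
    then have "Cauchy \<sigma>" "\<And>n. \<sigma> n \<in> cone_over M" unfolding C.MCauchy_def Cauchy_def by auto
    then obtain l where l: "l \<in> cone_over M" "\<sigma> \<longlonglongrightarrow> l"
      using complete_cone_over[OF M] by blast
    then have "limitin C.mtopology \<sigma> l sequentially"
      unfolding C.limitin_metric using s
      by (auto simp: C.MCauchy_def tendsto_iff range_subsetD eventually_conj_iff)
    then show "\<exists>x. limitin C.mtopology \<sigma> x sequentially" ..
  qed
  then have "mcomplete_of (cfunspace (top_of_set {0..T}) C.Self)"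
    by (rule C.mcomplete_cfunspace)
  then show ?thesis unfolding self mcomplete_of_def path_metric_def .
qed

lemma limitin_pathsD:
  assumes "limitin P.mtopology \<sigma> l sequentially"
  shows "l \<in> paths" "0 < e \<Longrightarrow> \<forall>\<^sub>F n in sequentially. \<sigma> n \<in> paths \<and> (\<forall>t\<in>{0..T}. dist (\<sigma> n t) (l t) < e)"
proof -
  show l: "l \<in> paths" using assms by (simp add: P.limitin_metric)
  assume "0 < e"
  then have "\<forall>\<^sub>F n in sequentially. \<sigma> n \<in> paths \<and> pdist (\<sigma> n) l < e"
    using assms by (simp add: P.limitin_metric)
  then show "\<forall>\<^sub>F n in sequentially. \<sigma> n \<in> paths \<and> (\<forall>t\<in>{0..T}. dist (\<sigma> n t) (l t) < e)"
    by eventually_elim (meson dist_le_pdist l le_less_trans)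
qed

lemma limitin_paths_pointwise:
  assumes "limitin P.mtopology \<sigma> l sequentially" "t \<in> {0..T}"
  shows "(\<lambda>n. \<sigma> n t) \<longlonglongrightarrow> l t"
proof (rule tendstoI)
  fix e :: real assume "0 < e"
  from limitin_pathsD(2)[OF assms(1) this] show "\<forall>\<^sub>F n in sequentially. dist (\<sigma> n t) (l t) < e"
    by eventually_elim (use assms(2) in blast)
qed

lemma path_action_paths:
  "z \<in> paths \<Longrightarrow> path_action xbar T z = (SUP n. ennreal (dyadic_energy T n z))"
  by (rule path_action_eq_dyadic_energy[OF T compact_imp_bounded[OF M] xbar pathD(2) path_all])

lemma dyadic_energy_tendsto:
  assumes "limitin P.mtopology \<sigma> l sequentially"
  shows "(\<lambda>k. dyadic_energy T n (\<sigma> k)) \<longlonglongrightarrow> dyadic_energy T n l"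
  unfolding dyadic_energy_def
proof (intro tendsto_sum)
  fix i assume "i \<in> {..<2^n::nat}"
  then have i: "i < 2^n" by simp
  let ?a = "T * real i / 2^n" and ?b = "T * real (Suc i) / 2^n"
  have "?a \<in> {0..T}" "?b \<in> {0..T}"
    unfolding atLeastAtMost_iff using dyadic_points(1-3)[OF T i] by (meson order_trans)+
  then have "(\<lambda>k. dist (\<sigma> k ?a) (\<sigma> k ?b)) \<longlonglongrightarrow> dist (l ?a) (l ?b)"
    by (intro tendsto_dist limitin_paths_pointwise[OF assms])
  then show "(\<lambda>k. (dist (\<sigma> k ?a) (\<sigma> k ?b))\<^sup>2 * 2^n / T) \<longlonglongrightarrow> (dist (l ?a) (l ?b))\<^sup>2 * 2^n / T"
    by (intro tendsto_divide[OF tendsto_mult[OF tendsto_power tendsto_const] tendsto_const]) (use T in simp_all)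
qed

lemma dyadic_energy_measurable [measurable]: "dyadic_energy T n \<in> borel_measurable P.mborel"
  by (rule P.borel_measurable_mborel_sequential) (rule dyadic_energy_tendsto)

text \<open>The action written as a supremum of functionals that depend on the path only through
  finitely many positions, hence continuously. Measurability and lower semicontinuity are visible
  from this form.\<close>

definition energy :: "(real \<Rightarrow> 'a cone) \<Rightarrow> ennreal" where
  "energy z = (SUP n. ennreal (dyadic_energy T n z))"

lemma energy_measurable [measurable]: "energy \<in> borel_measurable P.mborel"
  unfolding energy_def by measurable

lemma action_eq:
  assumes "space \<mu> = paths"
  shows "action xbar T \<mu> = (\<integral>\<^sup>+z. energy z \<partial>\<mu>)"
  unfolding action_def energy_def by (rule nn_integral_cong) (simp add: assms path_action_paths)

lemma energy_liminf:
  assumes "limitin P.mtopology \<sigma> l sequentially"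
  shows "energy l \<le> liminf (\<lambda>k. energy (\<sigma> k))"
  unfolding energy_def
proof (rule SUP_least)
  fix n
  have "(\<lambda>k. ennreal (dyadic_energy T n (\<sigma> k))) \<longlonglongrightarrow> ennreal (dyadic_energy T n l)"
    by (intro tendsto_ennrealI dyadic_energy_tendsto[OF assms])
  then have "ennreal (dyadic_energy T n l) = liminf (\<lambda>k. ennreal (dyadic_energy T n (\<sigma> k)))"
    by (rule lim_imp_Liminf[OF trivial_limit_sequentially, symmetric])
  also have "\<dots> \<le> liminf (\<lambda>k. SUP n. ennreal (dyadic_energy T n (\<sigma> k)))"
    by (intro Liminf_mono always_eventually allI SUP_upper) simp
  finally show "ennreal (dyadic_energy T n l) \<le> liminf (\<lambda>k. SUP n. ennreal (dyadic_energy T n (\<sigma> k)))" .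
qed

definition marginal_functional :: "(real \<times> 'a \<Rightarrow> real) \<Rightarrow> (real \<Rightarrow> 'a cone) \<Rightarrow> real" where
  "marginal_functional f z = (LINT t:{0..T}|lborel. f (t, cone_base xbar (z t)) * (cone_radius (z t))\<^sup>2)"

lemma integrand_continuous:
  assumes f: "continuous_on ({0..T} \<times> M) f" and z: "z \<in> paths"
  shows "continuous_on {0..T} (\<lambda>t. f (t, cone_base xbar (z t)) * (cone_radius (z t))\<^sup>2)"
proof -
  have "continuous_on {0..T} (\<lambda>t. (t, z t))"
    using pathD(2)[OF z] by (intro continuous_on_Pair continuous_on_id)
  moreover have "(\<lambda>t. (t, z t)) ` {0..T} \<subseteq> {0..T} \<times> cone_over M"
    using pathD(1)[OF z] by auto
  ultimately have "continuous_on {0..T} (\<lambda>t. case (t, z t) of (t, p) \<Rightarrow> f (t, cone_base xbar p) * (cone_radius p)\<^sup>2)"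
    by (rule continuous_on_compose2[OF continuous_on_cone_integrand[OF M xbar f]])
  then show ?thesis by (simp only: prod.case)
qed

lemma path_radius_bounded:
  assumes "z \<in> paths"
  obtains R where "0 \<le> R" "\<forall>t\<in>{0..T}. cone_radius (z t) \<le> R"
proof -
  have "continuous_on {0..T} (\<lambda>t. cone_radius (z t))"
    by (rule continuous_on_compose2[OF continuous_on_cone_radius[of UNIV] pathD(2)[OF assms]]) simp
  then have "bounded ((\<lambda>t. cone_radius (z t)) ` {0..T})"
    by (intro compact_imp_bounded compact_continuous_image compact_Icc)
  then obtain R where R: "\<forall>t\<in>{0..T}. cone_radius (z t) \<le> R" by (auto simp: bounded_iff)
  have "0 \<le> R" using order_trans[OF cone_radius_nonneg R[rule_format, OF ends(1)]] .
  then show thesis using that R by blast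
qed

lemma continuous_function_bounded:
  assumes "continuous_on ({0..T} \<times> M) f"
  obtains B where "0 \<le> B" "\<forall>t\<in>{0..T}. \<forall>x\<in>M. \<bar>f (t, x) :: real\<bar> \<le> B"
proof -
  have "bounded (f ` ({0..T} \<times> M))"
    by (intro compact_imp_bounded compact_continuous_image assms compact_Times M compact_Icc)
  then obtain B where "\<forall>q\<in>{0..T} \<times> M. \<bar>f q\<bar> \<le> B" by (auto simp: bounded_iff)
  then have B: "\<forall>t\<in>{0..T}. \<forall>x\<in>M. \<bar>f (t, x)\<bar> \<le> B" by blast
  have "0 \<le> B" using order_trans[OF abs_ge_zero B[rule_format, OF ends(1) xbar]] .
  then show thesis using that B by blast
qed

text \<open>Uniform convergence puts the radii, from some index on, within 1 of those of the limit
  path. This supplies the dominating constant \<open>B * (R + 1)^2\<close>; the first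
  \<open>n0\<close> terms are dropped and restored at the end.\<close>

lemma marginal_functional_tendsto:
  assumes f: "continuous_on ({0..T} \<times> M) f" and r: "range \<sigma> \<subseteq> paths"
    and lim: "limitin P.mtopology \<sigma> l sequentially"
  shows "(\<lambda>n. marginal_functional f (\<sigma> n)) \<longlonglongrightarrow> marginal_functional f l"
proof -
  have l: "l \<in> paths" by (rule limitin_pathsD(1)[OF lim])
  obtain B where B: "0 \<le> B" "\<forall>t\<in>{0..T}. \<forall>x\<in>M. \<bar>f (t, x)\<bar> \<le> B"
    using continuous_function_bounded[OF f] .
  obtain R where R: "0 \<le> R" "\<forall>t\<in>{0..T}. cone_radius (l t) \<le> R"
    using path_radius_bounded[OF l] .
  obtain n0 where n0: "\<forall>n\<ge>n0. \<forall>t\<in>{0..T}. dist (\<sigma> n t) (l t) < 1"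
    using limitin_pathsD(2)[OF lim, of 1] zero_less_one unfolding eventually_sequentially by blast
  define g where "g z t = indicator {0..T} t *\<^sub>R (f (t, cone_base xbar (z t)) * (cone_radius (z t))\<^sup>2)" for z t
  have gm: "g z \<in> borel_measurable lborel" if "z \<in> paths" for z
    unfolding g_def using borel_measurable_continuous_on_indicator[OF _ integrand_continuous[OF f that]] by simp
  have "(\<lambda>n. \<integral>t. g (\<sigma> (n + n0)) t \<partial>lborel) \<longlonglongrightarrow> (\<integral>t. g l t \<partial>lborel)"
  proof (rule integral_dominated_convergence[where w="\<lambda>t. indicator {0..T} t * (B * (R + 1)\<^sup>2)"])
    show "g l \<in> borel_measurable lborel" "\<And>n. g (\<sigma> (n + n0)) \<in> borel_measurable lborel"
      using gm l r by auto
    show "integrable lborel (\<lambda>t. indicator {0..T} t * (B * (R + 1)\<^sup>2))"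
      using T by (intro integrable_mult_left integrable_real_indicator) auto
    show "AE t in lborel. (\<lambda>n. g (\<sigma> (n + n0)) t) \<longlonglongrightarrow> g l t"
    proof (intro always_eventually allI)
      fix t
      show "(\<lambda>n. g (\<sigma> (n + n0)) t) \<longlonglongrightarrow> g l t"
      proof (cases "t \<in> {0..T}")
        case True
        have p: "(\<lambda>n. (t, \<sigma> (n + n0) t)) \<longlonglongrightarrow> (t, l t)"
          by (intro tendsto_Pair tendsto_const LIMSEQ_ignore_initial_segment limitin_paths_pointwise[OF lim True])
        have "(\<lambda>n. case (t, \<sigma> (n + n0) t) of (t, p) \<Rightarrow> f (t, cone_base xbar p) * (cone_radius p)\<^sup>2)
           \<longlonglongrightarrow> (case (t, l t) of (t, p) \<Rightarrow> f (t, cone_base xbar p) * (cone_radius p)\<^sup>2)"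
          by (rule continuous_on_tendsto_compose[OF continuous_on_cone_integrand[OF M xbar f] p])
            (use True pathD(1)[OF l True] pathD(1)[OF range_subsetD[OF r] True] in auto)
        then show ?thesis using True by (simp add: g_def)
      qed (simp add: g_def)
    qed
    show "AE t in lborel. norm (g (\<sigma> (n + n0)) t) \<le> indicator {0..T} t * (B * (R + 1)\<^sup>2)" for n
    proof (intro always_eventually allI)
      fix t
      show "norm (g (\<sigma> (n + n0)) t) \<le> indicator {0..T} t * (B * (R + 1)\<^sup>2)"
      proof (cases "t \<in> {0..T}")
        case True
        have s: "\<sigma> (n + n0) \<in> paths" using r by auto
        have "cone_radius (\<sigma> (n + n0) t) \<le> R + 1"
          using cone_radius_lipschitz[of "\<sigma> (n + n0) t" "l t"] n0[rule_format, OF _ True, of "n + n0"] R(2)[rule_format, OF True] by simp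
        then have "(cone_radius (\<sigma> (n + n0) t))\<^sup>2 \<le> (R + 1)\<^sup>2" by (intro power_mono) auto
        moreover have "\<bar>f (t, cone_base xbar (\<sigma> (n + n0) t))\<bar> \<le> B"
          by (intro B(2)[rule_format, OF True] cone_base_in[OF pathD(1)[OF s True] xbar])
        ultimately show ?thesis using True B(1) by (simp add: g_def abs_mult mult_mono)
      qed (simp add: g_def)
    qed
  qed
  then have "(\<lambda>n. marginal_functional f (\<sigma> (n + n0))) \<longlonglongrightarrow> marginal_functional f l"
    by (simp add: g_def marginal_functional_def set_lebesgue_integral_def)
  then show ?thesis by (rule LIMSEQ_offset)
qed

text \<open>Every marginal functional is controlled by the one for the constant 1. It is therefore
  bounded on paths of prescribed size and zero on paths of size zero.\<close>

lemma marginal_functional_bound: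
  assumes f: "continuous_on ({0..T} \<times> M) f" and z: "z \<in> paths"
    and B: "\<forall>t\<in>{0..T}. \<forall>x\<in>M. \<bar>f (t, x)\<bar> \<le> B"
  shows "\<bar>marginal_functional f z\<bar> \<le> B * marginal_functional (\<lambda>_. 1) z"
proof -
  have i1: "set_integrable lborel {0..T} (\<lambda>t. f (t, cone_base xbar (z t)) * (cone_radius (z t))\<^sup>2)"
    by (rule borel_integrable_atLeastAtMost') (rule integrand_continuous[OF f z])
  have i2: "set_integrable lborel {0..T} (\<lambda>t. 1 * (cone_radius (z t))\<^sup>2)"
    by (rule borel_integrable_atLeastAtMost') (rule integrand_continuous[OF continuous_on_const z])
  have "\<bar>marginal_functional f z\<bar> \<le> (LINT t:{0..T}|lborel. norm (f (t, cone_base xbar (z t)) * (cone_radius (z t))\<^sup>2))"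
    unfolding marginal_functional_def using set_integral_norm_bound[OF i1] by simp
  also have "\<dots> \<le> (LINT t:{0..T}|lborel. B * (1 * (cone_radius (z t))\<^sup>2))"
  proof (rule set_integral_mono)
    show "set_integrable lborel {0..T} (\<lambda>t. norm (f (t, cone_base xbar (z t)) * (cone_radius (z t))\<^sup>2))"
      using set_integrable_norm[OF i1] by simp
    show "set_integrable lborel {0..T} (\<lambda>t. B * (1 * (cone_radius (z t))\<^sup>2))"
      using i2 by (rule set_integrable_mult_right)
    fix t assume t: "t \<in> {0..T}"
    have "\<bar>f (t, cone_base xbar (z t))\<bar> * (cone_radius (z t))\<^sup>2 \<le> B * (cone_radius (z t))\<^sup>2"
      by (intro mult_right_mono B[rule_format, OF t] cone_base_in[OF pathD(1)[OF z t] xbar]) simp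
    then show "norm (f (t, cone_base xbar (z t)) * (cone_radius (z t))\<^sup>2) \<le> B * (1 * (cone_radius (z t))\<^sup>2)"
      by (simp add: abs_mult)
  qed
  also have "\<dots> = B * marginal_functional (\<lambda>_. 1) z"
    by (simp add: marginal_functional_def)
  finally show ?thesis .
qed

lemma marginal_functional_one_nonneg: "0 \<le> marginal_functional (\<lambda>_. 1) z"
  unfolding marginal_functional_def set_lebesgue_integral_def by (rule integral_nonneg_AE) auto

text \<open>The first term controls the marginal functionals, the endpoint radii control the
  coupling functionals. Each term is itself a constraint functional, so the mean of the sum is the
  same for all admissible plans.\<close>

definition path_size :: "(real \<Rightarrow> 'a cone) \<Rightarrow> real" where
  "path_size z = marginal_functional (\<lambda>_. 1) z + ((cone_radius (z 0))\<^sup>2 + (cone_radius (z T))\<^sup>2)"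

lemma path_size_nonneg: "0 \<le> path_size z"
  unfolding path_size_def using marginal_functional_one_nonneg[of z] by simp

lemma path_size_ge:
  "marginal_functional (\<lambda>_. 1) z \<le> path_size z" "(cone_radius (z 0))\<^sup>2 \<le> path_size z" "(cone_radius (z T))\<^sup>2 \<le> path_size z"
  unfolding path_size_def using marginal_functional_one_nonneg[of z] by simp_all

lemma coupling_tendsto:
  fixes f :: "'a cone \<times> 'a cone \<Rightarrow> real"
  assumes f: "continuous_on (cone_over M \<times> cone_over M) f" and r: "range \<sigma> \<subseteq> paths"
    and lim: "limitin P.mtopology \<sigma> l sequentially"
  shows "(\<lambda>n. f (\<sigma> n 0, \<sigma> n T)) \<longlonglongrightarrow> f (l 0, l T)"
proof (rule continuous_on_tendsto_compose[OF f])
  show "(\<lambda>n. (\<sigma> n 0, \<sigma> n T)) \<longlonglongrightarrow> (l 0, l T)"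
    by (intro tendsto_Pair limitin_paths_pointwise[OF lim] ends)
  show "(l 0, l T) \<in> cone_over M \<times> cone_over M"
    using pathD(1)[OF limitin_pathsD(1)[OF lim]] ends by blast
  have "(\<sigma> n 0, \<sigma> n T) \<in> cone_over M \<times> cone_over M" for n
    using pathD(1)[of "\<sigma> n"] r ends by blast
  then show "\<forall>\<^sub>F n in sequentially. (\<sigma> n 0, \<sigma> n T) \<in> cone_over M \<times> cone_over M" by simp
qed

lemma radius_sq_sum_continuous:
  "continuous_on S (\<lambda>p. (cone_radius (fst p :: 'a cone))\<^sup>2 + (cone_radius (snd p :: 'a cone))\<^sup>2)"
proof (intro continuous_intros)
  show "continuous_on S (\<lambda>p. cone_radius (fst p :: 'a cone))"
    by (rule continuous_on_compose2[OF continuous_on_cone_radius[of UNIV]]) (auto intro: continuous_intros)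
  show "continuous_on S (\<lambda>p. cone_radius (snd p :: 'a cone))"
    by (rule continuous_on_compose2[OF continuous_on_cone_radius[of UNIV]]) (auto intro: continuous_intros)
qed

lemma path_size_measurable [measurable]: "path_size \<in> borel_measurable P.mborel"
proof (rule P.borel_measurable_mborel_sequential)
  fix \<sigma> l assume r: "range \<sigma> \<subseteq> paths" and l: "limitin P.mtopology \<sigma> l sequentially"
  show "(\<lambda>n. path_size (\<sigma> n)) \<longlonglongrightarrow> path_size l"
    unfolding path_size_def
    using tendsto_add[OF marginal_functional_tendsto[OF continuous_on_const r l] coupling_tendsto[OF radius_sq_sum_continuous r l]]
    by simp
qed

end

section \<open>Dilations\<close>

context cone_paths
begin

definition path_scale :: "real \<Rightarrow> (real \<Rightarrow> 'a cone) \<Rightarrow> real \<Rightarrow> 'a cone" where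
  "path_scale c z = (\<lambda>t\<in>{0..T}. cone_scale c (z t))"

lemma path_scale_apply [simp]: "t \<in> {0..T} \<Longrightarrow> path_scale c z t = cone_scale c (z t)"
  by (simp add: path_scale_def)

lemma dist_cone_scale_le:
  fixes p q :: "'a cone"
  assumes "0 \<le> c"
  shows "dist (cone_scale c p) (cone_scale c q) \<le> c * dist p q"
proof (cases "c = 0")
  case True
  then show ?thesis using dist_cone_le_radius_sum[of "cone_scale 0 p" "cone_scale 0 q"] by simp
next
  case False
  with assms show ?thesis by (simp add: dist_cone_scale)
qed

lemma path_scale_in:
  assumes c: "0 \<le> c" and z: "z \<in> paths"
  shows "path_scale c z \<in> paths"
  unfolding path_scale_def
proof (rule pathI)
  show "cone_scale c (z t) \<in> cone_over M" if "t \<in> {0..T}" for t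
    by (rule cone_scale_in[OF c pathD(1)[OF z that]])
  have "c-lipschitz_on UNIV (cone_scale c :: 'a cone \<Rightarrow> _)"
    using c by (intro lipschitz_onI dist_cone_scale_le)
  from continuous_on_compose2[OF lipschitz_on_continuous_on[OF this] pathD(2)[OF z]]
  show "continuous_on {0..T} (\<lambda>t. cone_scale c (z t))" by simp
qed

lemma path_scale_measurable:
  assumes c: "0 \<le> c"
  shows "path_scale c \<in> measurable P.mborel P.mborel"
proof (rule P.measurable_mborel_sequential)
  fix \<sigma> l assume r: "range \<sigma> \<subseteq> paths" and lim: "limitin P.mtopology \<sigma> l sequentially"
  have l: "l \<in> paths" by (rule limitin_pathsD(1)[OF lim])
  show "limitin P.mtopology (\<lambda>n. path_scale c (\<sigma> n)) (path_scale c l) sequentially"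
    unfolding P.limitin_metric
  proof (intro conjI allI impI path_scale_in[OF c l])
    fix e :: real assume e: "0 < e"
    \<comment> \<open>The factor \<open>c + 1\<close> in place of \<open>c\<close> avoids division
      by zero for the degenerate dilation.\<close>
    have "0 < e / (2 * (c + 1))" using e c by simp
    from limitin_pathsD(2)[OF lim this]
    show "\<forall>\<^sub>F n in sequentially. path_scale c (\<sigma> n) \<in> paths \<and> pdist (path_scale c (\<sigma> n)) (path_scale c l) < e"
    proof eventually_elim
      case (elim n)
      have "pdist (path_scale c (\<sigma> n)) (path_scale c l) \<le> e / 2"
      proof (rule pdist_le)
        fix t assume t: "t \<in> {0..T}"
        have "dist (path_scale c (\<sigma> n) t) (path_scale c l t) \<le> c * dist (\<sigma> n t) (l t)"
          using t c by (simp add: dist_cone_scale_le)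
        also have "\<dots> \<le> (c + 1) * (e / (2 * (c + 1)))"
          using elim t c by (intro mult_mono) (auto intro: less_imp_le)
        also have "\<dots> = e / 2"
        proof -
          have "k * (e / (2 * k)) = e / 2" if "k \<noteq> 0" for k using that by simp
          moreover have "c + 1 \<noteq> 0" using c by linarith
          ultimately show ?thesis by blast
        qed
        finally show "dist (path_scale c (\<sigma> n) t) (path_scale c l t) \<le> e / 2" .
      qed (use e in simp)
      moreover have "path_scale c (\<sigma> n) \<in> paths" using elim by (intro path_scale_in[OF c]) blast
      ultimately show ?case using e by linarith
    qed
  qed
qed (rule path_scale_in[OF c])

text \<open>The factor depends on the path. Rounding it down to a multiple of \<open>1/2^n\<close>
  leaves countably many fixed dilations, and the resulting paths converge uniformly, as the error is
  at most \<open>(1/2)^n\<close> times the largest radius.\<close>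

lemma path_scale_measurable_compose:
  assumes a [measurable]: "a \<in> borel_measurable P.mborel" and a0: "\<And>z. 0 \<le> a z"
  shows "(\<lambda>z. path_scale (a z) z) \<in> measurable P.mborel P.mborel"
proof (rule P.measurable_mborel_limit)
  define k where "k n z = nat \<lfloor>a z * 2^n\<rfloor>" for n :: nat and z
  have km [measurable]: "k n \<in> measurable P.mborel (count_space UNIV)" for n
    unfolding k_def by measurable
  show "(\<lambda>z. path_scale (real (k n z) / 2^n) z) \<in> measurable P.mborel P.mborel" for n
    by (rule measurable_compose_countable[OF path_scale_measurable km]) simp
  fix z assume "z \<in> space P.mborel"
  then have z: "z \<in> paths" by simp
  obtain R where R: "0 \<le> R" "\<forall>t\<in>{0..T}. cone_radius (z t) \<le> R" using path_radius_bounded[OF z] .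
  have close: "\<bar>real (k n z) / 2^n - a z\<bar> \<le> (1/2)^n" for n
  proof -
    have "0 \<le> a z * 2^n" using a0 by simp
    then have 1: "real (k n z) \<le> a z * 2^n" "a z * 2^n \<le> real (k n z) + 1"
      unfolding k_def by linarith+
    have "real (k n z) / 2^n \<le> a z" using 1(1) by (simp add: pos_divide_le_eq)
    moreover have "a z \<le> (real (k n z) + 1) / 2^n" using 1(2) by (simp add: pos_le_divide_eq)
    ultimately show ?thesis by (simp add: add_divide_distrib power_one_over abs_le_iff)
  qed
  show "limitin P.mtopology (\<lambda>n. path_scale (real (k n z) / 2^n) z) (path_scale (a z) z) sequentially"
    unfolding P.limitin_metric
  proof (intro conjI allI impI path_scale_in[OF a0 z])
    fix e :: real assume e: "0 < e"
    have "(\<lambda>n. (1/2)^n * R) \<longlonglongrightarrow> 0"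
      by (intro tendsto_mult_left_zero LIMSEQ_realpow_zero) auto
    then have "\<forall>\<^sub>F n in sequentially. (1/2)^n * R < e" using e by (rule order_tendstoD(2))
    then show "\<forall>\<^sub>F n in sequentially. path_scale (real (k n z) / 2^n) z \<in> paths
        \<and> pdist (path_scale (real (k n z) / 2^n) z) (path_scale (a z) z) < e"
    proof eventually_elim
      case (elim n)
      have "pdist (path_scale (real (k n z) / 2^n) z) (path_scale (a z) z) \<le> (1/2)^n * R"
      proof (rule pdist_le)
        fix t assume t: "t \<in> {0..T}"
        have "dist (path_scale (real (k n z) / 2^n) z t) (path_scale (a z) z t) = \<bar>real (k n z) / 2^n - a z\<bar> * cone_radius (z t)"
          unfolding path_scale_apply[OF t] by (rule dist_cone_scale_same[OF _ a0]) simp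
        also have "\<dots> \<le> (1/2)^n * R" using close R t by (intro mult_mono) auto
        finally show "dist (path_scale (real (k n z) / 2^n) z t) (path_scale (a z) z t) \<le> (1/2)^n * R" .
      qed (use R in simp)
      with elim show ?case by (auto intro: path_scale_in[OF _ z])
    qed
  qed
qed

lemma dyadic_energy_scale:
  assumes "0 < c" "z \<in> paths"
  shows "dyadic_energy T n (path_scale c z) = c\<^sup>2 * dyadic_energy T n z"
  unfolding dyadic_energy_def sum_distrib_left
proof (rule sum.cong[OF refl])
  fix i assume "i \<in> {..<2^n::nat}"
  then have i: "i < 2^n" by simp
  let ?a = "T * real i / 2^n" and ?b = "T * real (Suc i) / 2^n"
  have m: "?a \<in> {0..T}" "?b \<in> {0..T}"
    unfolding atLeastAtMost_iff using dyadic_points(1-3)[OF T i] by (meson order_trans)+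
  show "(dist (path_scale c z ?a) (path_scale c z ?b))\<^sup>2 * 2^n / T = c\<^sup>2 * ((dist (z ?a) (z ?b))\<^sup>2 * 2^n / T)"
    unfolding path_scale_apply[OF m(1)] path_scale_apply[OF m(2)] dist_cone_scale[OF assms(1)] power_mult_distrib
    by (simp only: mult.assoc times_divide_eq_right)
qed

lemma marginal_functional_scale:
  assumes "0 < c"
  shows "marginal_functional f (path_scale c z) = c\<^sup>2 * marginal_functional f z"
proof -
  have "marginal_functional f (path_scale c z) = (LINT t:{0..T}|lborel. c\<^sup>2 * (f (t, cone_base xbar (z t)) * (cone_radius (z t))\<^sup>2))"
    unfolding marginal_functional_def
  proof (rule set_lebesgue_integral_cong)
    show "\<forall>t. t \<in> {0..T} \<longrightarrow> f (t, cone_base xbar (path_scale c z t)) * (cone_radius (path_scale c z t))\<^sup>2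
      = c\<^sup>2 * (f (t, cone_base xbar (z t)) * (cone_radius (z t))\<^sup>2)"
      using assms by (simp add: power_mult_distrib)
  qed simp
  then show ?thesis by (simp add: marginal_functional_def)
qed

lemma path_size_scale:
  assumes "0 < c"
  shows "path_size (path_scale c z) = c\<^sup>2 * path_size z"
  unfolding path_size_def marginal_functional_scale[OF assms]
  using assms ends by (simp add: power_mult_distrib algebra_simps)

lemma homogeneous2_scale:
  assumes f: "homogeneous2 M f" and c: "0 < c" and pq: "p \<in> cone_over M" "q \<in> cone_over M"
  shows "f (cone_scale c p, cone_scale c q) = c\<^sup>2 * f (p, q)"
proof -
  have "p = cone_pt (cone_base xbar p) (cone_radius p)" "q = cone_pt (cone_base xbar q) (cone_radius q)" by simp_all
  then show ?thesis
    using f c pq unfolding homogeneous2_def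
    by (metis cone_base_in cone_radius_nonneg cone_scale_pt less_imp_le xbar)
qed

text \<open>The dilation that normalises \<open>path_size\<close>; paths of size \<open>0\<close> carry no mass after reweighting.\<close>

definition dilate :: "real \<Rightarrow> (real \<Rightarrow> 'a cone) measure \<Rightarrow> (real \<Rightarrow> 'a cone) measure" where
  "dilate \<kappa> \<mu> = distr (density \<mu> (\<lambda>z. path_size z / \<kappa>)) P.mborel (\<lambda>z. path_scale (sqrt (\<kappa> / path_size z)) z)"

lemma dilation_measurable [measurable]:
  assumes "0 < \<kappa>"
  shows "(\<lambda>z. path_scale (sqrt (\<kappa> / path_size z)) z) \<in> measurable P.mborel P.mborel"
  using assms path_size_nonneg by (intro path_scale_measurable_compose) auto

text \<open>The density \<open>path_size z / \<kappa>\<close> cancels the factor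
  \<open>\<kappa> / path_size z\<close> that 2-homogeneity produces. On paths of size zero the
  density vanishes, and so does \<open>F\<close> by the hypothesis \<open>zero\<close>.\<close>

lemma has_bochner_integral_dilate:
  assumes \<kappa>: "0 < \<kappa>" and s: "sets \<mu> = sets P.mborel"
    and F [measurable]: "F \<in> borel_measurable P.mborel"
    and hom: "\<And>c z. 0 < c \<Longrightarrow> z \<in> paths \<Longrightarrow> F (path_scale c z) = c\<^sup>2 * F z"
    and zero: "\<And>z. z \<in> paths \<Longrightarrow> path_size z = 0 \<Longrightarrow> F z = (0::real)"
    and int: "has_bochner_integral \<mu> F x"
  shows "has_bochner_integral (dilate \<kappa> \<mu>) F x"
proof -
  have sp: "space \<mu> = paths" using sets_eq_imp_space_eq[OF s] by simp
  note dm = dilation_measurable[OF \<kappa>]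
  have [measurable]: "(\<lambda>z. F (path_scale (sqrt (\<kappa> / path_size z)) z)) \<in> borel_measurable \<mu>"
    using measurable_compose[OF dm F] by (simp add: measurable_cong_sets[OF s refl])
  have [measurable]: "path_size \<in> borel_measurable \<mu>"
    using path_size_measurable by (simp add: measurable_cong_sets[OF s refl])
  show ?thesis
    unfolding dilate_def
  proof (rule has_bochner_integral_distr[OF F])
    show "(\<lambda>z. path_scale (sqrt (\<kappa> / path_size z)) z) \<in> measurable (density \<mu> (\<lambda>z. path_size z / \<kappa>)) P.mborel"
      using dm by (simp add: measurable_cong_sets[OF s refl])
    show "has_bochner_integral (density \<mu> (\<lambda>z. path_size z / \<kappa>)) (\<lambda>z. F (path_scale (sqrt (\<kappa> / path_size z)) z)) x"
    proof (rule has_bochner_integral_density)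
      show "has_bochner_integral \<mu> (\<lambda>z. (path_size z / \<kappa>) *\<^sub>R F (path_scale (sqrt (\<kappa> / path_size z)) z)) x"
      proof (rule has_bochner_integral_cong[THEN iffD1, OF refl _ refl int])
        fix z assume "z \<in> space \<mu>"
        then have z: "z \<in> paths" by (simp add: sp)
        show "F z = (path_size z / \<kappa>) *\<^sub>R F (path_scale (sqrt (\<kappa> / path_size z)) z)"
        proof (cases "path_size z = 0")
          case True
          then show ?thesis using zero[OF z] by simp
        next
          case False
          then have p: "0 < path_size z" using path_size_nonneg[of z] by linarith
          have "F (path_scale (sqrt (\<kappa> / path_size z)) z) = (sqrt (\<kappa> / path_size z))\<^sup>2 * F z"
            using \<kappa> p by (intro hom z) simp
          also have "(sqrt (\<kappa> / path_size z))\<^sup>2 = \<kappa> / path_size z" using \<kappa> p by simp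
          finally show ?thesis using \<kappa> p by simp
        qed
      qed
    qed (use \<kappa> path_size_nonneg in auto)
  qed
qed

lemma coupling_measurable:
  fixes f :: "'a cone \<times> 'a cone \<Rightarrow> real"
  assumes "continuous_on (cone_over M \<times> cone_over M) f"
  shows "(\<lambda>z. f (z 0, z T)) \<in> borel_measurable P.mborel"
  by (rule P.borel_measurable_mborel_sequential) (rule coupling_tendsto[OF assms])

lemma marginal_measurable:
  assumes "continuous_on ({0..T} \<times> M) f"
  shows "marginal_functional f \<in> borel_measurable P.mborel"
  by (rule P.borel_measurable_mborel_sequential) (rule marginal_functional_tendsto[OF assms])

lemma admissible_plansD:
  assumes "\<mu> \<in> admissible_plans xbar M T \<gamma>"
  shows "sets \<mu> = sets P.mborel" "space \<mu> = paths" "prob_space \<mu>"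
    "continuous_on (cone_over M \<times> cone_over M) f \<Longrightarrow> homogeneous2 M f \<Longrightarrow>
      has_bochner_integral \<mu> (\<lambda>z. f (z 0, z T)) (\<integral>p. f p \<partial>\<gamma>)"
    "continuous_on ({0..T} \<times> M) g \<Longrightarrow>
      has_bochner_integral \<mu> (marginal_functional g) (LINT x:M|normalized_lebesgue M. (LINT t:{0..T}|lborel. g (t, x)))"
proof -
  have *: "\<mu> \<in> dynamic_plans M T" "homogeneous_coupling M T \<gamma> \<mu>" "homogeneous_marginal xbar M T \<mu>"
    using assms by (auto simp: admissible_plans_def)
  show s: "sets \<mu> = sets P.mborel" and "prob_space \<mu>"
    using *(1) by (auto simp: dynamic_plans_def path_borel_eq)
  show "space \<mu> = paths" using sets_eq_imp_space_eq[OF s] by simp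
  show "continuous_on (cone_over M \<times> cone_over M) f \<Longrightarrow> homogeneous2 M f \<Longrightarrow>
      has_bochner_integral \<mu> (\<lambda>z. f (z 0, z T)) (\<integral>p. f p \<partial>\<gamma>)"
    using *(2) unfolding homogeneous_coupling_def by blast
  show "continuous_on ({0..T} \<times> M) g \<Longrightarrow>
      has_bochner_integral \<mu> (marginal_functional g) (LINT x:M|normalized_lebesgue M. (LINT t:{0..T}|lborel. g (t, x)))"
    using *(3) unfolding homogeneous_marginal_def marginal_functional_def[abs_def] by blast
qed

lemma admissible_plansI:
  assumes "sets \<mu> = sets P.mborel" "prob_space \<mu>"
    "\<And>f. continuous_on (cone_over M \<times> cone_over M) f \<Longrightarrow> homogeneous2 M f \<Longrightarrow>
      has_bochner_integral \<mu> (\<lambda>z. f (z 0, z T)) (\<integral>p. f p \<partial>\<gamma>)"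
    "\<And>g. continuous_on ({0..T} \<times> M) g \<Longrightarrow>
      has_bochner_integral \<mu> (marginal_functional g) (LINT x:M|normalized_lebesgue M. (LINT t:{0..T}|lborel. g (t, x)))"
  shows "\<mu> \<in> admissible_plans xbar M T \<gamma>"
  using assms unfolding admissible_plans_def dynamic_plans_def homogeneous_coupling_def homogeneous_marginal_def
    marginal_functional_def[abs_def] path_borel_eq by blast

lemma homogeneous2_radius_sq_sum: "homogeneous2 M (\<lambda>p. (cone_radius (fst p))\<^sup>2 + (cone_radius (snd p))\<^sup>2)"
  unfolding homogeneous2_def by (simp add: power_mult_distrib algebra_simps)

text \<open>The common mean of \<open>path_size\<close> under all admissible plans, read off from
  the constraint with the constant 1 and the coupling with the sum of squared radii.\<close>

definition total_size :: "('a cone \<times> 'a cone) measure \<Rightarrow> real" where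
  "total_size \<gamma> = (LINT x:M|normalized_lebesgue M. (LINT t:{0..T}|lborel. 1))
    + (\<integral>p. (cone_radius (fst p))\<^sup>2 + (cone_radius (snd p))\<^sup>2 \<partial>\<gamma>)"

lemma has_bochner_integral_path_size:
  assumes "\<mu> \<in> admissible_plans xbar M T \<gamma>"
  shows "has_bochner_integral \<mu> path_size (total_size \<gamma>)"
  unfolding path_size_def[abs_def] total_size_def
  using has_bochner_integral_add[OF admissible_plansD(5)[OF assms, of "\<lambda>_. 1"]
      admissible_plansD(4)[OF assms radius_sq_sum_continuous homogeneous2_radius_sq_sum]]
  by simp

text \<open>The reweighted measure is a probability because \<open>path_size\<close> has mean
  \<open>total_size \<gamma>\<close>. Dyadic energies are 2-homogeneous, so weighted energies are
  preserved where the size is positive; where it vanishes the weight is zero and the inequality for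
  the action is trivial.\<close>

lemma dilate_admissible:
  assumes \<mu>: "\<mu> \<in> admissible_plans xbar M T \<gamma>" and \<kappa>: "0 < total_size \<gamma>"
  defines "\<mu>' \<equiv> dilate (total_size \<gamma>) \<mu>"
  shows "\<mu>' \<in> admissible_plans xbar M T \<gamma>" "AE z in \<mu>'. path_size z = total_size \<gamma>"
    "action xbar T \<mu>' \<le> action xbar T \<mu>"
proof -
  let ?\<kappa> = "total_size \<gamma>"
  let ?D = "density \<mu> (\<lambda>z. path_size z / ?\<kappa>)"
  let ?S = "\<lambda>z. path_scale (sqrt (?\<kappa> / path_size z)) z"
  note s = admissible_plansD(1)[OF \<mu>] and sp = admissible_plansD(2)[OF \<mu>]
  have dm: "?S \<in> measurable ?D P.mborel"
    using dilation_measurable[OF \<kappa>] by (simp add: measurable_cong_sets[OF s refl])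
  have pm [measurable]: "path_size \<in> borel_measurable \<mu>"
    using path_size_measurable by (simp add: measurable_cong_sets[OF s refl])
  have int: "has_bochner_integral \<mu> path_size ?\<kappa>" by (rule has_bochner_integral_path_size[OF \<mu>])
  have scaled: "path_size (?S z) = ?\<kappa>" if "path_size z \<noteq> 0" for z
  proof -
    have p: "0 < path_size z" using path_size_nonneg[of z] that by linarith
    then have "path_size (?S z) = (sqrt (?\<kappa> / path_size z))\<^sup>2 * path_size z"
      using \<kappa> by (intro path_size_scale) simp
    also have "\<dots> = ?\<kappa>" using \<kappa> p by simp
    finally show ?thesis .
  qed
  have prob: "prob_space \<mu>'"
    unfolding \<mu>'_def dilate_def
  proof (rule prob_space.prob_space_distr[OF _ dm])
    show "prob_space ?D"
    proof (rule prob_spaceI)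
      have "emeasure ?D (space ?D) = (\<integral>\<^sup>+z. ennreal (path_size z / ?\<kappa>) \<partial>\<mu>)"
        by (simp add: emeasure_density)
      also have "\<dots> = ennreal (\<integral>z. path_size z / ?\<kappa> \<partial>\<mu>)"
        using int \<kappa> path_size_nonneg by (intro nn_integral_eq_integral) (auto simp: has_bochner_integral_iff)
      also have "\<dots> = 1" using int \<kappa> by (simp add: has_bochner_integral_iff)
      finally show "emeasure ?D (space ?D) = 1" .
    qed
  qed
  show adm: "\<mu>' \<in> admissible_plans xbar M T \<gamma>"
  proof (rule admissible_plansI[OF _ prob])
    show "sets \<mu>' = sets P.mborel" by (simp add: \<mu>'_def dilate_def)
    fix f :: "'a cone \<times> 'a cone \<Rightarrow> real"
    assume f: "continuous_on (cone_over M \<times> cone_over M) f" and h: "homogeneous2 M f"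
    show "has_bochner_integral \<mu>' (\<lambda>z. f (z 0, z T)) (\<integral>p. f p \<partial>\<gamma>)"
      unfolding \<mu>'_def
    proof (rule has_bochner_integral_dilate[OF \<kappa> s coupling_measurable[OF f]])
      show "f (path_scale c z 0, path_scale c z T) = c\<^sup>2 * f (z 0, z T)" if "0 < c" "z \<in> paths" for c z
        unfolding path_scale_apply[OF ends(1)] path_scale_apply[OF ends(2)]
        by (rule homogeneous2_scale[OF h that(1) pathD(1)[OF that(2) ends(1)] pathD(1)[OF that(2) ends(2)]])
      show "f (z 0, z T) = 0" if z: "z \<in> paths" and 0: "path_size z = 0" for z
      proof -
        have "cone_radius (z 0) = 0" "cone_radius (z T) = 0"
          using path_size_ge(2,3)[of z] 0 by simp_all
        \<comment> \<open>Both endpoints are the apex, a fixed point of dilation by 2, so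
          homogeneity gives \<open>f = 4 * f\<close> and hence \<open>f = 0\<close>.\<close>
        then have "cone_scale 2 (z 0) = z 0" "cone_scale 2 (z T) = z T"
          by (metis cone_pt_base_radius cone_scale_def mult_zero_right)+
        then have "f (z 0, z T) = 2\<^sup>2 * f (z 0, z T)"
          using homogeneous2_scale[OF h _ pathD(1)[OF z ends(1)] pathD(1)[OF z ends(2)], of 2] by simp
        then show ?thesis by simp
      qed
      show "has_bochner_integral \<mu> (\<lambda>z. f (z 0, z T)) (\<integral>p. f p \<partial>\<gamma>)"
        by (rule admissible_plansD(4)[OF \<mu> f h])
    qed
  next
    fix g :: "real \<times> 'a \<Rightarrow> real" assume g: "continuous_on ({0..T} \<times> M) g"
    obtain B where B: "0 \<le> B" "\<forall>t\<in>{0..T}. \<forall>x\<in>M. \<bar>g (t, x)\<bar> \<le> B" using continuous_function_bounded[OF g] .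
    show "has_bochner_integral \<mu>' (marginal_functional g) (LINT x:M|normalized_lebesgue M. (LINT t:{0..T}|lborel. g (t, x)))"
      unfolding \<mu>'_def
    proof (rule has_bochner_integral_dilate[OF \<kappa> s marginal_measurable[OF g]])
      show "marginal_functional g z = 0" if z: "z \<in> paths" and 0: "path_size z = 0" for z
      proof -
        have "marginal_functional (\<lambda>_. 1) z = 0"
          using path_size_ge(1)[of z] marginal_functional_one_nonneg[of z] 0 by linarith
        then show ?thesis using marginal_functional_bound[OF g z B(2)] by simp
      qed
    qed (use marginal_functional_scale admissible_plansD(5)[OF \<mu> g] in auto)
  qed
  have AE: "AE z in ?D. path_size z \<noteq> 0"
    by (subst AE_density) auto
  show "AE z in \<mu>'. path_size z = ?\<kappa>"
    unfolding \<mu>'_def dilate_def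
  proof (subst AE_distr_iff[OF dm])
    show "{z \<in> space P.mborel. path_size z = ?\<kappa>} \<in> sets P.mborel" by measurable
    show "AE z in ?D. path_size (?S z) = ?\<kappa>" using AE by eventually_elim (rule scaled)
  qed
  have em: "energy \<in> borel_measurable \<mu>"
    using energy_measurable by (simp add: measurable_cong_sets[OF s refl])
  have "action xbar T \<mu>' = (\<integral>\<^sup>+z. energy z \<partial>\<mu>')"
    by (rule action_eq[OF admissible_plansD(2)[OF adm]])
  also have "\<dots> = (\<integral>\<^sup>+z. energy (?S z) \<partial>?D)"
    unfolding \<mu>'_def dilate_def by (rule nn_integral_distr[OF dm]) measurable
  also have "\<dots> = (\<integral>\<^sup>+z. ennreal (path_size z / ?\<kappa>) * energy (?S z) \<partial>\<mu>)"
  proof (rule nn_integral_density)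
    show "(\<lambda>z. energy (?S z)) \<in> borel_measurable \<mu>"
      using measurable_compose[OF dilation_measurable[OF \<kappa>] energy_measurable]
      by (simp add: measurable_cong_sets[OF s refl])
  qed measurable
  also have "\<dots> \<le> (\<integral>\<^sup>+z. energy z \<partial>\<mu>)"
  proof (rule nn_integral_mono)
    fix z assume "z \<in> space \<mu>"
    then have z: "z \<in> paths" by (simp add: sp)
    show "ennreal (path_size z / ?\<kappa>) * energy (?S z) \<le> energy z"
    proof (cases "path_size z = 0")
      case False
      then have p: "0 < path_size z" using path_size_nonneg[of z] by linarith
      have "ennreal (path_size z / ?\<kappa>) * energy (?S z) = (SUP n. ennreal (path_size z / ?\<kappa>) * ennreal (dyadic_energy T n (?S z)))"
        unfolding energy_def by (rule SUP_mult_left_ennreal)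
      also have "\<dots> \<le> energy z"
      proof (rule SUP_least)
        fix n
        have "dyadic_energy T n (?S z) = (sqrt (?\<kappa> / path_size z))\<^sup>2 * dyadic_energy T n z"
          using \<kappa> p by (intro dyadic_energy_scale z) simp
        also have "(sqrt (?\<kappa> / path_size z))\<^sup>2 = ?\<kappa> / path_size z" using \<kappa> p by simp
        finally have "path_size z / ?\<kappa> * dyadic_energy T n (?S z) = dyadic_energy T n z"
          using \<kappa> p by simp
        then have "ennreal (path_size z / ?\<kappa>) * ennreal (dyadic_energy T n (?S z)) = ennreal (dyadic_energy T n z)"
          using \<kappa> p dyadic_energy_nonneg[OF T] by (subst ennreal_mult[symmetric]) (auto simp del: times_divide_eq_left)
        also have "\<dots> \<le> energy z" unfolding energy_def by (rule SUP_upper) simp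
        finally show "ennreal (path_size z / ?\<kappa>) * ennreal (dyadic_energy T n (?S z)) \<le> energy z" .
      qed
      finally show ?thesis .
    qed simp
  qed
  also have "\<dots> = action xbar T \<mu>" by (rule action_eq[OF sp, symmetric])
  finally show "action xbar T \<mu>' \<le> action xbar T \<mu>" .
qed

end

section \<open>Existence of minimizers\<close>

context cone_paths
begin

lemma path_holder:
  assumes z: "z \<in> paths" and m: "0 \<le> m" and E: "\<And>n. dyadic_energy T n z \<le> m"
    and st: "s \<in> {0..T}" "t \<in> {0..T}"
  shows "dist (z s) (z t) \<le> sqrt (m * \<bar>s - t\<bar>)"
proof -
  have A: "path_action xbar T z \<le> ennreal m"
    unfolding path_action_paths[OF z] by (intro SUP_least ennreal_leI E)
  note le = dist_sq_le_path_action[OF T compact_imp_bounded[OF M] xbar path_all[OF z] A m]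
  show ?thesis
  proof (cases "s \<le> t")
    case True
    have "(dist (z s) (z t))\<^sup>2 \<le> m * (t - s)" using le[of s t] st True by simp
    then show ?thesis using True by (simp add: real_le_rsqrt)
  next
    case False
    have "(dist (z t) (z s))\<^sup>2 \<le> m * (s - t)" using le[of t s] st False by simp
    then show ?thesis using False by (simp add: real_le_rsqrt dist_commute)
  qed
qed

text \<open>Arzela-Ascoli is applied to the Euclidean curves \<open>F n = (r, r x)\<close>: the
  initial radius is at most \<open>sqrt \<kappa>\<close>, and the Hoelder estimate bounds both the
  later radii and the modulus of continuity. Uniform closeness of two such curves is carried back to
  the paths by \<open>dist_cone_le_vec\<close>, which gives a Cauchy subsequence.\<close>

lemma totally_bounded_paths:
  assumes m: "0 \<le> m"
  shows "P.mtotally_bounded {z \<in> paths. path_size z \<le> \<kappa> \<and> (\<forall>n. dyadic_energy T n z \<le> m)}"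
  unfolding P.mtotally_bounded_sequentially
proof (intro conjI allI impI)
  fix \<sigma> :: "nat \<Rightarrow> real \<Rightarrow> 'a cone"
  assume "range \<sigma> \<subseteq> {z \<in> paths. path_size z \<le> \<kappa> \<and> (\<forall>n. dyadic_energy T n z \<le> m)}"
  then have \<sigma>: "\<sigma> n \<in> paths" "path_size (\<sigma> n) \<le> \<kappa>" "dyadic_energy T k (\<sigma> n) \<le> m" for n k
    by (auto simp: image_subset_iff)
  obtain L where L: "\<And>x. x \<in> M \<Longrightarrow> norm x \<le> L" using compact_imp_bounded[OF M] by (auto simp: bounded_iff)
  have L0: "0 \<le> L" using L[OF xbar] norm_ge_zero order_trans by blast
  have base: "norm (cone_base xbar (\<sigma> n t)) \<le> L" if "t \<in> {0..T}" for n t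
    by (intro L cone_base_in[OF pathD(1)[OF \<sigma>(1) that] xbar])
  have hold: "dist (\<sigma> n s) (\<sigma> n t) \<le> sqrt (m * \<bar>s - t\<bar>)" if "s \<in> {0..T}" "t \<in> {0..T}" for n s t
    by (rule path_holder[OF \<sigma>(1) m \<sigma>(3) that])
  define R where "R = sqrt \<kappa> + sqrt (m * T)"
  have rad: "cone_radius (\<sigma> n t) \<le> R" if t: "t \<in> {0..T}" for n t
  proof -
    have "(cone_radius (\<sigma> n 0))\<^sup>2 \<le> \<kappa>" using path_size_ge(2)[of "\<sigma> n"] \<sigma>(2)[of n] by linarith
    then have "cone_radius (\<sigma> n 0) \<le> sqrt \<kappa>" by (rule real_le_rsqrt)
    moreover have "dist (\<sigma> n t) (\<sigma> n 0) \<le> sqrt (m * T)"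
      by (rule order.trans[OF hold[OF t ends(1)]]) (use t m in \<open>auto intro!: mult_left_mono\<close>)
    ultimately show ?thesis using cone_radius_lipschitz[of "\<sigma> n t" "\<sigma> n 0"] unfolding R_def by linarith
  qed
  define F where "F n t = (cone_radius (\<sigma> n t), cone_vec xbar (\<sigma> n t))" for n t
  have FB: "norm (F n t) \<le> R + R * L" if t: "t \<in> {0..T}" for n t
  proof -
    have "norm (F n t) \<le> norm (cone_radius (\<sigma> n t)) + norm (cone_vec xbar (\<sigma> n t))"
      unfolding F_def by (rule norm_Pair_le)
    also have "\<dots> = cone_radius (\<sigma> n t) + cone_radius (\<sigma> n t) * norm (cone_base xbar (\<sigma> n t))"
      by (simp add: cone_vec_def)
    also have "\<dots> \<le> R + R * L"
      using rad[OF t] order_trans[OF cone_radius_nonneg rad[OF t]] base[OF t]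
      by (intro add_mono mult_mono) auto
    finally show ?thesis .
  qed
  define C where "C = 5 + 5 * L"
  have C: "0 < C" using L0 by (simp add: C_def)
  have FL: "norm (F n s - F n t) \<le> C * sqrt (m * \<bar>s - t\<bar>)" if st: "s \<in> {0..T}" "t \<in> {0..T}" for n s t
  proof -
    have "norm (F n s - F n t) \<le> norm (cone_radius (\<sigma> n s) - cone_radius (\<sigma> n t)) + norm (cone_vec xbar (\<sigma> n s) - cone_vec xbar (\<sigma> n t))"
      unfolding F_def diff_Pair by (rule norm_Pair_le)
    also have "\<dots> \<le> dist (\<sigma> n s) (\<sigma> n t) + (4 + 5 * L) * dist (\<sigma> n s) (\<sigma> n t)"
      using cone_radius_lipschitz cone_vec_lipschitz[OF base[OF st(1)] base[OF st(2)]]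
      by (intro add_mono) auto
    also have "\<dots> = C * dist (\<sigma> n s) (\<sigma> n t)" by (simp add: C_def algebra_simps)
    also have "\<dots> \<le> C * sqrt (m * \<bar>s - t\<bar>)" using hold[OF st] C by (intro mult_left_mono) auto
    finally show ?thesis .
  qed
  have equi: "\<exists>d. 0 < d \<and> (\<forall>n t. t \<in> {0..T} \<and> norm (s - t) < d \<longrightarrow> norm (F n s - F n t) < e)"
    if s: "s \<in> {0..T}" and e: "0 < e" for s e
  proof (intro exI conjI allI impI)
    \<comment> \<open>Obtained by solving \<open>C * sqrt (m * \<bar>s - t\<bar>) < e\<close> for
      the time difference; \<open>m + 1\<close> keeps the quotient meaningful for
      \<open>m = 0\<close>.\<close>
    show "0 < (e / C)\<^sup>2 / (m + 1)" using e C m by simp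
    fix n t assume t: "t \<in> {0..T} \<and> norm (s - t) < (e / C)\<^sup>2 / (m + 1)"
    have "m * \<bar>s - t\<bar> \<le> (m + 1) * \<bar>s - t\<bar>" by (intro mult_right_mono) auto
    also have "\<dots> < (e / C)\<^sup>2"
      using t m by (simp add: pos_less_divide_eq mult.commute)
    finally have "sqrt (m * \<bar>s - t\<bar>) < e / C"
      using e C by (intro real_less_lsqrt) auto
    then have "C * sqrt (m * \<bar>s - t\<bar>) < e" using C by (simp add: pos_less_divide_eq mult.commute)
    with FL[OF s, of t n] t show "norm (F n s - F n t) < e" by linarith
  qed
  have "\<exists>g k. strict_mono (k :: nat \<Rightarrow> nat) \<and> (\<forall>e>0. \<exists>N. \<forall>n x. n \<ge> N \<and> x \<in> {0..T} \<longrightarrow> norm (F (k n) x - g x) < e)"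
  proof (rule Arzela_Ascoli[OF compact_Icc FB equi])
    fix g and k :: "nat \<Rightarrow> nat"
    assume k: "strict_mono k"
      and u: "\<And>e. 0 < e \<Longrightarrow> \<exists>N. \<forall>n x. n \<ge> N \<and> x \<in> {0..T} \<longrightarrow> norm (F (k n) x - g x) < e"
    show ?thesis by (rule exI[of _ g], rule exI[of _ k], rule conjI[OF k], intro allI impI, rule u)
  qed
  then obtain g k where k: "strict_mono (k :: nat \<Rightarrow> nat)"
    and unif: "\<forall>e>0. \<exists>N. \<forall>n x. n \<ge> N \<and> x \<in> {0..T} \<longrightarrow> norm (F (k n) x - g x) < e"
    by (elim exE conjE)
  show "\<exists>r. strict_mono r \<and> P.MCauchy (\<sigma> \<circ> r)"
  proof (intro exI[of _ k] conjI k)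
    show "P.MCauchy (\<sigma> \<circ> k)"
      unfolding P.MCauchy_def
    proof (intro conjI allI impI)
      show "range (\<sigma> \<circ> k) \<subseteq> paths" using \<sigma>(1) by auto
      fix e :: real assume e: "0 < e"
      \<comment> \<open>The sum \<open>(3 + 6 * L) + 2\<close> of the two weights in
        \<open>dist_cone_le_vec\<close>. Two curves within \<open>\<delta>\<close> of
        \<open>g\<close> differ by at most \<open>2 * \<delta>\<close>, and
        \<open>D * (2 * \<delta>) = e / 2\<close>.\<close>
      define D where "D = 5 + 6 * L"
      have D: "0 < D" using L0 by (simp add: D_def)
      define \<delta> where "\<delta> = e / (4 * D)"
      have \<delta>: "0 < \<delta>" using e D by (simp add: \<delta>_def)
      obtain N where N: "\<forall>n x. n \<ge> N \<and> x \<in> {0..T} \<longrightarrow> norm (F (k n) x - g x) < \<delta>"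
        using unif \<delta> by blast
      have "pdist ((\<sigma> \<circ> k) n) ((\<sigma> \<circ> k) n') < e" if n: "N \<le> n" "N \<le> n'" for n n'
      proof -
        have "pdist ((\<sigma> \<circ> k) n) ((\<sigma> \<circ> k) n') \<le> e / 2"
        proof (rule pdist_le)
          fix t assume t: "t \<in> {0..T}"
          have "norm (F (k n) t - F (k n') t) \<le> norm (F (k n) t - g t) + norm (F (k n') t - g t)"
            using norm_triangle_ineq4[of "F (k n) t - g t" "F (k n') t - g t"] by simp
          moreover have "norm (F (k n) t - g t) < \<delta>" "norm (F (k n') t - g t) < \<delta>" using N n t by blast+
          ultimately have nF: "norm (F (k n) t - F (k n') t) \<le> 2 * \<delta>" by linarith
          have "norm (cone_radius (\<sigma> (k n) t) - cone_radius (\<sigma> (k n') t)) \<le> norm (F (k n) t - F (k n') t)"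
            "norm (cone_vec xbar (\<sigma> (k n) t) - cone_vec xbar (\<sigma> (k n') t)) \<le> norm (F (k n) t - F (k n') t)"
            unfolding F_def diff_Pair by (rule norm_fst_le, rule norm_snd_le)
          with nF have "norm (cone_radius (\<sigma> (k n) t) - cone_radius (\<sigma> (k n') t)) \<le> 2 * \<delta>"
            "norm (cone_vec xbar (\<sigma> (k n) t) - cone_vec xbar (\<sigma> (k n') t)) \<le> 2 * \<delta>" by linarith+
          then have "(3 + 6 * L) * \<bar>cone_radius (\<sigma> (k n) t) - cone_radius (\<sigma> (k n') t)\<bar>
             + 2 * norm (cone_vec xbar (\<sigma> (k n) t) - cone_vec xbar (\<sigma> (k n') t)) \<le> (3 + 6 * L) * (2 * \<delta>) + 2 * (2 * \<delta>)"
            using L0 by (intro add_mono mult_left_mono) auto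
          also have "\<dots> = D * (2 * \<delta>)" by (simp add: D_def algebra_simps)
          also have "\<dots> = e / 2" using D by (simp add: \<delta>_def)
          finally show "dist ((\<sigma> \<circ> k) n t) ((\<sigma> \<circ> k) n' t) \<le> e / 2"
            using dist_cone_le_vec[OF base[OF t, of "k n"] base[OF t, of "k n'"]] by simp
        qed (use e in simp)
        with e show ?thesis by linarith
      qed
      then show "\<exists>N. \<forall>n n'. N \<le> n \<longrightarrow> N \<le> n' \<longrightarrow> pdist ((\<sigma> \<circ> k) n) ((\<sigma> \<circ> k) n') < e" by blast
    qed
  qed
qed auto

lemma sublevel_measurable:
  "{z \<in> paths. path_size z \<le> \<kappa> \<and> (\<forall>n. dyadic_energy T n z \<le> m)} \<in> sets P.mborel"
proof -
  have "{z \<in> space P.mborel. path_size z \<le> \<kappa> \<and> (\<forall>n. dyadic_energy T n z \<le> m)} \<in> sets P.mborel" by measurable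
  then show ?thesis by simp
qed

text \<open>Markov's inequality at the threshold \<open>C * 2^j\<close> for an energy of mean at
  most \<open>C\<close>; the size condition holds almost surely.\<close>

lemma sublevel_measure_ge:
  assumes s: "sets \<mu> = sets P.mborel" and pr: "prob_space \<mu>"
    and size: "AE z in \<mu>. path_size z = \<kappa>" and act: "action xbar T \<mu> \<le> ennreal C" and C: "0 < C"
  shows "measure \<mu> {z \<in> paths. path_size z \<le> \<kappa> \<and> (\<forall>n. dyadic_energy T n z \<le> C * 2^j)} \<ge> 1 - (1/2)^j"
proof -
  interpret prob_space \<mu> by (rule pr)
  let ?K = "{z \<in> paths. path_size z \<le> \<kappa> \<and> (\<forall>n. dyadic_energy T n z \<le> C * 2^j)}"
  have sp: "space \<mu> = paths" using sets_eq_imp_space_eq[OF s] by simp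
  have Ks: "?K \<in> sets \<mu>" unfolding s by (rule sublevel_measurable)
  have em [measurable]: "energy \<in> borel_measurable \<mu>"
    using energy_measurable by (simp add: measurable_cong_sets[OF s refl])
  define c where "c = ennreal (1 / (C * 2^j))"
  let ?B = "{z \<in> space \<mu>. 1 \<le> c * energy z}"
  have Bs: "?B \<in> sets \<mu>" by measurable
  have "emeasure \<mu> (space \<mu> - ?K) \<le> emeasure \<mu> ?B"
  proof (rule emeasure_mono_AE[OF _ Bs])
    show "AE z in \<mu>. z \<in> space \<mu> - ?K \<longrightarrow> z \<in> ?B"
      using size
    proof eventually_elim
      case (elim z)
      show ?case
      proof
        assume "z \<in> space \<mu> - ?K"
        with elim obtain n where z: "z \<in> space \<mu>" and n: "C * 2^j < dyadic_energy T n z" by (auto simp: sp not_le)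
        have "1 = ennreal (1 / (C * 2^j) * (C * 2^j))" using C by simp
        also have "\<dots> = c * ennreal (C * 2^j)" unfolding c_def using C by (intro ennreal_mult) auto
        also have "\<dots> \<le> c * energy z"
        proof (rule mult_left_mono)
          have "ennreal (C * 2^j) \<le> ennreal (dyadic_energy T n z)" using n by (intro ennreal_leI) simp
          also have "\<dots> \<le> energy z" unfolding energy_def by (rule SUP_upper) simp
          finally show "ennreal (C * 2^j) \<le> energy z" .
        qed simp
        finally show "z \<in> ?B" using z by simp
      qed
    qed
  qed
  also have "\<dots> \<le> c * (\<integral>\<^sup>+z. energy z * indicator (space \<mu>) z \<partial>\<mu>)"
    by (rule nn_integral_Markov_inequality) measurable
  also have "(\<integral>\<^sup>+z. energy z * indicator (space \<mu>) z \<partial>\<mu>) = action xbar T \<mu>"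
    unfolding action_eq[OF sp] by (rule nn_integral_cong) simp
  also have "c * action xbar T \<mu> \<le> c * ennreal C" using act by (rule mult_left_mono) simp
  also have "\<dots> = ennreal (1 / (C * 2^j) * C)" unfolding c_def using C by (intro ennreal_mult[symmetric]) auto
  also have "1 / (C * 2^j) * C = (1/2)^j" using C by (simp add: power_one_over)
  finally have "measure \<mu> (space \<mu> - ?K) \<le> (1/2)^j" by (simp add: emeasure_eq_measure)
  then show ?thesis using prob_compl[OF Ks] by simp
qed

text \<open>Positivity of \<open>total_size \<gamma>\<close> is what allows every plan of the
  minimising sequence to be dilated to constant size.\<close>

theorem minimizer_exists:
  assumes \<kappa>: "0 < total_size \<gamma>"
    and fin: "\<exists>\<mu>\<in>admissible_plans xbar M T \<gamma>. action xbar T \<mu> < \<infinity>"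
  shows "\<exists>\<mu>\<in>admissible_plans xbar M T \<gamma>. \<forall>\<nu>\<in>admissible_plans xbar M T \<gamma>. action xbar T \<mu> \<le> action xbar T \<nu>"
proof -
  let ?A = "admissible_plans xbar M T \<gamma>" and ?\<kappa> = "total_size \<gamma>"
  define I where "I = (INF \<mu>\<in>?A. action xbar T \<mu>)"
  have I: "I < \<infinity>" unfolding I_def using fin by (simp add: INF_less_iff)
  have "\<exists>\<mu>\<in>?A. (AE z in \<mu>. path_size z = ?\<kappa>) \<and> action xbar T \<mu> \<le> I + ennreal (1 / real (Suc n))" for n
  proof -
    \<comment> \<open>Since \<open>I\<close> is finite, adding a positive number gives a strictly
      larger bound, which some admissible plan beats.\<close>
    obtain i where i: "I = ennreal i" "0 \<le> i" using I by (cases I) auto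
    have "ennreal i < ennreal (i + 1 / real (Suc n))" using i(2) by (intro ennreal_lessI) (auto simp: add_nonneg_pos)
    also have "\<dots> = I + ennreal (1 / real (Suc n))" unfolding i(1) by (rule ennreal_plus[OF i(2)]) simp
    finally have "I < I + ennreal (1 / real (Suc n))" unfolding i(1) .
    then obtain \<mu> where \<mu>: "\<mu> \<in> ?A" "action xbar T \<mu> < I + ennreal (1 / real (Suc n))"
      unfolding I_def by (auto simp: INF_less_iff)
    note d = dilate_admissible[OF \<mu>(1) \<kappa>]
    have "action xbar T (dilate ?\<kappa> \<mu>) \<le> I + ennreal (1 / real (Suc n))"
      using order.trans[OF d(3) less_imp_le[OF \<mu>(2)]] .
    with d(1,2) show ?thesis by blast
  qed
  then obtain \<mu> where "\<forall>n. \<mu> n \<in> ?A \<and> (AE z in \<mu> n. path_size z = ?\<kappa>) \<and> action xbar T (\<mu> n) \<le> I + ennreal (1 / real (Suc n))"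
    by metis
  then have \<mu>: "\<mu> n \<in> ?A" and size: "AE z in \<mu> n. path_size z = ?\<kappa>"
    and act: "action xbar T (\<mu> n) \<le> I + ennreal (1 / real (Suc n))" for n by blast+
  \<comment> \<open>A common bound for all actions in the sequence, as
    \<open>1 / real (Suc n)\<close> is at most 1.\<close>
  define C where "C = enn2real I + 1"
  have C: "0 < C" unfolding C_def by (simp add: add_nonneg_pos)
  have IC: "I + 1 = ennreal C" unfolding C_def using I by (simp add: ennreal_plus)
  have act1: "action xbar T (\<mu> n) \<le> ennreal C" for n
  proof -
    have "ennreal (1 / real (Suc n)) \<le> 1" by simp
    then have "I + ennreal (1 / real (Suc n)) \<le> I + 1" by (rule add_left_mono)
    with act[of n] show ?thesis unfolding IC by (rule order.trans)
  qed
  define K where "K j = {z \<in> paths. path_size z \<le> ?\<kappa> \<and> (\<forall>n. dyadic_energy T n z \<le> C * 2^j)}" for j :: nat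
  have Km: "K j \<in> sets P.mborel" for j unfolding K_def by (rule sublevel_measurable)
  have Kt: "P.mtotally_bounded (K j)" for j unfolding K_def using C by (intro totally_bounded_paths) simp
  have Kg: "1 - (1/2)^j \<le> measure (\<mu> n) (K j)" for n j
    unfolding K_def
    by (rule sublevel_measure_ge[OF admissible_plansD(1)[OF \<mu>] admissible_plansD(3)[OF \<mu>] size act1 C])
  obtain s Q Z Z' where s: "strict_mono (s :: nat \<Rightarrow> nat)" and Q: "prob_space (Q :: real measure)"
    and Zm: "\<forall>n. Z n \<in> measurable Q P.mborel" and Z'm: "Z' \<in> measurable Q P.mborel"
    and Zd: "\<forall>n. distr Q P.mborel (Z n) = \<mu> (s n)"
    and lim: "AE u in Q. limitin P.mtopology (\<lambda>n. Z n u) (Z' u) sequentially"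
    by (rule P.Skorohod_tight[where \<mu>=\<mu> and K=K, OF mcomplete_paths
          admissible_plansD(3)[OF \<mu>] admissible_plansD(1)[OF \<mu>] Km Kt Kg])
  interpret Q: prob_space Q by (rule Q)
  have Zm: "Z n \<in> measurable Q P.mborel" and Zd: "distr Q P.mborel (Z n) = \<mu> (s n)" for n
    using Zm Zd by blast+
  have Zp: "Z n u \<in> paths" if "u \<in> space Q" for n u using measurable_space[OF Zm that] by simp
  have "AE u in Q. path_size (Z n u) = ?\<kappa>" for n
  proof -
    have "AE z in distr Q P.mborel (Z n). path_size z = ?\<kappa>" unfolding Zd by (rule size)
    then show ?thesis by (rule AE_distrD[OF Zm])
  qed
  then have sizeZ: "AE u in Q. \<forall>n. path_size (Z n u) = ?\<kappa>" by (simp add: AE_all_countable)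
  define \<mu>' where "\<mu>' = distr Q P.mborel Z'"
  \<comment> \<open>The common passage to the limit for both constraints: the paths
    \<open>Z n u\<close> almost surely have size \<open>?\<kappa>\<close>, so the values of
    \<open>F\<close> are bounded by \<open>B\<close>, and the integrals equal the same number
    \<open>x\<close> for every \<open>n\<close>.\<close>
  have limit: "has_bochner_integral \<mu>' F x"
    if F: "\<And>\<sigma> l. range \<sigma> \<subseteq> paths \<Longrightarrow> limitin P.mtopology \<sigma> l sequentially \<Longrightarrow> (\<lambda>n. F (\<sigma> n)) \<longlonglongrightarrow> F l"
      and B: "\<And>z. z \<in> paths \<Longrightarrow> path_size z = ?\<kappa> \<Longrightarrow> \<bar>F z\<bar> \<le> B"
      and int: "\<And>n. has_bochner_integral (\<mu> n) F x" for F :: "_ \<Rightarrow> real" and x B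
  proof -
    have Fm: "F \<in> borel_measurable P.mborel" by (rule P.borel_measurable_mborel_sequential) (rule F)
    have FZm: "(\<lambda>u. F (Z n u)) \<in> borel_measurable Q" for n by (rule measurable_compose[OF Zm Fm])
    have FZ'm: "(\<lambda>u. F (Z' u)) \<in> borel_measurable Q" by (rule measurable_compose[OF Z'm Fm])
    have ptw: "AE u in Q. (\<lambda>n. F (Z n u)) \<longlonglongrightarrow> F (Z' u)"
      using lim AE_space
    proof eventually_elim
      case (elim u)
      show ?case by (rule F[OF _ elim(1)]) (use Zp[OF elim(2)] in auto)
    qed
    have dom: "AE u in Q. norm (F (Z n u)) \<le> B" for n
      using sizeZ AE_space by eventually_elim (use B Zp in auto)
    have bi: "integrable Q (\<lambda>u. B)" by simp
    have int': "integrable Q (\<lambda>u. F (Z' u))"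
      by (rule integrable_dominated_convergence[OF FZ'm FZm bi ptw dom])
    have conv: "(\<lambda>n. \<integral>u. F (Z n u) \<partial>Q) \<longlonglongrightarrow> (\<integral>u. F (Z' u) \<partial>Q)"
      by (rule integral_dominated_convergence[OF FZ'm FZm bi ptw dom])
    have "(\<integral>u. F (Z n u) \<partial>Q) = x" for n
    proof -
      have "(\<integral>u. F (Z n u) \<partial>Q) = (\<integral>z. F z \<partial>distr Q P.mborel (Z n))"
        by (rule integral_distr[OF Zm Fm, symmetric])
      also have "\<dots> = x" unfolding Zd using int by (rule has_bochner_integral_integral_eq)
      finally show ?thesis .
    qed
    with conv have "(\<integral>u. F (Z' u) \<partial>Q) = x" by (simp add: LIMSEQ_const_iff)
    with int' have "has_bochner_integral Q (\<lambda>u. F (Z' u)) x" by (simp add: has_bochner_integral_iff)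
    then show ?thesis unfolding \<mu>'_def by (rule has_bochner_integral_distr[OF Fm Z'm])
  qed
  have adm: "\<mu>' \<in> ?A"
  proof (rule admissible_plansI)
    show "sets \<mu>' = sets P.mborel" by (simp add: \<mu>'_def)
    show "prob_space \<mu>'" unfolding \<mu>'_def by (rule Q.prob_space_distr[OF Z'm])
  next
    fix f :: "'a cone \<times> 'a cone \<Rightarrow> real"
    assume f: "continuous_on (cone_over M \<times> cone_over M) f" and h: "homogeneous2 M f"
    \<comment> \<open>Paths of size \<open>?\<kappa>\<close> have both endpoints in this compact
      part of the cone, on which the continuous \<open>f\<close> is bounded.\<close>
    let ?b = "{p \<in> cone_over M. cone_radius p \<le> sqrt ?\<kappa>}"
    have "bounded (f ` (?b \<times> ?b))"
      by (intro compact_imp_bounded compact_continuous_image compact_Times compact_cone_ball M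
          continuous_on_subset[OF f]) auto
    then obtain B where B: "\<forall>q\<in>?b \<times> ?b. \<bar>f q\<bar> \<le> B" by (auto simp: bounded_iff)
    show "has_bochner_integral \<mu>' (\<lambda>z. f (z 0, z T)) (\<integral>p. f p \<partial>\<gamma>)"
    proof (rule limit[OF coupling_tendsto[OF f]])
      fix z assume z: "z \<in> paths" and k: "path_size z = ?\<kappa>"
      have "cone_radius (z 0) \<le> sqrt ?\<kappa>" "cone_radius (z T) \<le> sqrt ?\<kappa>"
        using path_size_ge(2,3)[of z] by (auto simp: k intro: real_le_rsqrt)
      then have "(z 0, z T) \<in> ?b \<times> ?b" using pathD(1)[OF z ends(1)] pathD(1)[OF z ends(2)] by simp
      then show "\<bar>f (z 0, z T)\<bar> \<le> B" by (rule B[rule_format])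
    qed (use admissible_plansD(4)[OF \<mu> f h] in auto)
  next
    fix g :: "real \<times> 'a \<Rightarrow> real" assume g: "continuous_on ({0..T} \<times> M) g"
    obtain B where B: "0 \<le> B" "\<forall>t\<in>{0..T}. \<forall>x\<in>M. \<bar>g (t, x)\<bar> \<le> B" using continuous_function_bounded[OF g] .
    show "has_bochner_integral \<mu>' (marginal_functional g) (LINT x:M|normalized_lebesgue M. (LINT t:{0..T}|lborel. g (t, x)))"
    proof (rule limit[OF marginal_functional_tendsto[OF g]])
      fix z assume z: "z \<in> paths" and k: "path_size z = ?\<kappa>"
      have "\<bar>marginal_functional g z\<bar> \<le> B * marginal_functional (\<lambda>_. 1) z"
        by (rule marginal_functional_bound[OF g z B(2)])
      also have "\<dots> \<le> B * ?\<kappa>" using path_size_ge(1)[of z] B(1) unfolding k by (rule mult_left_mono)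
      finally show "\<bar>marginal_functional g z\<bar> \<le> B * ?\<kappa>" .
    qed (use admissible_plansD(5)[OF \<mu> g] in auto)
  qed
  have "action xbar T \<mu>' = (\<integral>\<^sup>+z. energy z \<partial>\<mu>')" by (rule action_eq[OF admissible_plansD(2)[OF adm]])
  also have "\<dots> = (\<integral>\<^sup>+u. energy (Z' u) \<partial>Q)"
    unfolding \<mu>'_def by (rule nn_integral_distr[OF Z'm]) measurable
  also have "\<dots> \<le> (\<integral>\<^sup>+u. liminf (\<lambda>n. energy (Z n u)) \<partial>Q)"
  proof (rule nn_integral_mono_AE)
    show "AE u in Q. energy (Z' u) \<le> liminf (\<lambda>n. energy (Z n u))"
      using lim by eventually_elim (rule energy_liminf)
  qed
  also have "\<dots> \<le> liminf (\<lambda>n. \<integral>\<^sup>+u. energy (Z n u) \<partial>Q)"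
    by (rule nn_integral_liminf) (rule measurable_compose[OF Zm energy_measurable])
  also have "(\<lambda>n. \<integral>\<^sup>+u. energy (Z n u) \<partial>Q) = (\<lambda>n. action xbar T (\<mu> (s n)))"
  proof
    fix n
    have "(\<integral>\<^sup>+u. energy (Z n u) \<partial>Q) = (\<integral>\<^sup>+z. energy z \<partial>distr Q P.mborel (Z n))"
      by (rule nn_integral_distr[OF Zm, symmetric]) measurable
    also have "\<dots> = action xbar T (\<mu> (s n))"
      unfolding Zd by (rule action_eq[OF admissible_plansD(2)[OF \<mu>], symmetric])
    finally show "(\<integral>\<^sup>+u. energy (Z n u) \<partial>Q) = action xbar T (\<mu> (s n))" .
  qed
  also have "liminf (\<lambda>n. action xbar T (\<mu> (s n))) \<le> I"
  proof (rule ennreal_le_epsilon)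
    fix e :: real assume e: "0 < e"
    then obtain n0 where n0: "1 / real (Suc n0) < e" using nat_approx_posE by blast
    show "liminf (\<lambda>n. action xbar T (\<mu> (s n))) \<le> I + ennreal e"
    proof (rule Liminf_le)
      show "\<forall>\<^sub>F n in sequentially. action xbar T (\<mu> (s n)) \<le> I + ennreal e"
        using eventually_ge_at_top[of n0]
      proof eventually_elim
        case (elim n)
        have "n0 \<le> s n" using elim seq_suble[OF s, of n] by linarith
        then have "1 / real (Suc (s n)) \<le> 1 / real (Suc n0)" by (intro divide_left_mono) auto
        then have "I + ennreal (1 / real (Suc (s n))) \<le> I + ennreal e"
          using n0 by (intro add_left_mono ennreal_leI) linarith
        with act[of "s n"] show ?case by (rule order.trans)
      qed
    qed simp
  qed
  finally have "action xbar T \<mu>' \<le> I" .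
  moreover have "I \<le> action xbar T \<nu>" if "\<nu> \<in> ?A" for \<nu> unfolding I_def by (rule INF_lower[OF that])
  ultimately show ?thesis using adm by (meson order.trans)
qed

end

section \<open>Positivity of the total size and the conclusion\<close>

text \<open>\<open>uniform_measure\<close> is a probability only for sets of positive finite
  measure. The nonempty open subset gives positivity and compactness gives finiteness.\<close>

lemma normalized_lebesgue_const:
  fixes M :: "'a::euclidean_space set"
  assumes U: "open U" "U \<noteq> {}" "U \<subseteq> M" and M: "compact M"
  shows "(LINT x:M|normalized_lebesgue M. c) = (c::real)"
proof -
  have Ms: "M \<in> sets lborel" using compact_imp_closed[OF M] by simp
  have "emeasure lborel M \<noteq> 0"
  proof
    assume "emeasure lborel M = 0"
    then have "negligible M" using Ms by (simp add: negligible_iff_null_sets null_sets_completionI null_setsI)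
    then show False using open_not_negligible[OF U(1,2)] negligible_subset[OF _ U(3)] by blast
  qed
  moreover have "emeasure lborel M \<noteq> \<infinity>"
    using emeasure_bounded_finite[OF compact_imp_bounded[OF M]] by simp
  ultimately have "emeasure (normalized_lebesgue M) M = 1"
    by (rule emeasure_uniform_measure_1)
  then show ?thesis using Ms by (simp add: set_lebesgue_integral_def measure_def)
qed

theorem proposition4p4:
  fixes U M :: "'a::euclidean_space set" and xbar :: 'a and T :: real
    and \<gamma> :: "('a cone \<times> 'a cone) measure"
  assumes "open U" "bounded U" "U \<noteq> {}" "lipschitz_boundary U" "M = closure U"
    and "xbar \<in> M" and "T > 0"
    and "\<gamma> \<in> P2 (cone_over M \<times> cone_over M)"
    and "\<exists>\<mu>\<in>admissible_plans xbar M T \<gamma>. action xbar T \<mu> < \<infinity>"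
  shows "\<exists>\<mu>\<in>admissible_plans xbar M T \<gamma>.
           \<forall>\<nu>\<in>admissible_plans xbar M T \<gamma>. action xbar T \<mu> \<le> action xbar T \<nu>"
proof -
  have M: "compact M" using assms(2,5) by (simp add: compact_closure)
  interpret cone_paths M xbar T by unfold_locales (use M assms in auto)
  \<comment> \<open>The marginal part of \<open>total_size \<gamma>\<close> equals \<open>T\<close>,
    while the part from \<open>\<gamma>\<close> integrates a nonnegative function; hence the total
    is positive.\<close>
  have "(LINT x:M|normalized_lebesgue M. (LINT t:{0..T}|lborel. 1)) = (LINT t:{0..T}|lborel. 1 :: real)"
    by (rule normalized_lebesgue_const[OF assms(1,3) _ M]) (simp add: assms(5) closure_subset)
  also have "\<dots> = T" using assms(7) by (simp add: set_lebesgue_integral_def)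
  finally have "0 < total_size \<gamma>"
    unfolding total_size_def using assms(7) by (simp add: add_pos_nonneg integral_nonneg_AE)
  then show ?thesis by (rule minimizer_exists[OF _ assms(9)])
qed

end
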